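(* Assume $\mathbb E[\xi^2+\xi^{-1}+\nu^3]<\infty$. Then $$\lim_{n\to\infty} n\,\mathbb E[C_n]=\frac1{c_1}.$$ If in addition $p_1\,m<1$, then $$\lim_{n\to\infty}\frac{\mathbb E[R_n]}{n}=c_1\,\mathbb E\Big[\frac1W\Big].$$
   Context: Let $\mathbf p=(p_k)_{k\ge0}$ be a probability distribution on the nonnegative integers with $p_0=0$ and finite mean $m=\sum_k kp_k>1$. Let $\mathbb T$ be a Galton–Watson tree with offspring distribution $\mathbf p$, rooted at $\varnothing$, and let $\nu$ denote the number of children of the root (so $\nu\sim\mathbf p$). For a vertex $x$, $|x|$ is its depth and $\overleftarrow{x}$ its parent. Let $\mathbb T_n=\{x\in\mathbb T:|x|=n\}$. The depth of the edge $e=\{\overleftarrow x,x\}$ is $d(e)=|x|$. Let $\xi$ be a strictly positive random variable; conditionally on $\mathbb T$, let $\{\xi(e)\}$ be i.i.d. copies of $\xi$, and assign to each edge $e$ the resistance $r(e)=m^{d(e)}\xi(e)$. $C_n$ is the effective conductance between $\varnothing$ and $\mathbb T_n$, and $R_n=1/C_n$ the effective resistance. $W=\lim_{n\to\infty}m^{-n}\#\mathbb T_n$ (a.s. limit). Constants: $a_1=m^{-2}\mathbb E[\nu(\nu-1)]$, $b_1=\mathbb E[\xi]$, $c_1=\dfrac{a_1b_1}{1-m^{-1}}$. *)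

theory Defs
  imports "HOL-Probability.Probability"
begin

text \<open>Ulam--Harris labelling: a vertex is a list of child indices, most recent
step first. The children of u are i # u, the parent of x is tl x, the depth
of x is length x, the root is the empty list. N u is the number of children of u.\<close>

definition gw_tree :: "(nat list \<Rightarrow> 'a \<Rightarrow> nat) \<Rightarrow> 'a \<Rightarrow> nat list set" where
  "gw_tree N \<omega> = {u. \<forall>k<length u. u ! k < N (drop (Suc k) u) \<omega>}"

definition gw_level :: "(nat list \<Rightarrow> 'a \<Rightarrow> nat) \<Rightarrow> nat \<Rightarrow> 'a \<Rightarrow> nat list set" where
  "gw_level N n \<omega> = {u \<in> gw_tree N \<omega>. length u = n}"

text \<open>Effective conductance between the root and level n, by Dirichlet's principle:
the infimum of the energy of functions equal to 1 at the root and 0 on level n.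
The edge {tl x, x} (x not the root) has resistance r x \<omega>.\<close>

definition eff_conductance ::
  "(nat list \<Rightarrow> 'a \<Rightarrow> nat) \<Rightarrow> (nat list \<Rightarrow> 'a \<Rightarrow> real) \<Rightarrow> nat \<Rightarrow> 'a \<Rightarrow> real" where
  "eff_conductance N r n \<omega> =
     Inf {(\<Sum>x \<in> {x \<in> gw_tree N \<omega>. 1 \<le> length x \<and> length x \<le> n}. (f (tl x) - f x)^2 / r x \<omega>)
          | f :: nat list \<Rightarrow> real. f [] = 1 \<and> (\<forall>x \<in> gw_level N n \<omega>. f x = 0)}"

definition eff_resistance ::
  "(nat list \<Rightarrow> 'a \<Rightarrow> nat) \<Rightarrow> (nat list \<Rightarrow> 'a \<Rightarrow> real) \<Rightarrow> nat \<Rightarrow> 'a \<Rightarrow> real" where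
  "eff_resistance N r n \<omega> = 1 / eff_conductance N r n \<omega>"

definition gw_W :: "(nat list \<Rightarrow> 'a \<Rightarrow> nat) \<Rightarrow> real \<Rightarrow> 'a \<Rightarrow> real" where
  "gw_W N m \<omega> = lim (\<lambda>n. real (card (gw_level N n \<omega>)) / m ^ n)"

end

theory Submission
  imports Defs
begin

text \<open>Let $C_n$ be the conductance and $x_n$, $y_n$, $z_n$ its first three moments. Decomposing the tree at
the root gives $C_{n+1} = m^{-1} \sum_{i<\nu} C_n^{(i)} / (1 + \xi_i C_n^{(i)})$ with independent copies,
so that $x_n - x_{n+1} = E[\xi C_n^2 / (1 + \xi C_n)]$ and $y_{n+1} \approx y_n / m + a_1 x_{n+1}^2$.
A correlation inequality gives $y_{n+1}/x_{n+1} \le y_n / (m x_n) + a_1 x_{n+1}$, whence $y_n = o(x_n)$ and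
$x_{n+1} \sim x_n$; then $z_n = O(x_n^3)$, $y_n / x_n^2 \to a_1 / (1 - 1/m)$ and
$1/x_{n+1} - 1/x_n \to c_1$.

For the resistance, $C_n / x_n - W_n$ is the average of independent centred copies, hence tends to $0$ in
mean square. It remains to show that $U_n = x_n / C_n$ is uniformly integrable. A vertex with one
child multiplies the resistance by $m$, while with two children the resistance exceeds $mK$ only if both
branches exceed $K$, which is unlikely because $W > 0$ almost surely. So $E (U_{n+1} - mK)^+$ is at most
$m (p_1 + \varepsilon)$ times $E (U_n - K)^+$ up to $o(1)$, and $m p_1 < 1$.\<close>

section \<open>Conductances as a recursive functional of the environment\<close>

text \<open>Expectations are computed under the product law \<open>Q\<close> of offspring numbers
  and edge factors attached to all labels, in the tree or not: passing to the subtree of a child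
  preserves \<open>Q\<close>, and different children give independent subtrees, so conductances
  become fixed functions of one environment. Since only E[1/\<xi>] is finite, C_1 may lack a second
  moment. An edge in series caps the conductance by 1/\<xi> and so gains one order of integrability;
  hence the moment recursion starts two levels later. That x_n tends to 0 must come first, without
  any control of y_n; it follows from Cauchy-Schwarz, E[C^2 / (1/\<xi> + C)] >= x_n^2 / (E[1/\<xi>]
  + x_n). The correlation inequality is Chebyshev's under the law biased by C: there C and 1/(1 +
  \<xi> C) are negatively correlated. The plain bound y_{n+1} <= y_n / m + a_1 x_{n+1}^2 would
  leave, after division by x_{n+1}, the ratio x_n / x_{n+1}, which is still uncontrolled. In the
  resistance part the threshold grows by the factor m per generation, so the excess is followed
  along thresholds m^j K, over which it decays geometrically.\<close>

definition subtree :: "nat \<Rightarrow> (nat list + nat list \<Rightarrow> real) \<Rightarrow> (nat list + nat list \<Rightarrow> real)" where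
  "subtree i y = (\<lambda>s. y (map_sum (\<lambda>u. u @ [i]) (\<lambda>u. u @ [i]) s))"

text \<open>An offspring number is read off a real coordinate by rounding down, so that all
  coordinates, offspring numbers (\<open>Inl\<close>) and edge factors (\<open>Inr\<close>), live in
  one Borel space.\<close>

definition children :: "(nat list + nat list \<Rightarrow> real) \<Rightarrow> nat" where
  "children y = nat \<lfloor>y (Inl [])\<rfloor>"

text \<open>Branches in parallel add up. The division by \<open>m\<close> is a change of scale: each
  edge lies one level deeper in the whole tree than in the tree planted on its child, hence is
  \<open>m\<close> times as resistant.\<close>

definition branch :: "real \<Rightarrow> ((nat list + nat list \<Rightarrow> real) \<Rightarrow> real) \<Rightarrow> (nat list + nat list \<Rightarrow> real) \<Rightarrow> real" where
  "branch m F y = (\<Sum>i<children y. F (subtree i y)) / m"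

text \<open>\<open>planted m n y\<close> is the conductance between the parent of the root and level \<open>n\<close> when an edge
of resistance \<open>y (Inr [])\<close> is attached above the root.\<close>

primrec planted :: "real \<Rightarrow> nat \<Rightarrow> (nat list + nat list \<Rightarrow> real) \<Rightarrow> real" where
  "planted m 0 y = 1 / y (Inr [])"
| "planted m (Suc n) y = branch m (planted m n) y / (1 + y (Inr []) * branch m (planted m n) y)"

primrec population :: "real \<Rightarrow> nat \<Rightarrow> (nat list + nat list \<Rightarrow> real) \<Rightarrow> real" where
  "population m 0 y = 1"
| "population m (Suc n) y = branch m (population m n) y"

definition environment ::
  "(nat list \<Rightarrow> 'a \<Rightarrow> nat) \<Rightarrow> (nat list \<Rightarrow> 'a \<Rightarrow> real) \<Rightarrow> 'a \<Rightarrow> nat list + nat list \<Rightarrow> real" where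
  "environment N X \<omega> = (\<lambda>s. case s of Inl u \<Rightarrow> real (N u \<omega>) | Inr u \<Rightarrow> X u \<omega>)"

section \<open>Splitting levels and edges over the children of the root\<close>

lemma subtree_environment:
  "subtree i (environment N X \<omega>) = environment (\<lambda>u. N (u @ [i])) (\<lambda>u. X (u @ [i])) \<omega>"
  by (auto simp: subtree_def environment_def fun_eq_iff split: sum.splits)

lemma children_environment [simp]: "children (environment N X \<omega>) = N [] \<omega>"
  by (simp add: children_def environment_def)

lemma environment_Inr [simp]: "environment N X \<omega> (Inr u) = X u \<omega>"
  by (simp add: environment_def)

text \<open>Labels list the most recent step first, so the last entry is the step from the root and
  appending \<open>[i]\<close> embeds the subtree of the child \<open>i\<close>.\<close>

lemma gw_tree_snoc:
  "u @ [i] \<in> gw_tree N \<omega> \<longleftrightarrow> i < N [] \<omega> \<and> u \<in> gw_tree (\<lambda>v. N (v @ [i])) \<omega>"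
proof -
  have "(\<forall>k<Suc (length u). (u @ [i]) ! k < N (drop (Suc k) (u @ [i])) \<omega>) \<longleftrightarrow>
        (\<forall>k<length u. u ! k < N (drop (Suc k) u @ [i]) \<omega>) \<and> i < N [] \<omega>"
    by (auto simp: nth_append less_Suc_eq)
  then show ?thesis
    by (auto simp: gw_tree_def)
qed

lemma gw_level_Suc:
  "gw_level N (Suc n) \<omega> = (\<Union>i<N [] \<omega>. (\<lambda>u. u @ [i]) ` gw_level (\<lambda>v. N (v @ [i])) n \<omega>)"
proof (intro set_eqI iffI)
  fix v assume v: "v \<in> gw_level N (Suc n) \<omega>"
  then obtain u i where "v = u @ [i]"
    by (cases v rule: rev_cases) (auto simp: gw_level_def)
  with v show "v \<in> (\<Union>i<N [] \<omega>. (\<lambda>u. u @ [i]) ` gw_level (\<lambda>v. N (v @ [i])) n \<omega>)"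
    by (auto simp: gw_level_def gw_tree_snoc)
qed (auto simp: gw_level_def gw_tree_snoc)

lemma gw_level_0: "gw_level N 0 \<omega> = {[]}"
  by (auto simp: gw_level_def gw_tree_def)

lemma finite_gw_level: "finite (gw_level N n \<omega>)"
  by (induction n arbitrary: N) (simp_all add: gw_level_0 gw_level_Suc)

lemma card_gw_level: 
  "real (card (gw_level N n \<omega>)) / m ^ n = population m n (environment N X \<omega>)"
proof (induction n arbitrary: N X)
  case (Suc n)
  have "card (gw_level N (Suc n) \<omega>) = (\<Sum>i<N [] \<omega>. card ((\<lambda>u. u @ [i]) ` gw_level (\<lambda>v. N (v @ [i])) n \<omega>))"
    unfolding gw_level_Suc by (rule card_UN_disjoint) (auto simp: finite_gw_level)
  also have "\<dots> = (\<Sum>i<N [] \<omega>. card (gw_level (\<lambda>v. N (v @ [i])) n \<omega>))"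
    by (intro sum.cong refl card_image) (auto simp: inj_on_def)
  finally have "real (card (gw_level N (Suc n) \<omega>)) / m ^ Suc n =
      (\<Sum>i<N [] \<omega>. real (card (gw_level (\<lambda>v. N (v @ [i])) n \<omega>)) / m ^ n) / m"
    by (simp add: sum_divide_distrib field_simps)
  then show ?case
    by (simp only: population.simps branch_def subtree_environment Suc[symmetric] children_environment)
qed (simp add: gw_level_0)

definition edges :: "(nat list \<Rightarrow> 'a \<Rightarrow> nat) \<Rightarrow> nat \<Rightarrow> 'a \<Rightarrow> nat list set" where
  "edges N n \<omega> = {x \<in> gw_tree N \<omega>. 1 \<le> length x \<and> length x \<le> n}"

lemma edges_0 [simp]: "edges N 0 \<omega> = {}"
  by (auto simp: edges_def)

lemma edges_snoc:
  "u @ [i] \<in> edges N (Suc n) \<omega> \<longleftrightarrow> i < N [] \<omega> \<and> (u = [] \<or> u \<in> edges (\<lambda>v. N (v @ [i])) n \<omega>)"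
  using gw_tree_snoc[of u i N \<omega>] by (cases u) (auto simp: edges_def gw_tree_def[of "\<lambda>v. N (v @ [i])"])

lemma edges_Suc:
  "edges N (Suc n) \<omega> =
     (\<Union>i<N [] \<omega>. insert [i] ((\<lambda>u. u @ [i]) ` edges (\<lambda>v. N (v @ [i])) n \<omega>))"
proof (intro set_eqI)
  fix v
  show "v \<in> edges N (Suc n) \<omega> \<longleftrightarrow>
      v \<in> (\<Union>i<N [] \<omega>. insert [i] ((\<lambda>u. u @ [i]) ` edges (\<lambda>v. N (v @ [i])) n \<omega>))"
  proof (cases v rule: rev_cases)
    case Nil
    then show ?thesis by (auto simp: edges_def)
  next
    case (snoc u i)
    show ?thesis unfolding snoc edges_snoc by auto
  qed
qed

lemma finite_edges: "finite (edges N n \<omega>)"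
  by (induction n arbitrary: N) (simp_all add: edges_Suc)

lemma sum_edges_Suc:
  fixes g :: "nat list \<Rightarrow> real"
  shows "(\<Sum>x\<in>edges N (Suc n) \<omega>. g x) =
    (\<Sum>i<N [] \<omega>. g [i] + (\<Sum>u\<in>edges (\<lambda>v. N (v @ [i])) n \<omega>. g (u @ [i])))"
proof -
  have "(\<Sum>x\<in>edges N (Suc n) \<omega>. g x) =
    (\<Sum>i<N [] \<omega>. sum g (insert [i] ((\<lambda>u. u @ [i]) ` edges (\<lambda>v. N (v @ [i])) n \<omega>)))"
    unfolding edges_Suc by (rule sum.UNION_disjoint) (auto simp: finite_edges)
  also have "\<dots> = (\<Sum>i<N [] \<omega>. g [i] + (\<Sum>u\<in>edges (\<lambda>v. N (v @ [i])) n \<omega>. g (u @ [i])))"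
  proof (intro sum.cong refl)
    fix i
    have "[i] \<notin> (\<lambda>u. u @ [i]) ` edges (\<lambda>v. N (v @ [i])) n \<omega>"
      by (auto simp: edges_def)
    then show "sum g (insert [i] ((\<lambda>u. u @ [i]) ` edges (\<lambda>v. N (v @ [i])) n \<omega>)) =
        g [i] + (\<Sum>u\<in>edges (\<lambda>v. N (v @ [i])) n \<omega>. g (u @ [i]))"
      by (simp add: finite_edges sum.reindex inj_on_def)
  qed
  finally show ?thesis .
qed

section \<open>Dirichlet's principle and the series and parallel laws\<close>

definition energy ::
  "real \<Rightarrow> (nat list \<Rightarrow> 'a \<Rightarrow> nat) \<Rightarrow> (nat list \<Rightarrow> 'a \<Rightarrow> real) \<Rightarrow> nat \<Rightarrow> 'a \<Rightarrow> (nat list \<Rightarrow> real) \<Rightarrow> real" where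
  "energy m N X n \<omega> f = (\<Sum>x\<in>edges N n \<omega>. (f (tl x) - f x)\<^sup>2 / (m ^ length x * X x \<omega>))"

lemma energy_Suc:
  "energy m N X (Suc n) \<omega> f =
    (\<Sum>i<N [] \<omega>. (f [] - f [i])\<^sup>2 / X [i] \<omega> +
       energy m (\<lambda>v. N (v @ [i])) (\<lambda>v. X (v @ [i])) n \<omega> (\<lambda>v. f (v @ [i]))) / m"
proof -
  have *: "(f (tl (u @ [i])) - f (u @ [i]))\<^sup>2 / (m ^ length (u @ [i]) * X (u @ [i]) \<omega>) =
      (f (tl u @ [i]) - f (u @ [i]))\<^sup>2 / (m ^ length u * X (u @ [i]) \<omega>) / m"
    if "u \<in> edges N' n \<omega>" for u i and N' :: "nat list \<Rightarrow> 'a \<Rightarrow> nat"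
    using that by (cases u) (auto simp: edges_def)
  show ?thesis
    unfolding energy_def sum_edges_Suc sum_divide_distrib add_divide_distrib
    by (intro sum.cong arg_cong2[where f="(+)"] refl *) (simp_all add: mult.commute)
qed

lemma energy_0 [simp]: "energy m N X 0 \<omega> f = 0"
  by (simp add: energy_def)

lemma branch_nonneg: 
  assumes "m > 0" "\<And>i. F (subtree i y) \<ge> 0"
  shows "branch m F y \<ge> 0"
  using assms by (auto simp: branch_def intro!: divide_nonneg_pos sum_nonneg)

lemma planted_nonneg:
  assumes "m > 0" "\<And>u. y (Inr u) \<ge> 0"
  shows "planted m n y \<ge> 0"
  using assms(2)
proof (induction n arbitrary: y)
  case (Suc n)
  have "branch m (planted m n) y \<ge> 0"
    using Suc.prems by (intro branch_nonneg \<open>m > 0\<close> Suc.IH) (auto simp: subtree_def)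
  then show ?case
    using Suc.prems by simp
qed simp

text \<open>This is the series law as a minimisation over the potential \<open>b\<close> between an
  edge of resistance \<open>x\<close> and a network of conductance \<open>C\<close>: the excess over
  the minimum is a perfect square, zero at \<open>b = a / (1 + x * C)\<close>.\<close>

lemma series_energy_ge:
  fixes a b x C :: real
  assumes "x > 0" "C \<ge> 0"
  shows "(a - b)\<^sup>2 / x + b\<^sup>2 * C \<ge> a\<^sup>2 * (C / (1 + x * C))"
proof -
  have pos: "1 + x * C > 0" using assms by (simp add: add_pos_nonneg)
  have "((a - b)\<^sup>2 / x + b\<^sup>2 * C) - a\<^sup>2 * (C / (1 + x * C)) = (a - b * (1 + x * C))\<^sup>2 / (x * (1 + x * C))"
    using assms pos by (simp add: divide_simps) (simp add: power2_eq_square algebra_simps)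
  also have "\<dots> \<ge> 0"
    using assms pos by simp
  finally show ?thesis by simp
qed

lemma series_energy_eq:
  fixes x C :: real
  assumes "x > 0" "C \<ge> 0"
  defines "t \<equiv> 1 / (1 + x * C)"
  shows "(1 - t)\<^sup>2 / x + t\<^sup>2 * C = C / (1 + x * C)"
proof -
  have pos: "1 + x * C > 0" using assms by (simp add: add_pos_nonneg)
  have "1 - t = x * C * t"
    using pos by (simp add: t_def divide_simps)
  then have "(1 - t)\<^sup>2 / x = (x * C * t)\<^sup>2 / x" by simp
  then have "(1 - t)\<^sup>2 / x + t\<^sup>2 * C = t * t * (C * (1 + x * C))"
    using assms(1) by (simp add: power2_eq_square algebra_simps)
  also have "\<dots> = C / (1 + x * C)"
    using pos by (simp add: t_def)
  finally show ?thesis .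
qed

text \<open>The root value \<open>f []\<close> stays general, and the bound scales with its square,
  because in the induction the subtree of the child \<open>i\<close> has root value
  \<open>f [i]\<close>.\<close>

lemma energy_ge:
  assumes "m > 0" "\<And>u. X u \<omega> > 0" "\<And>x. x \<in> gw_level N (Suc n) \<omega> \<Longrightarrow> f x = 0"
  shows "energy m N X (Suc n) \<omega> f \<ge> (f [])\<^sup>2 * branch m (planted m n) (environment N X \<omega>)"
  using assms(2,3)
proof (induction n arbitrary: N X f)
  case 0
  have "f [i] = 0" if "i < N [] \<omega>" for i
    using 0(2)[of "[i]"] that by (simp add: gw_level_Suc gw_level_0)
  then show ?case
    by (simp add: energy_Suc branch_def subtree_environment sum_distrib_left)
next
  case (Suc n)
  define C where "C i = branch m (planted m n) (environment (\<lambda>u. N (u @ [i])) (\<lambda>u. X (u @ [i])) \<omega>)" for i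
  have C: "C i \<ge> 0" for i
    unfolding C_def by (intro branch_nonneg planted_nonneg \<open>m > 0\<close>)
      (use Suc.prems in \<open>auto simp: subtree_environment less_imp_le\<close>)
  have "(f [])\<^sup>2 * branch m (planted m (Suc n)) (environment N X \<omega>) =
      (\<Sum>i<N [] \<omega>. (f [])\<^sup>2 * (C i / (1 + X [i] \<omega> * C i))) / m"
    by (simp add: branch_def[of m "planted m (Suc n)"] subtree_environment C_def sum_distrib_left)
  also have "\<dots> \<le> (\<Sum>i<N [] \<omega>. (f [] - f [i])\<^sup>2 / X [i] \<omega> + (f [i])\<^sup>2 * C i) / m"
    by (intro divide_right_mono sum_mono series_energy_ge) (use Suc.prems C \<open>m > 0\<close> in auto)
  also have "\<dots> \<le> energy m N X (Suc (Suc n)) \<omega> f"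
    unfolding energy_Suc[of m N X "Suc n"]
  proof (intro divide_right_mono sum_mono add_left_mono)
    fix i assume "i \<in> {..<N [] \<omega>}"
    then have "energy m (\<lambda>v. N (v @ [i])) (\<lambda>v. X (v @ [i])) (Suc n) \<omega> (\<lambda>v. f (v @ [i]))
        \<ge> (f ([] @ [i]))\<^sup>2 * C i"
      unfolding C_def using Suc.prems
      by (intro Suc.IH) (auto simp: gw_level_Suc[of N "Suc n"])
    then show "(f [i])\<^sup>2 * C i \<le> energy m (\<lambda>v. N (v @ [i])) (\<lambda>v. X (v @ [i])) (Suc n) \<omega> (\<lambda>v. f (v @ [i]))"
      by simp
  qed (use \<open>m > 0\<close> in simp)
  finally show ?case .
qed

text \<open>Optimal potentials of the subtrees are glued together after scaling by
  \<open>t i\<close>, the value at the child \<open>i\<close> that minimises the series energy of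
  its edge and its subtree.\<close>

lemma energy_attained:
  assumes "m > 0" "\<And>u. X u \<omega> > 0"
  shows "\<exists>f. f [] = 1 \<and> (\<forall>x \<in> gw_level N (Suc n) \<omega>. f x = 0) \<and>
    energy m N X (Suc n) \<omega> f = branch m (planted m n) (environment N X \<omega>)"
  using assms(2)
proof (induction n arbitrary: N X)
  case 0
  show ?case
    by (rule exI[of _ "\<lambda>x. if x = [] then 1 else 0"])
      (auto simp: energy_Suc branch_def subtree_environment gw_level_Suc gw_level_0)
next
  case (Suc n)
  define C where "C i = branch m (planted m n) (environment (\<lambda>u. N (u @ [i])) (\<lambda>u. X (u @ [i])) \<omega>)" for i
  define t where "t i = 1 / (1 + X [i] \<omega> * C i)" for i
  have C: "C i \<ge> 0" for i
    unfolding C_def by (intro branch_nonneg planted_nonneg \<open>m > 0\<close>)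
      (use Suc.prems in \<open>auto simp: subtree_environment less_imp_le\<close>)
  have "\<exists>f. f [] = 1 \<and> (\<forall>x \<in> gw_level (\<lambda>u. N (u @ [i])) (Suc n) \<omega>. f x = 0) \<and>
      energy m (\<lambda>u. N (u @ [i])) (\<lambda>u. X (u @ [i])) (Suc n) \<omega> f = C i" for i
    unfolding C_def by (intro Suc.IH Suc.prems)
  then obtain F where F: "F i [] = 1" "\<And>x. x \<in> gw_level (\<lambda>u. N (u @ [i])) (Suc n) \<omega> \<Longrightarrow> F i x = 0"
      "energy m (\<lambda>u. N (u @ [i])) (\<lambda>u. X (u @ [i])) (Suc n) \<omega> (F i) = C i" for i
    by metis
  \<comment> \<open>\<open>last x\<close> is the child of the root above \<open>x\<close>, and
    \<open>butlast x\<close> is the label of \<open>x\<close> inside the subtree of that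
    child.\<close>
  define f where "f x = (if x = [] then 1 else t (last x) * F (last x) (butlast x))" for x
  have scale: "energy m N' X' n' \<omega> (\<lambda>v. s * g v) = s\<^sup>2 * energy m N' X' n' \<omega> g"
    for N' X' n' and s :: real and g
    by (simp add: energy_def sum_distrib_left flip: right_diff_distrib power_mult_distrib)
  show ?case
  proof (intro exI[of _ f] conjI ballI)
    show "f [] = 1" by (simp add: f_def)
    show "f x = 0" if "x \<in> gw_level N (Suc (Suc n)) \<omega>" for x
      using that F(2) by (auto simp: gw_level_Suc[of N "Suc n"] f_def)
    have "energy m N X (Suc (Suc n)) \<omega> f = 
        (\<Sum>i<N [] \<omega>. (1 - t i)\<^sup>2 / X [i] \<omega> + (t i)\<^sup>2 * C i) / m"
      unfolding energy_Suc[of m N X "Suc n"] by (simp add: f_def F scale)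
    also have "\<dots> = (\<Sum>i<N [] \<omega>. C i / (1 + X [i] \<omega> * C i)) / m"
      unfolding t_def by (intro arg_cong2[where f="(/)"] sum.cong refl series_energy_eq C Suc.prems)
    also have "\<dots> = branch m (planted m (Suc n)) (environment N X \<omega>)"
      by (simp add: branch_def[of m "planted m (Suc n)"] subtree_environment C_def)
    finally show "energy m N X (Suc (Suc n)) \<omega> f = branch m (planted m (Suc n)) (environment N X \<omega>)" .
  qed
qed

text \<open>The lower bound and the glued potential make the infimum a minimum. Level 0 is excluded:
  there the root would have to carry both 1 and 0, so no potential is admissible and
  \<open>Inf {}\<close> is a default value.\<close>

theorem eff_conductance_eq_branch:
  assumes "m > 0" "\<And>u. X u \<omega> > 0"
  shows "eff_conductance N (\<lambda>x \<omega>. m ^ length x * X x \<omega>) (Suc n) \<omega> =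
    branch m (planted m n) (environment N X \<omega>)"
  unfolding eff_conductance_def edges_def[symmetric] energy_def[symmetric]
proof (rule cInf_eq_minimum)
  show "branch m (planted m n) (environment N X \<omega>) \<in>
     {energy m N X (Suc n) \<omega> f |f. f [] = 1 \<and> (\<forall>x\<in>gw_level N (Suc n) \<omega>. f x = 0)}"
    using energy_attained[of m X \<omega> N n] assms by force
next
  fix c assume "c \<in> {energy m N X (Suc n) \<omega> f |f. f [] = 1 \<and> (\<forall>x\<in>gw_level N (Suc n) \<omega>. f x = 0)}"
  then show "branch m (planted m n) (environment N X \<omega>) \<le> c"
    using energy_ge[of m X \<omega> N n] assms by force
qed

text \<open>The bound 1 on the \<open>Inl\<close> coordinates expresses p_0 = 0: no dead ends, hence
  strictly positive conductances. Asking it at every label makes the property pass to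
  subtrees.\<close>

definition positive_env :: "(nat list + nat list \<Rightarrow> real) \<Rightarrow> bool" where
  "positive_env y \<longleftrightarrow> (\<forall>u. y (Inr u) > 0) \<and> (\<forall>u. y (Inl u) \<ge> 1)"

lemma positive_env_subtree: "positive_env y \<Longrightarrow> positive_env (subtree i y)"
  by (auto simp: positive_env_def subtree_def)

lemma positive_env_resistance: "positive_env y \<Longrightarrow> y (Inr u) > 0"
  by (simp add: positive_env_def)

lemma positive_env_children: "positive_env y \<Longrightarrow> children y \<ge> 1"
  unfolding positive_env_def children_def by (metis le_floor_iff nat_mono nat_one_as_int of_int_1)

lemma branch_pos:
  assumes "m > 0" "positive_env y" "\<And>i. F (subtree i y) > 0"
  shows "branch m F y > 0"
  using assms positive_env_children[of y]
  by (auto simp: branch_def intro!: divide_pos_pos sum_pos simp: lessThan_empty_iff)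

lemma planted_pos:
  assumes "m > 0" "positive_env y"
  shows "planted m n y > 0"
  using assms(2)
proof (induction n arbitrary: y)
  case (Suc n)
  have "branch m (planted m n) y > 0"
    by (intro branch_pos Suc.IH positive_env_subtree Suc.prems assms(1))
  then show ?case
    using Suc.prems by (simp add: positive_env_def add_pos_pos)
qed (simp add: positive_env_def)

section \<open>Recurrences\<close>

text \<open>Once \<open>a n\<close> stays below some \<open>\<beta> < 1\<close>, every bound above
  the fixed point \<open>B / (1 - \<beta>)\<close> of \<open>t = \<beta> * t + B\<close> is
  preserved; \<open>K\<close> also covers the finitely many earlier terms.\<close>

lemma perturbed_contraction_bounded:
  fixes u a b :: "nat \<Rightarrow> real"
  assumes rec: "\<And>n. u (Suc n) \<le> a n * u n + b n" and u: "\<And>n. u n \<ge> 0"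
    and a: "a \<longlonglongrightarrow> \<alpha>" "\<alpha> < 1" and b: "\<And>n. b n \<le> B"
  shows "\<exists>K. \<forall>n. u n \<le> K"
proof -
  obtain \<beta> where \<beta>: "max \<alpha> 0 < \<beta>" "\<beta> < 1"
    using a(2) dense[of "max \<alpha> 0" 1] by auto
  have "eventually (\<lambda>n. a n < \<beta>) sequentially"
    using order_tendstoD(2)[OF a(1), of \<beta>] \<beta> by simp
  then obtain n0 where n0: "\<And>n. n \<ge> n0 \<Longrightarrow> a n < \<beta>"
    by (auto simp: eventually_sequentially)
  define K where "K = max (Max (u ` {..n0})) (B / (1 - \<beta>))"
  have init: "u n \<le> K" if "n \<le> n0" for n
    unfolding K_def using that by (intro max.coboundedI1 Max_ge) auto
  have "B / (1 - \<beta>) \<le> K" by (simp add: K_def)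
  then have B: "\<beta> * K + B \<le> K"
    using \<beta> by (simp add: divide_simps algebra_simps split: if_splits)
  have "u (n0 + n) \<le> K" for n
  proof (induction n)
    case (Suc n)
    have "u (n0 + Suc n) \<le> a (n0 + n) * u (n0 + n) + b (n0 + n)"
      using rec by simp
    also have "\<dots> \<le> \<beta> * K + B"
      using n0[of "n0 + n"] u[of "n0 + n"] Suc b \<beta>
      by (intro add_mono order_trans[OF mult_right_mono mult_left_mono]) auto
    finally show ?case using B by simp
  qed (simp add: init)
  then have "u n \<le> K" for n
    using init[of n] by (cases "n \<le> n0") (simp, metis le_add_diff_inverse nat_le_linear)
  then show ?thesis by blast
qed

lemma perturbed_contraction_null:
  fixes u a b :: "nat \<Rightarrow> real"
  assumes rec: "\<And>n. u (Suc n) \<le> a n * u n + b n" and u: "\<And>n. u n \<ge> 0"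
    and a: "a \<longlonglongrightarrow> \<alpha>" "\<alpha> < 1" and b: "b \<longlonglongrightarrow> 0"
  shows "u \<longlonglongrightarrow> 0"
proof (rule order_tendstoI)
  fix \<epsilon> :: real assume \<epsilon>: "0 < \<epsilon>"
  obtain \<beta> where \<beta>: "max \<alpha> 0 < \<beta>" "\<beta> < 1"
    using a(2) dense[of "max \<alpha> 0" 1] by auto
  \<comment> \<open>Errors of this size have the fixed point \<open>\<epsilon> / 2\<close> under
    \<open>t = \<beta> * t + error\<close>; the other half of \<open>\<epsilon>\<close> absorbs the
    decaying initial value.\<close>
  have pos: "0 < \<epsilon> / 2 * (1 - \<beta>)" using \<epsilon> \<beta> by simp
  have "eventually (\<lambda>n. a n < \<beta> \<and> b n < \<epsilon> / 2 * (1 - \<beta>)) sequentially"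
    using order_tendstoD(2)[OF a(1), of \<beta>] order_tendstoD(2)[OF b pos] \<beta> by (simp add: eventually_conj)
  then obtain n0 where n0: "\<And>n. n \<ge> n0 \<Longrightarrow> a n < \<beta> \<and> b n < \<epsilon> / 2 * (1 - \<beta>)"
    by (auto simp: eventually_sequentially)
  have bound: "u (n + n0) \<le> \<beta> ^ n * u n0 + \<epsilon> / 2" for n
  proof (induction n)
    case (Suc n)
    have "u (Suc n + n0) \<le> a (n + n0) * u (n + n0) + b (n + n0)"
      using rec by simp
    also have "\<dots> \<le> \<beta> * (\<beta> ^ n * u n0 + \<epsilon> / 2) + \<epsilon> / 2 * (1 - \<beta>)"
      using n0[of "n + n0"] u[of "n + n0"] Suc \<beta>
      by (intro add_mono order_trans[OF mult_right_mono mult_left_mono]) auto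
    also have "\<dots> = \<beta> ^ Suc n * u n0 + \<epsilon> / 2"
      by (simp add: field_simps)
    finally show ?case .
  qed (use \<epsilon> in simp)
  have "(\<lambda>n. \<beta> ^ n * u n0 + \<epsilon> / 2) \<longlonglongrightarrow> 0 * u n0 + \<epsilon> / 2"
    using \<beta> by (intro tendsto_intros LIMSEQ_realpow_zero) auto
  then have "eventually (\<lambda>n. \<beta> ^ n * u n0 + \<epsilon> / 2 < \<epsilon>) sequentially"
    by (rule order_tendstoD) (use \<epsilon> in simp)
  then have "eventually (\<lambda>n. u (n + n0) < \<epsilon>) sequentially"
    by eventually_elim (use bound in \<open>auto intro: le_less_trans\<close>)
  then show "eventually (\<lambda>n. u n < \<epsilon>) sequentially"
    by (rule eventually_sequentially_seg[THEN iffD1])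
next
  fix \<epsilon> :: real assume "\<epsilon> < 0"
  then have "\<epsilon> < u n" for n using u[of n] by linarith
  then show "eventually (\<lambda>n. \<epsilon> < u n) sequentially" by simp
qed

text \<open>A Stolz-Cesaro argument: \<open>real n * v n\<close> grows in each step by at most the
  deviation of one increment from \<open>c\<close>, so it is eventually below any linear function of
  positive slope.\<close>

lemma increments_tendsto_imp_slope:
  fixes u :: "nat \<Rightarrow> real"
  assumes "(\<lambda>n. u (Suc n) - u n) \<longlonglongrightarrow> c"
  shows "(\<lambda>n. u n / real n) \<longlonglongrightarrow> c"
proof -
  define v where "v n = \<bar>u n / real n - c\<bar>" for n
  have v: "real (Suc n) * v (Suc n) \<le> real n * v n + \<bar>u (Suc n) - u n - c\<bar>" if "n > 0" for n
  proof -
    have scale: "k * \<bar>t / k - c\<bar> = \<bar>t - k * c\<bar>" if "k > 0" for k t :: real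
    proof -
      have "k * \<bar>t / k - c\<bar> = \<bar>k * (t / k - c)\<bar>" using that by (simp add: abs_mult)
      also have "k * (t / k - c) = t - k * c" using that by (simp add: right_diff_distrib)
      finally show ?thesis .
    qed
    have "real (Suc n) * v (Suc n) = \<bar>u (Suc n) - real (Suc n) * c\<bar>"
      unfolding v_def by (rule scale) simp
    moreover have "real n * v n = \<bar>u n - real n * c\<bar>"
      unfolding v_def by (rule scale) (use that in simp)
    ultimately show ?thesis by (simp add: algebra_simps)
  qed
  have "(\<lambda>n. u n / real n - c) \<longlonglongrightarrow> 0"
  proof (rule LIMSEQ_I)
    fix \<epsilon> :: real assume \<epsilon>: "0 < \<epsilon>"
    from LIMSEQ_D[OF assms, of "\<epsilon> / 2"] \<epsilon>
    obtain k where k: "\<And>n. n \<ge> k \<Longrightarrow> \<bar>u (Suc n) - u n - c\<bar> < \<epsilon> / 2" by auto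
    \<comment> \<open>Starting at a successor keeps all indices positive, away from the default
      value of division by 0.\<close>
    define k' where "k' = Suc k"
    have bound: "real (n + k') * v (n + k') \<le> real k' * v k' + real n * (\<epsilon> / 2)" for n
    proof (induction n)
      case (Suc n)
      have "real (Suc n + k') * v (Suc n + k') \<le> real (n + k') * v (n + k') + \<epsilon> / 2"
        using v[of "n + k'"] k[of "n + k'"] by (simp add: k'_def)
      also have "\<dots> \<le> real k' * v k' + real n * (\<epsilon> / 2) + \<epsilon> / 2"
        using Suc by simp
      finally show ?case by (simp add: ring_distribs add_divide_distrib)
    qed simp
    obtain l where l: "real l > real k' * v k' / (\<epsilon> / 2)" using reals_Archimedean2 by blast
    have "norm (u n / real n - c - 0) < \<epsilon>" if n: "n \<ge> l + k'" for n
    proof -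
      obtain j where j: "n = j + k'" "j \<ge> l" using n by (metis add_le_cancel_right le_Suc_ex add.commute le_add1 trans_le_add2)
      have "real n * v n \<le> real k' * v k' + real j * (\<epsilon> / 2)" using bound[of j] j by simp
      also have "\<dots> < real j * (\<epsilon> / 2) + real j * (\<epsilon> / 2)"
        using l j \<epsilon> by (simp add: divide_simps mult.commute) (smt (verit) mult_left_mono of_nat_mono)
      also have "\<dots> \<le> real n * \<epsilon>" using j \<epsilon> by simp
      finally show ?thesis unfolding v_def using j by (simp add: k'_def)
    qed
    then show "\<exists>no. \<forall>n\<ge>no. norm (u n / real n - c - 0) < \<epsilon>" by blast
  qed
  then show ?thesis by (simp add: LIM_zero_iff)
qed

section \<open>Asymptotics of the abstract moment recursion\<close>

text \<open>\<open>x\<close>, \<open>y\<close>, \<open>z\<close> play the role of the first three moments of the conductance, and \<open>s\<close> that of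
the second moment of the conductance with one edge attached in series.\<close>

locale moment_recursion =
  fixes x y z s :: "nat \<Rightarrow> real" and m a b b' \<beta> k1 k2 :: real
  assumes m: "m > 1" and ab: "a > 0" "b > 0" "b' \<ge> 0" "k1 \<ge> 0" "k2 \<ge> 0" and \<beta>: "\<beta> > 0"
    and x_pos: "\<And>n. x n > 0" and y_nonneg: "\<And>n. y n \<ge> 0" and z_nonneg: "\<And>n. z n \<ge> 0"
    and x_decr: "\<And>n. x n - x (Suc n) \<ge> (x n)\<^sup>2 / (\<beta> + x n)"
    and x_upper: "\<And>n. x n - x (Suc n) \<le> b * y n"
    and x_lower: "\<And>n. x n - x (Suc n) \<ge> b * y n - b' * z n"
    and y_rec: "\<And>n. y (Suc n) = s n / m + a * (x (Suc n))\<^sup>2"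
    and s_upper: "\<And>n. s n \<le> y n" and s_lower: "\<And>n. s n \<ge> y n - 2 * b * z n"
    and s_corr: "\<And>n. s n * x n \<le> x (Suc n) * y n"
    and z_rec: "\<And>n. z (Suc n) \<le> z n / m\<^sup>2 + k1 * s n * x (Suc n) + k2 * (x (Suc n)) ^ 3"
begin

lemma x_Suc_le: "x (Suc n) \<le> x n"
proof -
  have "(x n)\<^sup>2 / (\<beta> + x n) \<ge> 0" using \<beta> x_pos[of n] by simp
  then show ?thesis using x_decr[of n] by simp
qed

text \<open>Nothing is known yet about \<open>y\<close>, so \<open>x_decr\<close>, which involves
  \<open>x\<close> alone, does the work: a limit \<open>L\<close> must satisfy
  \<open>L\<^sup>2 / (\<beta> + L) \<le> 0\<close>.\<close>

lemma x_tendsto_0: "x \<longlonglongrightarrow> 0"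
proof -
  have "decseq x" by (rule decseq_SucI) (rule x_Suc_le)
  then obtain L where L: "x \<longlonglongrightarrow> L" "\<And>i. L \<le> x i"
    using decseq_convergent[of x 0] x_pos less_imp_le by metis
  have "L \<ge> 0" using LIMSEQ_le_const[OF L(1), of 0] x_pos by (meson less_imp_le)
  have "(\<lambda>n. x n - x (Suc n)) \<longlonglongrightarrow> L - L"
    by (intro tendsto_diff L(1) LIMSEQ_Suc)
  moreover have "(\<lambda>n. (x n)\<^sup>2 / (\<beta> + x n)) \<longlonglongrightarrow> L\<^sup>2 / (\<beta> + L)"
    using \<beta> \<open>L \<ge> 0\<close> by (intro tendsto_intros L(1)) auto
  ultimately have "L\<^sup>2 / (\<beta> + L) \<le> L - L"
    using x_decr by (intro LIMSEQ_le) auto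
  then have "L = 0" using \<beta> \<open>L \<ge> 0\<close> by (simp add: divide_simps)
  then show ?thesis using L by simp
qed

text \<open>\<open>s_corr\<close> turns \<open>s n / x (Suc n)\<close> into at most
  \<open>y n / x n\<close>; with \<open>s_upper\<close> instead, the unknown ratio
  \<open>x n / x (Suc n)\<close> would enter the contraction factor. What remains is a contraction
  by \<open>1 / m\<close> with perturbation \<open>a * x (Suc n)\<close>.\<close>

lemma y_over_x_tendsto_0: "(\<lambda>n. y n / x n) \<longlonglongrightarrow> 0"
proof (rule perturbed_contraction_null)
  fix n
  have "s n / x (Suc n) \<le> y n / x n"
    using s_corr[of n] x_pos[of n] x_pos[of "Suc n"] by (simp add: divide_simps mult.commute)
  then have "(s n / x (Suc n)) / m \<le> (y n / x n) / m"
    using m by (intro divide_right_mono) auto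
  moreover have "y (Suc n) / x (Suc n) = (s n / x (Suc n)) / m + a * x (Suc n)"
    using x_pos[of "Suc n"] m by (simp add: y_rec divide_simps power2_eq_square)
  ultimately show "y (Suc n) / x (Suc n) \<le> 1 / m * (y n / x n) + a * x (Suc n)" by (simp add: mult.commute)
  show "y n / x n \<ge> 0" using x_pos[of n] y_nonneg by simp
next
  show "(\<lambda>n. a * x (Suc n)) \<longlonglongrightarrow> 0"
    using tendsto_mult[OF tendsto_const[of a] LIMSEQ_Suc[OF x_tendsto_0]] by simp
  show "1 / m < 1" using m by simp
qed simp

text \<open>By \<open>x_upper\<close> the relative loss in one step is at most
  \<open>b * (y n / x n)\<close>.\<close>

lemma x_ratio: "(\<lambda>n. x n / x (Suc n)) \<longlonglongrightarrow> 1"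
proof -
  have "(\<lambda>n. x (Suc n) / x n) \<longlonglongrightarrow> 1"
  proof (rule tendsto_sandwich)
    show "(\<lambda>n. 1 - b * (y n / x n)) \<longlonglongrightarrow> 1"
      using tendsto_diff[OF tendsto_const[of 1] tendsto_mult[OF tendsto_const[of b] y_over_x_tendsto_0]] by simp
    show "eventually (\<lambda>n. 1 - b * (y n / x n) \<le> x (Suc n) / x n) sequentially"
    proof (rule always_eventually, rule allI)
      fix n show "1 - b * (y n / x n) \<le> x (Suc n) / x n"
        using x_upper[of n] x_pos[of n] by (simp add: divide_simps)
    qed
    show "eventually (\<lambda>n. x (Suc n) / x n \<le> 1) sequentially"
    proof (rule always_eventually, rule allI)
      fix n show "x (Suc n) / x n \<le> 1" using x_Suc_le[of n] x_pos[of n] by simp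
    qed
  qed simp
  from tendsto_inverse[OF this] show ?thesis by (simp add: inverse_eq_divide)
qed

definition \<rho> where "\<rho> n = x n / x (Suc n)"
definition Y where "Y n = y n / (x n)\<^sup>2"
definition Z where "Z n = z n / (x n) ^ 3"

lemma \<rho>_tendsto: "\<rho> \<longlonglongrightarrow> 1" using x_ratio by (simp add: \<rho>_def[abs_def])
lemma Y_nonneg: "Y n \<ge> 0" using y_nonneg by (simp add: Y_def)
lemma Z_nonneg: "Z n \<ge> 0" using z_nonneg x_pos[of n] by (simp add: Z_def)

lemma y_Y: "y n = Y n * (x n)\<^sup>2" using x_pos[of n] by (simp add: Y_def)
lemma z_Z: "z n = Z n * (x n) ^ 3" using x_pos[of n] by (simp add: Z_def)
lemma x_\<rho>: "x n = \<rho> n * x (Suc n)" using x_pos[of "Suc n"] by (simp add: \<rho>_def)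

lemma Y_Suc: "Y (Suc n) = (s n / (x (Suc n))\<^sup>2) / m + a"
  using x_pos[of "Suc n"] by (simp add: Y_def y_rec divide_simps)

lemma s_over_upper: "s n / (x (Suc n))\<^sup>2 \<le> (\<rho> n)\<^sup>2 * Y n"
proof -
  have "s n \<le> (\<rho> n)\<^sup>2 * Y n * (x (Suc n))\<^sup>2"
    using s_upper[of n] by (simp add: y_Y x_\<rho>[of n] power_mult_distrib algebra_simps)
  then show ?thesis using x_pos[of "Suc n"] by (simp add: divide_simps)
qed

lemma s_over_lower: "s n / (x (Suc n))\<^sup>2 \<ge> (\<rho> n)\<^sup>2 * (Y n - 2 * b * Z n * x n)"
proof -
  have "x n ^ 3 = x n * (\<rho> n)\<^sup>2 * (x (Suc n))\<^sup>2"
    using x_\<rho>[of n] by (metis power2_eq_square power3_eq_cube power_mult_distrib mult.assoc)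
  then have "(\<rho> n)\<^sup>2 * (Y n - 2 * b * Z n * x n) * (x (Suc n))\<^sup>2 \<le> s n"
    using s_lower[of n] y_Y[of n] z_Z[of n] arg_cong[OF x_\<rho>[of n], of "\<lambda>t. t\<^sup>2"]
    by (simp add: power_mult_distrib algebra_simps)
  then show ?thesis using x_pos[of "Suc n"] by (simp add: divide_simps)
qed

text \<open>Now that \<open>\<rho>\<close> tends to 1, the crude \<open>s_upper\<close> is good
  enough: the contraction factor \<open>(\<rho> n)\<^sup>2 / m\<close> tends to
  \<open>1 / m\<close>.\<close>

lemma Y_bounded: "\<exists>K. \<forall>n. Y n \<le> K"
proof (rule perturbed_contraction_bounded)
  show "Y (Suc n) \<le> (\<rho> n)\<^sup>2 / m * Y n + a" for n
    using divide_right_mono[OF s_over_upper[of n], of m] m by (simp add: Y_Suc)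
  show "(\<lambda>n. (\<rho> n)\<^sup>2 / m) \<longlonglongrightarrow> 1\<^sup>2 / m" using m by (intro tendsto_intros \<rho>_tendsto) auto
  show "1\<^sup>2 / m < 1" using m by simp
qed (auto simp: Y_nonneg)

text \<open>After division by \<open>x (Suc n) ^ 3\<close> the recursion contracts with factor
  tending to \<open>1 / m\<^sup>2\<close>, while the mixed term is controlled by the bound on
  \<open>Y\<close>.\<close>

lemma Z_bounded: "\<exists>K. \<forall>n. Z n \<le> K"
proof -
  obtain K where K: "\<And>n. Y n \<le> K" using Y_bounded by blast
  have conv: "convergent (\<lambda>n. (\<rho> n)\<^sup>2)"
    using tendsto_power[OF \<rho>_tendsto, of 2] by (auto simp: convergent_def)
  then have "Bseq (\<lambda>n. (\<rho> n)\<^sup>2)" by (rule convergent_imp_Bseq)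
  then obtain R where R: "\<And>n. (\<rho> n)\<^sup>2 \<le> R" unfolding Bseq_def by auto
  show ?thesis
  proof (rule perturbed_contraction_bounded)
    fix n
    have "Z (Suc n) \<le> (z n / m\<^sup>2 + k1 * s n * x (Suc n) + k2 * (x (Suc n)) ^ 3) / x (Suc n) ^ 3"
      unfolding Z_def using z_rec[of n] x_pos[of "Suc n"] by (intro divide_right_mono) auto
    also have "\<dots> = (\<rho> n)^3 / m\<^sup>2 * Z n + k1 * (s n / (x (Suc n))\<^sup>2) + k2"
      using x_pos[of "Suc n"] m
      by (simp add: z_Z x_\<rho>[of n] power_mult_distrib add_divide_distrib power2_eq_square power3_eq_cube)
    also have "s n / (x (Suc n))\<^sup>2 \<le> R * K"
      using s_over_upper[of n] mult_mono[OF R K, of n n] Y_nonneg[of n] order_trans[OF zero_le_power2 R] by auto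
    finally show "Z (Suc n) \<le> (\<rho> n)^3 / m\<^sup>2 * Z n + (k1 * (R * K) + k2)"
      using ab by (simp add: mult_left_mono)
  next
    show "(\<lambda>n. (\<rho> n)^3 / m\<^sup>2) \<longlonglongrightarrow> 1^3 / m\<^sup>2" using m by (intro tendsto_intros \<rho>_tendsto) auto
    show "1^3 / m\<^sup>2 < 1" using m by (simp add: one_less_power)
  qed (auto simp: Z_nonneg)
qed

text \<open>This makes the third-moment corrections in \<open>x_lower\<close> and
  \<open>s_lower\<close> negligible against the square of \<open>x n\<close>.\<close>

lemma Zx_tendsto_0: "(\<lambda>n. Z n * x n) \<longlonglongrightarrow> 0"
proof -
  obtain K where K: "\<And>n. Z n \<le> K" using Z_bounded by blast
  show ?thesis
  proof (rule tendsto_sandwich[OF _ _ tendsto_const])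
    show "(\<lambda>n. K * x n) \<longlonglongrightarrow> 0" using tendsto_mult[OF tendsto_const[of K] x_tendsto_0] by simp
    show "eventually (\<lambda>n. Z n * x n \<le> K * x n) sequentially"
      using K x_pos by (intro always_eventually allI mult_right_mono) (auto intro: less_imp_le)
    show "eventually (\<lambda>n. 0 \<le> Z n * x n) sequentially"
      using Z_nonneg x_pos by (intro always_eventually allI mult_nonneg_nonneg) (auto intro: less_imp_le)
  qed
qed

lemma Y_tendsto: "Y \<longlonglongrightarrow> a / (1 - 1 / m)"
proof -
  \<comment> \<open>The fixed point of \<open>t = t / m + a\<close>, which is the limiting form of
    \<open>Y_Suc\<close>.\<close>
  define y' where "y' = a / (1 - 1 / m)"
  have y': "y' = y' / m + a" using m by (simp add: y'_def divide_simps) (simp add: algebra_simps)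
  obtain K where K: "\<And>n. Y n \<le> K" using Y_bounded by blast
  \<comment> \<open>The first summand is the cost of replacing the square of \<open>\<rho> n\<close>
    by 1, the second the gap between the upper and lower bounds on \<open>s\<close>.\<close>
  define \<epsilon> where "\<epsilon> n = \<bar>(\<rho> n)\<^sup>2 - 1\<bar> * K + (\<rho> n)\<^sup>2 * (2 * b * (Z n * x n))" for n
  have step: "\<bar>Y (Suc n) - y'\<bar> \<le> 1 / m * \<bar>Y n - y'\<bar> + \<epsilon> n / m" for n
  proof -
    have "Z n * x n \<ge> 0" using Z_nonneg x_pos less_imp_le by (intro mult_nonneg_nonneg) auto
    then have nn: "(\<rho> n)\<^sup>2 * (2 * b * (Z n * x n)) \<ge> 0" using ab by simp
    have "\<bar>s n / (x (Suc n))\<^sup>2 - (\<rho> n)\<^sup>2 * Y n\<bar> \<le> (\<rho> n)\<^sup>2 * (2 * b * (Z n * x n))"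
      using s_over_lower[of n] s_over_upper[of n] nn by (simp add: abs_le_iff algebra_simps)
    moreover have "\<bar>((\<rho> n)\<^sup>2 - 1) * Y n\<bar> \<le> \<bar>(\<rho> n)\<^sup>2 - 1\<bar> * K"
      using K[of n] Y_nonneg[of n] by (simp add: abs_mult mult_left_mono)
    ultimately have "\<bar>s n / (x (Suc n))\<^sup>2 - y'\<bar> \<le> \<bar>Y n - y'\<bar> + \<epsilon> n"
      unfolding \<epsilon>_def left_diff_distrib[of _ 1 "Y n"] by linarith
    then have "\<bar>s n / (x (Suc n))\<^sup>2 - y'\<bar> / m \<le> (\<bar>Y n - y'\<bar> + \<epsilon> n) / m"
      using m by (intro divide_right_mono) auto
    moreover have "Y (Suc n) - y' = (s n / (x (Suc n))\<^sup>2 - y') / m"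
      using y' by (simp add: Y_Suc diff_divide_distrib)
    ultimately show ?thesis using m by (simp add: abs_divide add_divide_distrib)
  qed
  have "(\<lambda>n. \<bar>Y n - y'\<bar>) \<longlonglongrightarrow> 0"
  proof (rule perturbed_contraction_null[where a = "\<lambda>_. 1 / m"], rule step)
    have "(\<lambda>n. \<epsilon> n / m) \<longlonglongrightarrow> (\<bar>1\<^sup>2 - 1\<bar> * K + 1\<^sup>2 * (2 * b * 0)) / m"
      unfolding \<epsilon>_def using m by (intro tendsto_intros \<rho>_tendsto Zx_tendsto_0) auto
    then show "(\<lambda>n. \<epsilon> n / m) \<longlonglongrightarrow> 0" by simp
    show "1 / m < 1" using m by simp
  qed simp_all
  then have "(\<lambda>n. Y n - y') \<longlonglongrightarrow> 0" by (rule tendsto_rabs_zero_cancel)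
  then show ?thesis by (simp add: LIM_zero_iff y'_def)
qed

text \<open>The increments of \<open>1 / x n\<close> are the drops of \<open>x\<close> divided by
  the square of \<open>x n\<close>, times \<open>\<rho> n\<close>. By \<open>x_upper\<close> and
  \<open>x_lower\<close> they tend to \<open>b\<close> times the limit of \<open>Y\<close>.\<close>

lemma inverse_x_slope: "(\<lambda>n. 1 / x n / real n) \<longlonglongrightarrow> a * b / (1 - 1 / m)"
proof (rule increments_tendsto_imp_slope[of "\<lambda>n. 1 / x n"])
  have "(\<lambda>n. (x n - x (Suc n)) / (x n)\<^sup>2) \<longlonglongrightarrow> b * (a / (1 - 1 / m))"
  proof (rule tendsto_sandwich)
    have "(\<lambda>n. b * Y n - b' * (Z n * x n)) \<longlonglongrightarrow> b * (a / (1 - 1 / m)) - b' * 0"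
      by (intro tendsto_intros Y_tendsto Zx_tendsto_0)
    then show "(\<lambda>n. b * Y n - b' * (Z n * x n)) \<longlonglongrightarrow> b * (a / (1 - 1 / m))" by simp
    show "(\<lambda>n. b * Y n) \<longlonglongrightarrow> b * (a / (1 - 1 / m))" by (intro tendsto_intros Y_tendsto)
    show "eventually (\<lambda>n. b * Y n - b' * (Z n * x n) \<le> (x n - x (Suc n)) / (x n)\<^sup>2) sequentially"
    proof (rule always_eventually, rule allI)
      fix n
      have "b * Y n - b' * (Z n * x n) = (b * y n - b' * z n) / (x n)\<^sup>2"
        using x_pos[of n] by (simp add: Y_def Z_def divide_simps power2_eq_square power3_eq_cube)
      also have "\<dots> \<le> (x n - x (Suc n)) / (x n)\<^sup>2"
        using x_lower[of n] by (intro divide_right_mono) auto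
      finally show "b * Y n - b' * (Z n * x n) \<le> (x n - x (Suc n)) / (x n)\<^sup>2" .
    qed
    show "eventually (\<lambda>n. (x n - x (Suc n)) / (x n)\<^sup>2 \<le> b * Y n) sequentially"
    proof (rule always_eventually, rule allI)
      fix n
      show "(x n - x (Suc n)) / (x n)\<^sup>2 \<le> b * Y n"
        using divide_right_mono[OF x_upper[of n], of "(x n)\<^sup>2"] by (simp add: Y_def)
    qed
  qed
  from tendsto_mult[OF this \<rho>_tendsto]
  have "(\<lambda>n. (x n - x (Suc n)) / (x n)\<^sup>2 * \<rho> n) \<longlonglongrightarrow> a * b / (1 - 1 / m)" by (simp add: mult.commute)
  moreover have "(x n - x (Suc n)) / (x n)\<^sup>2 * \<rho> n = 1 / x (Suc n) - 1 / x n" for n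
    using x_pos[of n] x_pos[of "Suc n"] by (simp add: \<rho>_def divide_simps power2_eq_square)
  ultimately show "(\<lambda>n. 1 / x (Suc n) - 1 / x n) \<longlonglongrightarrow> a * b / (1 - 1 / m)" by (simp only:)
qed

end

section \<open>The law of the environment\<close>

locale branching_environment =
  fixes p :: "nat pmf" and \<xi> :: "real measure" and m :: real
  assumes \<xi>_prob: "prob_space \<xi>" and \<xi>_sets: "sets \<xi> = sets borel"
    and \<xi>_pos: "AE x in \<xi>. x > 0"
    and \<xi>_square: "integrable \<xi> (\<lambda>x. x\<^sup>2)" and \<xi>_inverse: "integrable \<xi> (\<lambda>x. 1 / x)"
    and p_0: "pmf p 0 = 0" and p_cube: "integrable p (\<lambda>k. real k ^ 3)"
    and m_mean: "m = measure_pmf.expectation p real" and m_gt_1: "m > 1"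
begin

definition D :: "nat list + nat list \<Rightarrow> real measure" where
  "D s = (case s of Inl _ \<Rightarrow> distr (measure_pmf p) borel real | Inr _ \<Rightarrow> \<xi>)"

definition Q :: "(nat list + nat list \<Rightarrow> real) measure" where
  "Q = PiM UNIV D"

lemma sets_D [measurable_cong]: "sets (D s) = sets borel"
  by (auto simp: D_def \<xi>_sets split: sum.split)

lemma space_D [simp]: "space (D s) = UNIV"
  using sets_eq_imp_space_eq[OF sets_D] by simp

lemma prob_space_D: "prob_space (D s)"
  by (auto simp: D_def \<xi>_prob split: sum.split intro!: prob_space.prob_space_distr prob_space_measure_pmf)

sublocale D: product_prob_space D UNIV
  by (intro product_prob_spaceI prob_space_D)

sublocale Q: prob_space Q
  unfolding Q_def by (rule D.prob_space_axioms)

lemma sets_Q [measurable_cong]: "sets Q = sets (PiM UNIV (\<lambda>_. borel))"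
  unfolding Q_def by (intro sets_PiM_cong refl sets_D)

lemma space_Q [simp]: "space Q = UNIV"
  using sets_eq_imp_space_eq[OF sets_Q] by (simp add: space_PiM)

lemma subtree_measurable [measurable]: "subtree i \<in> measurable Q Q"
proof -
  have "(\<lambda>y. \<lambda>s\<in>UNIV. y (map_sum (\<lambda>u. u @ [i]) (\<lambda>u. u @ [i]) s)) \<in> measurable Q (PiM UNIV (\<lambda>_. borel))"
    by (intro measurable_restrict) simp
  moreover have "(\<lambda>y. \<lambda>s\<in>UNIV. y (map_sum (\<lambda>u. u @ [i]) (\<lambda>u. u @ [i]) s)) = subtree i"
    by (simp add: subtree_def fun_eq_iff)
  ultimately show ?thesis
    using measurable_cong_sets[OF refl sets_Q, of Q] by simp
qed

lemma inj_graft: "inj (map_sum (\<lambda>u. u @ [i]) (\<lambda>u. u @ [i]))"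
  by (rule sum.inj_map) (auto simp: inj_on_def)

lemma D_graft: "D (map_sum (\<lambda>u. u @ [i]) (\<lambda>u. u @ [i]) s) = D s"
  by (cases s) (simp_all add: D_def)

text \<open>Grafting below a child relabels coordinates injectively and keeps their marginal laws,
  so the product measure is invariant.\<close>

lemma distr_subtree: "distr Q Q (subtree i) = Q"
proof -
  let ?f = "map_sum (\<lambda>u. u @ [i]) (\<lambda>u. u @ [i])"
  have "distr (PiM UNIV D) (PiM UNIV (\<lambda>s. D (?f s))) (\<lambda>y. \<lambda>s\<in>UNIV. y (?f s)) = PiM UNIV (\<lambda>s. D (?f s))"
    by (intro distr_PiM_reindex prob_space_D inj_graft) auto
  moreover have "(\<lambda>y. \<lambda>s\<in>UNIV. y (?f s)) = subtree i"
    by (simp add: subtree_def fun_eq_iff)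
  ultimately show ?thesis by (simp add: D_graft Q_def)
qed

lemma prob_UNIV [simp]: "Q.prob UNIV = 1"
  using Q.prob_space by simp

lemma subtree_integrable_iff:
  fixes F :: "_ \<Rightarrow> real"
  assumes [measurable]: "F \<in> borel_measurable Q"
  shows "integrable Q (\<lambda>y. F (subtree i y)) \<longleftrightarrow> integrable Q F"
  using integrable_distr_eq[of "subtree i" Q Q F] by (simp add: distr_subtree)

lemma subtree_integral:
  fixes F :: "_ \<Rightarrow> real"
  assumes [measurable]: "F \<in> borel_measurable Q"
  shows "(\<integral>y. F (subtree i y) \<partial>Q) = (\<integral>y. F y \<partial>Q)"
  using integral_distr[of "subtree i" Q Q F] by (simp add: distr_subtree)

lemma AE_subtree: "AE y in Q. P y \<Longrightarrow> AE y in Q. P (subtree i y)"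
  using AE_distrD[of "subtree i" Q Q P, unfolded distr_subtree] by simp

lemma resample: "distr (D s \<Otimes>\<^sub>M Q) Q (\<lambda>(x, y). y(s := x)) = Q"
  using distr_pair_PiM_eq_PiM[of UNIV D s] prob_space_D by (simp add: Q_def)

lemma resample_measurable [measurable]: "(\<lambda>(x, y). y(s := x)) \<in> measurable (D s \<Otimes>\<^sub>M Q) Q"
proof -
  have "(\<lambda>(x, y). y(s := x)) \<in> measurable (D s \<Otimes>\<^sub>M Q) (PiM UNIV (\<lambda>_. borel))"
  proof (rule measurable_PiM_single')
    fix t
    show "(\<lambda>z. (case z of (x, y) \<Rightarrow> y(s := x)) t) \<in> borel_measurable (D s \<Otimes>\<^sub>M Q)"
      by (cases "t = s") (simp_all add: case_prod_beta)
  qed auto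
  then show ?thesis
    using measurable_cong_sets[OF refl sets_Q, of "D s \<Otimes>\<^sub>M Q"] by simp
qed

text \<open>Overwriting the coordinate \<open>s\<close> by an independent draw does not change
  \<open>Q\<close>. By \<open>inv\<close> the second argument of \<open>F\<close> does not look at
  that coordinate, so Fubini separates the two.\<close>

lemma integral_resample:
  fixes F :: "real \<Rightarrow> (nat list + nat list \<Rightarrow> real) \<Rightarrow> real"
  assumes F: "(\<lambda>(x, y). F x y) \<in> borel_measurable (D s \<Otimes>\<^sub>M Q)" and G: "(\<lambda>y. F (y s) y) \<in> borel_measurable Q"
    and inv: "\<And>x x' y. F x (y(s := x')) = F x y"
    and int1: "\<And>x. integrable Q (F x)" and int2: "integrable (D s) (\<lambda>x. \<integral>y. \<bar>F x y\<bar> \<partial>Q)"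
  shows "integrable Q (\<lambda>y. F (y s) y)" "(\<integral>y. F (y s) y \<partial>Q) = (\<integral>x. (\<integral>y. F x y \<partial>Q) \<partial>D s)"
proof -
  interpret pair_sigma_finite "D s" Q
    by (simp add: pair_sigma_finite.intro D.sigma_finite_measures Q.sigma_finite_measure_axioms)
  have int: "integrable (D s \<Otimes>\<^sub>M Q) (\<lambda>(x, y). F x y)"
    by (intro Fubini_integrable) (use F int1 int2 in auto)
  have eq: "(\<lambda>z. F ((case z of (x, y) \<Rightarrow> y(s := x)) s) (case z of (x, y) \<Rightarrow> y(s := x))) = (\<lambda>(x, y). F x y)"
    by (auto simp: inv fun_eq_iff)
  show "integrable Q (\<lambda>y. F (y s) y)"
    using integrable_distr_eq[OF resample_measurable[of s] G] int by (simp add: resample eq)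
  show "(\<integral>y. F (y s) y \<partial>Q) = (\<integral>x. (\<integral>y. F x y \<partial>Q) \<partial>D s)"
    using integral_distr[OF resample_measurable[of s] G] integral_fst'[OF int] by (simp add: resample eq)
qed

lemma integral_coordinate:
  assumes g [measurable]: "g \<in> borel_measurable borel"
  shows "integrable Q (\<lambda>y. g (y s) :: real) \<longleftrightarrow> integrable (D s) g"
    "(\<integral>y. g (y s) \<partial>Q) = (\<integral>x. g x \<partial>D s)"
proof -
  have d: "distr Q (D s) (\<lambda>y. y s) = D s"
    unfolding Q_def by (rule D.PiM_component) simp
  have [measurable]: "g \<in> borel_measurable (D s)"
    using g by (simp add: measurable_cong_sets[OF sets_D refl])
  have [measurable]: "(\<lambda>y. y s) \<in> measurable Q (D s)" by measurable
  show "integrable Q (\<lambda>y. g (y s)) \<longleftrightarrow> integrable (D s) g"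
    using integrable_distr_eq[of "\<lambda>y. y s" Q "D s" g] by (simp add: d)
  show "(\<integral>y. g (y s) \<partial>Q) = (\<integral>x. g x \<partial>D s)"
    using integral_distr[of "\<lambda>y. y s" Q "D s" g] by (simp add: d)
qed

lemma indep_coordinate:
  fixes g :: "real \<Rightarrow> real" and h :: "_ \<Rightarrow> real"
  assumes g [measurable]: "g \<in> borel_measurable borel" and h [measurable]: "h \<in> borel_measurable Q"
    and inv: "\<And>x y. h (y(s := x)) = h y"
    and int: "integrable (D s) g" "integrable Q h"
  shows "integrable Q (\<lambda>y. g (y s) * h y)" "(\<integral>y. g (y s) * h y \<partial>Q) = (\<integral>x. g x \<partial>D s) * (\<integral>y. h y \<partial>Q)"
proof -
  have [measurable]: "g \<in> borel_measurable (D s)"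
    using g by (simp add: measurable_cong_sets[OF sets_D refl])
  have 1: "(\<lambda>(x, y). g x * h y) \<in> borel_measurable (D s \<Otimes>\<^sub>M Q)" by measurable
  have 2: "(\<lambda>y. g (y s) * h y) \<in> borel_measurable Q" by measurable
  have 3: "integrable (D s) (\<lambda>x. \<integral>y. \<bar>g x * h y\<bar> \<partial>Q)"
    using int by (simp add: abs_mult)
  note * = integral_resample[of "\<lambda>x y. g x * h y", OF 1 2 _ _ 3]
  show "integrable Q (\<lambda>y. g (y s) * h y)" by (rule *) (simp_all add: inv int)
  have "(\<integral>y. g (y s) * h y \<partial>Q) = (\<integral>x. (\<integral>y. g x * h y \<partial>Q) \<partial>D s)" by (rule *) (simp_all add: inv int)
  then show "(\<integral>y. g (y s) * h y \<partial>Q) = (\<integral>x. g x \<partial>D s) * (\<integral>y. h y \<partial>Q)"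
    by simp
qed

lemma children_measurable [measurable]: "children \<in> measurable Q (count_space UNIV)"
  unfolding children_def[abs_def] by measurable

text \<open>Conditioning on the offspring number of the root: \<open>F k\<close> ignores that
  coordinate, so it can be averaged last, over \<open>p\<close>. The hypothesis \<open>int2\<close>
  is the absolute integrability required by Fubini.\<close>

lemma integral_children:
  fixes F :: "nat \<Rightarrow> (nat list + nat list \<Rightarrow> real) \<Rightarrow> real"
  assumes int1: "\<And>k. integrable Q (F k)" and int2: "integrable p (\<lambda>k. \<integral>y. \<bar>F k y\<bar> \<partial>Q)"
    and inv: "\<And>k x y. F k (y(Inl [] := x)) = F k y"
  shows "integrable Q (\<lambda>y. F (children y) y)"
    "(\<integral>y. F (children y) y \<partial>Q) = (\<integral>k. (\<integral>y. F k y \<partial>Q) \<partial>p)"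
proof -
  have [measurable]: "F k \<in> borel_measurable Q" for k using int1[of k] by measurable
  have nat[measurable]: "(\<lambda>x :: real. nat \<lfloor>x\<rfloor>) \<in> measurable borel (count_space UNIV)" by measurable
  have D: "D (Inl []) = distr (measure_pmf p) borel real" by (simp add: D_def)
  have 1: "(\<lambda>(x, y). F (nat \<lfloor>x\<rfloor>) y) \<in> borel_measurable (D (Inl []) \<Otimes>\<^sub>M Q)"
    unfolding case_prod_beta
    by (rule measurable_compose_countable[where f = "\<lambda>k z. F k (snd z)"]) measurable
  have 2: "(\<lambda>y. F (nat \<lfloor>y (Inl [])\<rfloor>) y) \<in> borel_measurable Q"
    by (rule measurable_compose_countable[where f = "\<lambda>k y. F k y"]) measurable
  have d: "integrable (D (Inl [])) (\<lambda>x. g (nat \<lfloor>x\<rfloor>)) \<longleftrightarrow> integrable p g"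
      "(\<integral>x. g (nat \<lfloor>x\<rfloor>) \<partial>D (Inl [])) = (\<integral>k. g k \<partial>p)" for g :: "nat \<Rightarrow> real"
  proof -
    have [measurable]: "(\<lambda>x :: real. g (nat \<lfloor>x\<rfloor>)) \<in> borel_measurable borel"
      by (rule measurable_compose[OF nat]) simp
    show "integrable (D (Inl [])) (\<lambda>x. g (nat \<lfloor>x\<rfloor>)) \<longleftrightarrow> integrable p g"
      unfolding D by (subst integrable_distr_eq) simp_all
    show "(\<integral>x. g (nat \<lfloor>x\<rfloor>) \<partial>D (Inl [])) = (\<integral>k. g k \<partial>p)"
      unfolding D by (subst integral_distr) simp_all
  qed
  have 3: "integrable (D (Inl [])) (\<lambda>x. \<integral>y. \<bar>F (nat \<lfloor>x\<rfloor>) y\<bar> \<partial>Q)"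
    using d(1)[of "\<lambda>k. \<integral>y. \<bar>F k y\<bar> \<partial>Q"] int2 by simp
  note * = integral_resample[of "\<lambda>x. F (nat \<lfloor>x\<rfloor>)", OF 1 2 _ _ 3]
  show "integrable Q (\<lambda>y. F (children y) y)"
    unfolding children_def by (rule *) (simp_all add: int1 inv)
  have "(\<integral>y. F (children y) y \<partial>Q) = (\<integral>x. (\<integral>y. F (nat \<lfloor>x\<rfloor>) y \<partial>Q) \<partial>D (Inl []))"
    unfolding children_def by (rule *) (simp_all add: int1 inv)
  then show "(\<integral>y. F (children y) y \<partial>Q) = (\<integral>k. (\<integral>y. F k y \<partial>Q) \<partial>p)"
    using d(2)[of "\<lambda>k. \<integral>y. F k y \<partial>Q"] by simp
qed

lemma subtree_upd [simp]: "subtree i (y(Inl [] := x)) = subtree i y" "subtree i (y(Inr [] := x)) = subtree i y"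
proof -
  have "map_sum (\<lambda>u. u @ [i]) (\<lambda>u. u @ [i]) s \<noteq> Inl []" "map_sum (\<lambda>u. u @ [i]) (\<lambda>u. u @ [i]) s \<noteq> Inr []" for s
    by (cases s; simp)+
  then show "subtree i (y(Inl [] := x)) = subtree i y" "subtree i (y(Inr [] := x)) = subtree i y"
    by (simp_all add: subtree_def fun_eq_iff)
qed

lemma children_upd [simp]: "children (y(Inr [] := x)) = children y"
  by (simp add: children_def)

lemma branch_upd [simp]: "branch m F (y(Inr [] := x)) = branch m F y"
  by (simp add: branch_def)

lemma branch_measurable [measurable (raw)]:
  assumes [measurable]: "F \<in> borel_measurable Q"
  shows "branch m F \<in> borel_measurable Q"
  unfolding branch_def[abs_def]
  by (rule measurable_compose_countable[where f = "\<lambda>k y. (\<Sum>i<k. F (subtree i y)) / m"]) measurable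

lemma planted_measurable [measurable]: "planted m n \<in> borel_measurable Q"
proof (induction n)
  case (Suc n)
  note [measurable] = Suc.IH
  show ?case unfolding planted.simps[abs_def] by measurable
qed (simp add: planted.simps[abs_def])

lemma population_measurable [measurable]: "population m n \<in> borel_measurable Q"
proof (induction n)
  case (Suc n)
  note [measurable] = Suc.IH
  show ?case unfolding population.simps[abs_def] by measurable
qed (simp add: population.simps[abs_def])

lemma indep_coordinates: "Q.indep_vars (\<lambda>_. borel) (\<lambda>s y. y s) UNIV"
proof -
  have "Q.indep_vars D (\<lambda>s y. y s) UNIV"
  proof (subst Q.indep_vars_iff_distr_eq_PiM)
    show "(\<lambda>y. y s) \<in> measurable Q (D s)" for s by measurable
    have "distr Q (PiM UNIV D) (\<lambda>x. x) = Q" by (simp add: Q_def)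
    moreover have "distr Q (D s) (\<lambda>y. y s) = D s" for s
      unfolding Q_def by (rule D.PiM_component) simp
    ultimately show "distr Q (PiM UNIV D) (\<lambda>y. \<lambda>s\<in>UNIV. y s) = PiM UNIV (\<lambda>s. distr Q (D s) (\<lambda>y. y s))"
      by (simp add: Q_def restrict_UNIV)
  qed simp
  then show ?thesis
    using Q.indep_vars_compose2[of D "\<lambda>s y. y s" UNIV "\<lambda>_ x. x" "\<lambda>_. borel"] by simp
qed

text \<open>Labels ending in different indices form disjoint blocks \<open>K i\<close> of
  independent coordinates, and each subtree reads only its own block.\<close>

lemma indep_subtrees:
  fixes F :: "nat \<Rightarrow> _ \<Rightarrow> real"
  assumes F: "\<And>i. F i \<in> borel_measurable Q"
  shows "Q.indep_vars (\<lambda>_. borel) (\<lambda>i y. F i (subtree i y)) UNIV"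
proof -
  define f where "f i = map_sum (\<lambda>u :: nat list. u @ [i]) (\<lambda>u :: nat list. u @ [i])" for i :: nat
  define K where "K i = range (f i)" for i
  have disj: "disjoint_family_on K UNIV"
  proof (auto simp: disjoint_family_on_def K_def f_def)
    fix i j s t assume "i \<noteq> j" "map_sum (\<lambda>u. u @ [i]) (\<lambda>u. u @ [i]) s = map_sum (\<lambda>u :: nat list. u @ [j]) (\<lambda>u :: nat list. u @ [j]) t"
    then show False by (cases s; cases t) auto
  qed
  have "Q.indep_vars (\<lambda>i. PiM (K i) (\<lambda>_. borel)) (\<lambda>i y. restrict (\<lambda>s. y s) (K i)) UNIV"
    by (rule Q.indep_vars_restrict[OF indep_coordinates _ disj]) simp
  moreover have "(\<lambda>z. F i (\<lambda>s. z (f i s))) \<in> borel_measurable (PiM (K i) (\<lambda>_. borel))" for i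
  proof (rule measurable_compose[OF _ F])
    have "(\<lambda>z. \<lambda>s\<in>UNIV. z (f i s)) \<in> measurable (PiM (K i) (\<lambda>_. borel)) (PiM UNIV (\<lambda>_. borel))"
      by (intro measurable_restrict measurable_component_singleton) (simp add: K_def)
    then show "(\<lambda>z s. z (f i s)) \<in> measurable (PiM (K i) (\<lambda>_. borel)) Q"
      unfolding measurable_cong_sets[OF refl sets_Q] restrict_UNIV .
  qed
  ultimately have "Q.indep_vars (\<lambda>_. borel) (\<lambda>i y. F i (\<lambda>s. restrict (\<lambda>s. y s) (K i) (f i s))) UNIV"
    by (rule Q.indep_vars_compose2)
  moreover have "(\<lambda>s. restrict (\<lambda>s. y s) (K i) (f i s)) = subtree i y" for i y
    by (auto simp: subtree_def f_def K_def fun_eq_iff)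
  ultimately show ?thesis by simp
qed

section \<open>Moments of a sum over the children of the root\<close>

lemma indep_subtree_sum:
  fixes F :: "_ \<Rightarrow> real"
  assumes "F \<in> borel_measurable Q"
  shows "Q.indep_var borel (\<lambda>y. F (subtree k y)) borel (\<lambda>y. \<Sum>i<k. F (subtree i y))"
  using Q.indep_vars_subset[OF indep_subtrees[of "\<lambda>_. F"], of "insert k {..<k}"] assms
  by (intro Q.indep_vars_sum) auto

lemma subtree_sum_mean:
  fixes F :: "_ \<Rightarrow> real"
  assumes F: "integrable Q F"
  shows "integrable Q (\<lambda>y. \<Sum>i<k. F (subtree i y))"
    "(\<integral>y. (\<Sum>i<k. F (subtree i y)) \<partial>Q) = real k * (\<integral>y. F y \<partial>Q)"
  using F by (simp_all add: subtree_integrable_iff subtree_integral)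

text \<open>The expanded square has \<open>k\<close> diagonal terms and \<open>k * (k - 1)\<close>
  products over ordered pairs of distinct, hence independent, children; the induction peels off one
  child.\<close>

lemma subtree_sum_square:
  fixes F :: "_ \<Rightarrow> real"
  assumes F [measurable]: "F \<in> borel_measurable Q" and F2: "integrable Q (\<lambda>y. (F y)\<^sup>2)"
  shows "integrable Q (\<lambda>y. (\<Sum>i<k. F (subtree i y))\<^sup>2)"
    "(\<integral>y. (\<Sum>i<k. F (subtree i y))\<^sup>2 \<partial>Q) =
       real k * (\<integral>y. (F y)\<^sup>2 \<partial>Q) + real k * (real k - 1) * (\<integral>y. F y \<partial>Q)\<^sup>2"
proof -
  have F1: "integrable Q F"
    by (rule Q.square_integrable_imp_integrable) (use F2 in auto)
  note sub = subtree_integrable_iff[of F] subtree_integrable_iff[of "\<lambda>y. (F y)\<^sup>2"]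
    subtree_integral[of F] subtree_integral[of "\<lambda>y. (F y)\<^sup>2"]
  have "integrable Q (\<lambda>y. (\<Sum>i<k. F (subtree i y))\<^sup>2) \<and> 
    (\<integral>y. (\<Sum>i<k. F (subtree i y))\<^sup>2 \<partial>Q) =
       real k * (\<integral>y. (F y)\<^sup>2 \<partial>Q) + real k * (real k - 1) * (\<integral>y. F y \<partial>Q)\<^sup>2"
  proof (induction k)
    case (Suc k)
    let ?S = "\<lambda>y. \<Sum>i<k. F (subtree i y)" and ?G = "\<lambda>y. F (subtree k y)"
    have eq: "(\<lambda>y. (\<Sum>i<Suc k. F (subtree i y))\<^sup>2) = (\<lambda>y. (?S y)\<^sup>2 + 2 * (?G y * ?S y) + (?G y)\<^sup>2)"
      by (simp add: power2_eq_square algebra_simps fun_eq_iff)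
    have 1: "integrable Q (\<lambda>y. ?G y * ?S y)"
      by (rule Q.indep_var_integrable[OF indep_subtree_sum]) (simp_all add: subtree_sum_mean sub F1)
    have 2: "(\<integral>y. ?G y * ?S y \<partial>Q) = real k * (\<integral>y. F y \<partial>Q)\<^sup>2"
      by (subst Q.indep_var_lebesgue_integral[OF indep_subtree_sum])
        (simp_all add: subtree_sum_mean sub F1 power2_eq_square)
    show ?case
      unfolding eq using Suc 1 2 F1 F2 by (simp add: sub algebra_simps)
  qed simp
  then show "integrable Q (\<lambda>y. (\<Sum>i<k. F (subtree i y))\<^sup>2)"
    "(\<integral>y. (\<Sum>i<k. F (subtree i y))\<^sup>2 \<partial>Q) =
       real k * (\<integral>y. (F y)\<^sup>2 \<partial>Q) + real k * (real k - 1) * (\<integral>y. F y \<partial>Q)\<^sup>2" by auto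
qed

text \<open>The coefficients count triples of children by coincidence pattern: all equal, exactly
  two equal (three positions for the odd one), all distinct.\<close>

lemma subtree_sum_cube:
  fixes F :: "_ \<Rightarrow> real"
  assumes F [measurable]: "F \<in> borel_measurable Q" and F2: "integrable Q (\<lambda>y. (F y)\<^sup>2)"
    and F3: "integrable Q (\<lambda>y. (F y)^3)"
  shows "integrable Q (\<lambda>y. (\<Sum>i<k. F (subtree i y))^3)"
    "(\<integral>y. (\<Sum>i<k. F (subtree i y))^3 \<partial>Q) =
       real k * (\<integral>y. (F y)^3 \<partial>Q) + 3 * real k * (real k - 1) * (\<integral>y. (F y)\<^sup>2 \<partial>Q) * (\<integral>y. F y \<partial>Q)
       + real k * (real k - 1) * (real k - 2) * (\<integral>y. F y \<partial>Q)^3"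
proof -
  have F1: "integrable Q F"
    by (rule Q.square_integrable_imp_integrable) (use F2 in auto)
  note sub = subtree_integrable_iff[of F] subtree_integrable_iff[of "\<lambda>y. (F y)\<^sup>2"] subtree_integrable_iff[of "\<lambda>y. (F y)^3"]
    subtree_integral[of F] subtree_integral[of "\<lambda>y. (F y)\<^sup>2"] subtree_integral[of "\<lambda>y. (F y)^3"]
  have "integrable Q (\<lambda>y. (\<Sum>i<k. F (subtree i y))^3) \<and> 
    (\<integral>y. (\<Sum>i<k. F (subtree i y))^3 \<partial>Q) =
       real k * (\<integral>y. (F y)^3 \<partial>Q) + 3 * real k * (real k - 1) * (\<integral>y. (F y)\<^sup>2 \<partial>Q) * (\<integral>y. F y \<partial>Q)
       + real k * (real k - 1) * (real k - 2) * (\<integral>y. F y \<partial>Q)^3"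
  proof (induction k)
    case (Suc k)
    let ?S = "\<lambda>y. \<Sum>i<k. F (subtree i y)" and ?G = "\<lambda>y. F (subtree k y)"
    have eq: "(\<lambda>y. (\<Sum>i<Suc k. F (subtree i y))^3) =
        (\<lambda>y. (?S y)^3 + 3 * (?G y * (?S y)\<^sup>2) + 3 * ((?G y)\<^sup>2 * ?S y) + (?G y)^3)"
    proof
      have cube: "(u + v)^3 = u^3 + 3 * (v * u\<^sup>2) + 3 * (v\<^sup>2 * u) + v^3" for u v :: real
        by (simp add: power2_eq_square power3_eq_cube algebra_simps)
      show "(\<Sum>i<Suc k. F (subtree i y))^3 =
          (?S y)^3 + 3 * (?G y * (?S y)\<^sup>2) + 3 * ((?G y)\<^sup>2 * ?S y) + (?G y)^3" for y
        by (simp only: sum.lessThan_Suc cube)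
    qed
    have ind1: "Q.indep_var borel ?G borel (\<lambda>y. (?S y)\<^sup>2)"
    proof -
      have "Q.indep_var borel ((\<lambda>x. x) \<circ> ?G) borel ((\<lambda>x. x\<^sup>2) \<circ> ?S)"
        by (rule Q.indep_var_compose[OF indep_subtree_sum[OF F]]) simp_all
      then show ?thesis unfolding comp_def .
    qed
    have ind2: "Q.indep_var borel (\<lambda>y. (?G y)\<^sup>2) borel ?S"
    proof -
      have "Q.indep_var borel ((\<lambda>x. x\<^sup>2) \<circ> ?G) borel ((\<lambda>x. x) \<circ> ?S)"
        by (rule Q.indep_var_compose[OF indep_subtree_sum[OF F]]) simp_all
      then show ?thesis unfolding comp_def .
    qed
    have int: "integrable Q (\<lambda>y. ?G y * (?S y)\<^sup>2)" "integrable Q (\<lambda>y. (?G y)\<^sup>2 * ?S y)"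
      by (rule Q.indep_var_integrable[OF ind1], simp_all add: subtree_sum_square sub F1 F2)
        (rule Q.indep_var_integrable[OF ind2], simp_all add: subtree_sum_mean sub F1 F2)
    have 1: "(\<integral>y. ?G y * (?S y)\<^sup>2 \<partial>Q) =
        (\<integral>y. F y \<partial>Q) * (real k * (\<integral>y. (F y)\<^sup>2 \<partial>Q) + real k * (real k - 1) * (\<integral>y. F y \<partial>Q)\<^sup>2)"
      by (subst Q.indep_var_lebesgue_integral[OF ind1])
        (simp_all add: subtree_sum_mean subtree_sum_square sub F1 F2)
    have 2: "(\<integral>y. (?G y)\<^sup>2 * ?S y \<partial>Q) = (\<integral>y. (F y)\<^sup>2 \<partial>Q) * (real k * (\<integral>y. F y \<partial>Q))"
      by (subst Q.indep_var_lebesgue_integral[OF ind2])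
        (simp_all add: subtree_sum_mean subtree_sum_square sub F1 F2)
    have "(\<integral>y. (\<Sum>i<Suc k. F (subtree i y))^3 \<partial>Q) =
        (\<integral>y. (?S y)^3 \<partial>Q) + 3 * (\<integral>y. ?G y * (?S y)\<^sup>2 \<partial>Q) + 3 * (\<integral>y. (?G y)\<^sup>2 * ?S y \<partial>Q) + (\<integral>y. (F y)^3 \<partial>Q)"
      unfolding eq sub(6)[OF borel_measurable_power[OF F], of k, symmetric] integral_mult_right_zero[symmetric]
      using Suc.IH[THEN conjunct1] int F3
      by (subst Bochner_Integration.integral_add; (intro Bochner_Integration.integrable_add integrable_mult_right)?;
          simp add: sub)+
    also have "\<dots> = real (Suc k) * (\<integral>y. (F y)^3 \<partial>Q)
        + 3 * real (Suc k) * (real (Suc k) - 1) * (\<integral>y. (F y)\<^sup>2 \<partial>Q) * (\<integral>y. F y \<partial>Q)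
        + real (Suc k) * (real (Suc k) - 1) * (real (Suc k) - 2) * (\<integral>y. F y \<partial>Q)^3"
    proof -
      have "k * \<mu>3 + 3 * k * (k - 1) * \<mu>2 * \<mu>1 + k * (k - 1) * (k - 2) * \<mu>1 ^ 3
          + 3 * (\<mu>1 * (k * \<mu>2 + k * (k - 1) * \<mu>1\<^sup>2)) + 3 * (\<mu>2 * (k * \<mu>1)) + \<mu>3 =
          (1 + k) * \<mu>3 + 3 * (1 + k) * (1 + k - 1) * \<mu>2 * \<mu>1 + (1 + k) * (1 + k - 1) * (1 + k - 2) * \<mu>1 ^ 3"
        for k \<mu>1 \<mu>2 \<mu>3 :: real
        by (simp add: power2_eq_square power3_eq_cube algebra_simps)
      then show ?thesis
        unfolding 1 2 of_nat_Suc Suc.IH[THEN conjunct2] .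
    qed
    finally have "(\<integral>y. (\<Sum>i<Suc k. F (subtree i y))^3 \<partial>Q) = \<dots>" .
    moreover have "integrable Q (\<lambda>y. (\<Sum>i<Suc k. F (subtree i y))^3)"
      unfolding eq using Suc.IH[THEN conjunct1] int F3
      by (intro Bochner_Integration.integrable_add integrable_mult_right) (simp_all add: sub)
    ultimately show ?case by (rule conjI[rotated])
  qed simp
  then show "integrable Q (\<lambda>y. (\<Sum>i<k. F (subtree i y))^3)"
    "(\<integral>y. (\<Sum>i<k. F (subtree i y))^3 \<partial>Q) =
       real k * (\<integral>y. (F y)^3 \<partial>Q) + 3 * real k * (real k - 1) * (\<integral>y. (F y)\<^sup>2 \<partial>Q) * (\<integral>y. F y \<partial>Q)
       + real k * (real k - 1) * (real k - 2) * (\<integral>y. F y \<partial>Q)^3" by auto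
qed

section \<open>Averaging over the random number of children\<close>

lemma p_moments_integrable:
  "integrable p real" "integrable p (\<lambda>k. (real k)\<^sup>2)" "integrable p (\<lambda>k. real k ^ 3)"
proof -
  have "real k ^ j \<le> real k ^ 3" if "1 \<le> j" "j \<le> 3" for k j
    using that by (cases "k = 0") (auto intro: power_increasing simp: power_0_left)
  from this[of 1] this[of 2]
  show "integrable p real" "integrable p (\<lambda>k. (real k)\<^sup>2)"
    by (auto intro!: Bochner_Integration.integrable_bound[OF p_cube])
qed (rule p_cube)

definition a where "a = measure_pmf.expectation p (\<lambda>k. real k * (real k - 1)) / m\<^sup>2"
definition a3 where "a3 = measure_pmf.expectation p (\<lambda>k. real k * (real k - 1) * (real k - 2)) / m ^ 3"
definition b where "b = (\<integral>x. x \<partial>\<xi>)"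
definition b2 where "b2 = (\<integral>x. x\<^sup>2 \<partial>\<xi>)"
definition binv where "binv = (\<integral>x. 1 / x \<partial>\<xi>)"

lemma p_factorial_moments_integrable:
  "integrable p (\<lambda>k. real k * (real k - 1))" "integrable p (\<lambda>k. real k * (real k - 1) * (real k - 2))"
proof -
  have eq: "(\<lambda>k. real k * (real k - 1)) = (\<lambda>k. (real k)\<^sup>2 - real k)"
    "(\<lambda>k. real k * (real k - 1) * (real k - 2)) = (\<lambda>k. real k ^ 3 - 3 * (real k)\<^sup>2 + 2 * real k)"
    by (simp_all add: fun_eq_iff power2_eq_square power3_eq_cube algebra_simps)
  show "integrable p (\<lambda>k. real k * (real k - 1))" "integrable p (\<lambda>k. real k * (real k - 1) * (real k - 2))"
    unfolding eq using p_moments_integrable by auto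
qed

lemma a_pos: "a > 0"
proof -
  have "m - 1 = (\<integral>k. real k - 1 \<partial>p)"
    using p_moments_integrable by (simp add: m_mean)
  also have "\<dots> \<le> (\<integral>k. real k * (real k - 1) \<partial>p)"
  proof (rule integral_mono)
    fix k show "real k - 1 \<le> real k * (real k - 1)"
      by (cases k) (auto simp: algebra_simps)
  qed (use p_moments_integrable p_factorial_moments_integrable in auto)
  finally show ?thesis using m_gt_1 by (simp add: a_def)
qed

lemma a3_nonneg: "a3 \<ge> 0"
proof -
  have "0 \<le> real k * (real k - 1) * (real k - 2)" for k :: nat
  proof (cases "k \<le> 2")
    case True
    then have "k = 0 \<or> k = 1 \<or> k = 2" by linarith
    then show ?thesis by auto
  qed simp
  then show ?thesis
    unfolding a3_def using m_gt_1 by (intro divide_nonneg_pos Bochner_Integration.integral_nonneg) auto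
qed

text \<open>The mean offspring number cancels the normalisation \<open>1 / m\<close>. As
  \<open>F\<close> may change sign, the Fubini condition is verified through the triangle
  inequality.\<close>

lemma branch_integral:
  assumes F: "integrable Q F"
  shows "integrable Q (branch m F)" "(\<integral>y. branch m F y \<partial>Q) = (\<integral>y. F y \<partial>Q)"
proof -
  have [measurable]: "F \<in> borel_measurable Q" using F by measurable
  define G where "G k y = (\<Sum>i<k. F (subtree i y)) / m" for k y
  have B: "branch m F = (\<lambda>y. G (children y) y)" by (simp add: branch_def G_def fun_eq_iff)
  have G: "integrable Q (G k)" "(\<integral>y. G k y \<partial>Q) = real k * (\<integral>y. F y \<partial>Q) / m" for k
    unfolding G_def[abs_def] by (simp_all add: subtree_sum_mean F)
  have inv: "G k (y(Inl [] := x)) = G k y" for k y x by (simp add: G_def)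
  have abs: "(\<integral>y. \<bar>G k y\<bar> \<partial>Q) \<le> real k * (\<integral>y. \<bar>F y\<bar> \<partial>Q) / m" for k
  proof -
    have "(\<integral>y. \<bar>G k y\<bar> \<partial>Q) \<le> (\<integral>y. (\<Sum>i<k. \<bar>F (subtree i y)\<bar>) / m \<partial>Q)"
    proof (rule integral_mono)
      show "integrable Q (\<lambda>y. \<bar>G k y\<bar>)" using G by auto
      show "integrable Q (\<lambda>y. (\<Sum>i<k. \<bar>F (subtree i y)\<bar>) / m)"
        using subtree_sum_mean(1)[of "\<lambda>y. \<bar>F y\<bar>" k] F by simp
    qed (use m_gt_1 in \<open>auto simp: G_def abs_divide intro!: divide_right_mono sum_abs\<close>)
    also have "\<dots> = real k * (\<integral>y. \<bar>F y\<bar> \<partial>Q) / m"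
      using subtree_sum_mean[of "\<lambda>y. \<bar>F y\<bar>" k] F by simp
    finally show ?thesis .
  qed
  have int: "integrable p (\<lambda>k. \<integral>y. \<bar>G k y\<bar> \<partial>Q)"
  proof (rule Bochner_Integration.integrable_bound)
    show "integrable p (\<lambda>k. real k * (\<integral>y. \<bar>F y\<bar> \<partial>Q) / m)" using p_moments_integrable by simp
    show "AE k in p. norm (\<integral>y. \<bar>G k y\<bar> \<partial>Q) \<le> norm (real k * (\<integral>y. \<bar>F y\<bar> \<partial>Q) / m)"
    proof (rule AE_I2)
      fix k
      have "0 \<le> (\<integral>y. \<bar>G k y\<bar> \<partial>Q)" by (intro Bochner_Integration.integral_nonneg) auto
      with abs[of k] m_gt_1 show "norm (\<integral>y. \<bar>G k y\<bar> \<partial>Q) \<le> norm (real k * (\<integral>y. \<bar>F y\<bar> \<partial>Q) / m)" by simp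
    qed
  qed simp
  show "integrable Q (branch m F)"
    unfolding B by (rule integral_children(1)[OF G(1) int inv])
  have "(\<integral>y. branch m F y \<partial>Q) = (\<integral>k. (\<integral>y. G k y \<partial>Q) \<partial>p)"
    unfolding B by (rule integral_children(2)[OF G(1) int inv])
  also have "\<dots> = (\<integral>y. F y \<partial>Q)"
    using m_gt_1 m_mean by (simp add: G)
  finally show "(\<integral>y. branch m F y \<partial>Q) = (\<integral>y. F y \<partial>Q)" .
qed

text \<open>For centred \<open>F\<close> the last term vanishes and \<open>branch\<close> shrinks
  the second moment by exactly \<open>1 / m\<close>. This drives both the population martingale and
  its comparison with the conductance.\<close>

lemma branch_square:
  assumes F [measurable]: "F \<in> borel_measurable Q" and F2: "integrable Q (\<lambda>y. (F y)\<^sup>2)"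
  shows "integrable Q (\<lambda>y. (branch m F y)\<^sup>2)"
    "(\<integral>y. (branch m F y)\<^sup>2 \<partial>Q) = (\<integral>y. (F y)\<^sup>2 \<partial>Q) / m + a * (\<integral>y. F y \<partial>Q)\<^sup>2"
proof -
  define G where "G k y = ((\<Sum>i<k. F (subtree i y)) / m)\<^sup>2" for k y
  have B: "(\<lambda>y. (branch m F y)\<^sup>2) = (\<lambda>y. G (children y) y)" by (simp add: branch_def G_def fun_eq_iff)
  have G: "integrable Q (G k)" "(\<integral>y. G k y \<partial>Q) =
      real k * ((\<integral>y. (F y)\<^sup>2 \<partial>Q) / m\<^sup>2) + real k * (real k - 1) * ((\<integral>y. F y \<partial>Q)\<^sup>2 / m\<^sup>2)" for k
    unfolding G_def[abs_def] power_divide by (simp_all add: subtree_sum_square F2 add_divide_distrib)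
  have inv: "G k (y(Inl [] := x)) = G k y" for k y x by (simp add: G_def)
  have abs: "\<bar>G k y\<bar> = G k y" for k y by (simp add: G_def)
  have int: "integrable p (\<lambda>k. \<integral>y. \<bar>G k y\<bar> \<partial>Q)"
    unfolding abs G using p_moments_integrable p_factorial_moments_integrable
    by (intro Bochner_Integration.integrable_add integrable_mult_left) 
  show "integrable Q (\<lambda>y. (branch m F y)\<^sup>2)"
    unfolding B by (rule integral_children(1)[OF G(1) int inv])
  have "(\<integral>y. (branch m F y)\<^sup>2 \<partial>Q) = (\<integral>k. (\<integral>y. G k y \<partial>Q) \<partial>p)"
    unfolding B by (rule integral_children(2)[OF G(1) int inv])
  also have "\<dots> = (\<integral>k. real k * ((\<integral>y. (F y)\<^sup>2 \<partial>Q) / m\<^sup>2) \<partial>p) +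
      (\<integral>k. real k * (real k - 1) * ((\<integral>y. F y \<partial>Q)\<^sup>2 / m\<^sup>2) \<partial>p)"
    unfolding G using p_moments_integrable p_factorial_moments_integrable
    by (intro Bochner_Integration.integral_add integrable_mult_left)
  also have "\<dots> = (\<integral>y. (F y)\<^sup>2 \<partial>Q) / m + a * (\<integral>y. F y \<partial>Q)\<^sup>2"
    using m_gt_1 unfolding integral_mult_left_zero m_mean[symmetric] a_def by (simp add: power2_eq_square)
  finally show "(\<integral>y. (branch m F y)\<^sup>2 \<partial>Q) = (\<integral>y. (F y)\<^sup>2 \<partial>Q) / m + a * (\<integral>y. F y \<partial>Q)\<^sup>2" .
qed

text \<open>Nonnegativity makes the cubed sums equal to their absolute values almost surely, so the
  moment formula for \<open>k\<close> children itself yields the Fubini condition.\<close>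

lemma branch_cube:
  assumes F [measurable]: "F \<in> borel_measurable Q" and nonneg: "AE y in Q. F y \<ge> 0"
    and F2: "integrable Q (\<lambda>y. (F y)\<^sup>2)" and F3: "integrable Q (\<lambda>y. (F y)^3)"
  shows "integrable Q (\<lambda>y. (branch m F y)^3)"
    "(\<integral>y. (branch m F y)^3 \<partial>Q) = (\<integral>y. (F y)^3 \<partial>Q) / m\<^sup>2 +
       3 * a / m * (\<integral>y. (F y)\<^sup>2 \<partial>Q) * (\<integral>y. F y \<partial>Q) + a3 * (\<integral>y. F y \<partial>Q)^3"
proof -
  define G where "G k y = ((\<Sum>i<k. F (subtree i y)) / m)^3" for k y
  define c1 c2 c3 where "c1 = (\<integral>y. (F y)^3 \<partial>Q) / m^3" and "c2 = 3 * (\<integral>y. (F y)\<^sup>2 \<partial>Q) * (\<integral>y. F y \<partial>Q) / m^3"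
    and "c3 = (\<integral>y. F y \<partial>Q)^3 / m^3"
  have B: "(\<lambda>y. (branch m F y)^3) = (\<lambda>y. G (children y) y)" by (simp add: branch_def G_def fun_eq_iff)
  have G: "integrable Q (G k)" "(\<integral>y. G k y \<partial>Q) =
      real k * c1 + real k * (real k - 1) * c2 + real k * (real k - 1) * (real k - 2) * c3" for k
    unfolding G_def[abs_def] power_divide c1_def c2_def c3_def
    by (simp_all add: subtree_sum_cube F2 F3 add_divide_distrib)
  have inv: "G k (y(Inl [] := x)) = G k y" for k y x by (simp add: G_def)
  have "AE y in Q. \<forall>i. F (subtree i y) \<ge> 0"
    using AE_subtree[OF nonneg] by (simp add: AE_all_countable)
  then have "AE y in Q. \<bar>G k y\<bar> = G k y" for k
    by eventually_elim (use m_gt_1 in \<open>auto simp: G_def intro!: sum_nonneg divide_nonneg_pos zero_le_power abs_of_nonneg\<close>)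
  then have abs: "(\<integral>y. \<bar>G k y\<bar> \<partial>Q) = (\<integral>y. G k y \<partial>Q)" for k
    using G(1)[of k] by (intro integral_cong_AE) auto
  have int: "integrable p (\<lambda>k. \<integral>y. \<bar>G k y\<bar> \<partial>Q)"
    unfolding abs G using p_moments_integrable p_factorial_moments_integrable
    by (intro Bochner_Integration.integrable_add integrable_mult_left) 
  show "integrable Q (\<lambda>y. (branch m F y)^3)"
    unfolding B by (rule integral_children(1)[OF G(1) int inv])
  have "(\<integral>y. (branch m F y)^3 \<partial>Q) = (\<integral>k. (\<integral>y. G k y \<partial>Q) \<partial>p)"
    unfolding B by (rule integral_children(2)[OF G(1) int inv])
  also have "\<dots> = m * c1 + (a * m\<^sup>2) * c2 + (a3 * m^3) * c3"
    unfolding G using p_moments_integrable p_factorial_moments_integrable m_gt_1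
    by (simp add: m_mean[symmetric] a_def a3_def)
  also have "\<dots> = (\<integral>y. (F y)^3 \<partial>Q) / m\<^sup>2 +
       3 * a / m * (\<integral>y. (F y)\<^sup>2 \<partial>Q) * (\<integral>y. F y \<partial>Q) + a3 * (\<integral>y. F y \<partial>Q)^3"
    unfolding c1_def c2_def c3_def using m_gt_1 by (simp add: power2_eq_square power3_eq_cube)
  finally show "(\<integral>y. (branch m F y)^3 \<partial>Q) = (\<integral>y. (F y)^3 \<partial>Q) / m\<^sup>2 +
       3 * a / m * (\<integral>y. (F y)\<^sup>2 \<partial>Q) * (\<integral>y. F y \<partial>Q) + a3 * (\<integral>y. F y \<partial>Q)^3" .
qed

section \<open>Moments of the conductance\<close>

lemma AE_positive_env: "AE y in Q. positive_env y"
proof -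
  have "AE x in D (Inr u). x > 0" for u
    unfolding D_def sum.case by (rule \<xi>_pos)
  then have "AE y in Q. y (Inr u) > 0" for u
    unfolding Q_def by (intro D.AE_component) simp_all
  moreover have "AE k in p. real k \<ge> 1"
  proof (rule AE_pmfI)
    fix k assume "k \<in> set_pmf p"
    with p_0 have "k \<noteq> 0" by (metis set_pmf_iff)
    then show "real k \<ge> 1" by simp
  qed
  then have "AE x in D (Inl u). x \<ge> 1" for u
    unfolding D_def sum.case by (simp add: AE_distr_iff)
  then have "AE y in Q. y (Inl u) \<ge> 1" for u
    unfolding Q_def by (intro D.AE_component) simp_all
  ultimately show ?thesis
    by (simp add: positive_env_def AE_conj_iff AE_all_countable)
qed

text \<open>Index shift: \<open>cond n\<close> is the conductance to level \<open>n + 1\<close>.\<close>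

abbreviation "cond n \<equiv> branch m (planted m n)"

lemma AE_conductances_pos: "AE y in Q. y (Inr []) > 0 \<and> planted m n y > 0 \<and> cond n y > 0"
  using AE_positive_env
proof eventually_elim
  case (elim y)
  then show ?case
    using m_gt_1 by (auto intro!: planted_pos branch_pos positive_env_subtree simp: positive_env_resistance)
qed

section \<open>Integrability and positivity of the conductances\<close>

lemma series_le:
  fixes x C :: real
  assumes "x > 0" "C > 0"
  shows "0 \<le> C / (1 + x * C)" "C / (1 + x * C) \<le> C" "C / (1 + x * C) \<le> 1 / x"
proof -
  have u: "x * C > 0" using assms by simp
  then show "0 \<le> C / (1 + x * C)" using assms by simp
  show "C / (1 + x * C) \<le> C"
    using assms u add_pos_pos[OF zero_less_one u] by (simp add: pos_divide_le_eq algebra_simps)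
  show "C / (1 + x * C) \<le> 1 / x"
    using assms add_pos_pos[OF zero_less_one u] by (simp add: divide_simps mult.commute)
qed

lemma resistance_integrals:
  "integrable Q (\<lambda>y. 1 / y (Inr []))" "(\<integral>y. 1 / y (Inr []) \<partial>Q) = binv"
  "integrable Q (\<lambda>y. y (Inr []))" "(\<integral>y. y (Inr []) \<partial>Q) = b"
  "integrable \<xi> (\<lambda>x. x)"
proof -
  interpret \<xi>: prob_space \<xi> by (rule \<xi>_prob)
  have meas: "(\<lambda>x. x) \<in> borel_measurable \<xi>"
    by (simp add: measurable_cong_sets[OF \<xi>_sets refl])
  show id1: "integrable \<xi> (\<lambda>x. x)"
    by (rule \<xi>.square_integrable_imp_integrable) (use meas \<xi>_square in auto)
  have D: "D (Inr []) = \<xi>" by (simp add: D_def)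
  note * = integral_coordinate[where s = "Inr []", unfolded D]
  have inv: "(\<lambda>x :: real. 1 / x) \<in> borel_measurable borel" by measurable
  have id: "(\<lambda>x :: real. x) \<in> borel_measurable borel" by measurable
  show "integrable Q (\<lambda>y. 1 / y (Inr []))"
    by (rule *(1)[OF inv, THEN iffD2, OF \<xi>_inverse])
  show "(\<integral>y. 1 / y (Inr []) \<partial>Q) = binv"
    unfolding binv_def by (rule *(2)[OF inv])
  show "integrable Q (\<lambda>y. y (Inr []))"
    by (rule *(1)[OF id, THEN iffD2, OF id1])
  show "(\<integral>y. y (Inr []) \<partial>Q) = b"
    unfolding b_def by (rule *(2)[OF id])
qed

text \<open>The planted conductance P is at most C and at most 1/\<xi>, so P^(j+1) <= (1/\<xi>) C^j.
  As \<xi> and C are independent, one series edge raises the order of integrability by one at the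
  price of E[1/\<xi>] only.\<close>

lemma planted_Suc_integrable:
  assumes int: "integrable Q (\<lambda>y. (cond n y) ^ j)"
  shows "integrable Q (\<lambda>y. (planted m (Suc n) y) ^ j)" "integrable Q (\<lambda>y. (planted m (Suc n) y) ^ Suc j)"
proof -
  show "integrable Q (\<lambda>y. (planted m (Suc n) y) ^ j)"
  proof (rule Bochner_Integration.integrable_bound[OF int])
    show "AE y in Q. norm (planted m (Suc n) y ^ j) \<le> norm (cond n y ^ j)"
      using AE_conductances_pos[of n]
    proof eventually_elim
      case (elim y)
      with series_le[of "y (Inr [])" "cond n y"] show ?case
        by (simp add: power_mono)
    qed
  qed measurable
  have int': "integrable Q (\<lambda>y. 1 / y (Inr []) * (cond n y) ^ j)"
    by (rule indep_coordinate(1)[where g = "\<lambda>x. 1 / x"]) (use int \<xi>_inverse in \<open>auto simp: D_def\<close>)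
  show "integrable Q (\<lambda>y. (planted m (Suc n) y) ^ Suc j)"
  proof (rule Bochner_Integration.integrable_bound[OF int'])
    show "AE y in Q. norm (planted m (Suc n) y ^ Suc j) \<le> norm (1 / y (Inr []) * cond n y ^ j)"
      using AE_conductances_pos[of n]
    proof eventually_elim
      case (elim y)
      with series_le[of "y (Inr [])" "cond n y"]
      have "planted m (Suc n) y ^ Suc j \<le> 1 / y (Inr []) * cond n y ^ j"
        unfolding planted.simps power_Suc using elim by (intro mult_mono power_mono) auto
      moreover have "0 \<le> planted m (Suc n) y" using elim by (simp add: add_pos_pos)
      then have "0 \<le> planted m (Suc n) y ^ Suc j" by (rule zero_le_power)
      ultimately show ?case by (simp only: real_norm_def abs_of_nonneg)
    qed
  qed measurable
qed

lemma planted_integrable: "integrable Q (planted m n)"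
proof (induction n)
  case (Suc n)
  then show ?case
    using planted_Suc_integrable(1)[of n 1] branch_integral(1)[of "planted m n"] by simp
qed (simp add: planted.simps[abs_def] resistance_integrals)

text \<open>At index 0 the planted conductance is 1/\<xi>, for which only a first moment is given;
  squares therefore start at index 1 and cubes at index 2.\<close>

lemma planted_square_integrable: "integrable Q (\<lambda>y. (planted m (Suc n) y)\<^sup>2)"
proof (induction n)
  case 0
  show ?case
    using planted_Suc_integrable(2)[of 0 1] branch_integral(1)[OF planted_integrable, of 0]
    by (simp add: numeral_2_eq_2)
next
  case (Suc n)
  then show ?case
    using planted_Suc_integrable(1)[of "Suc n" 2] branch_square(1)[OF planted_measurable] by blast
qed

lemma AE_planted_nonneg: "AE y in Q. 0 \<le> planted m n y"
  using AE_conductances_pos[of n] by eventually_elim simp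

lemma planted_cube_integrable: "integrable Q (\<lambda>y. (planted m (Suc (Suc n)) y)^3)"
proof (induction n)
  case 0
  have "integrable Q (\<lambda>y. (planted m (Suc (Suc 0)) y) ^ Suc 2)"
    by (intro planted_Suc_integrable branch_square planted_measurable planted_square_integrable)
  then show ?case by (simp add: numeral_3_eq_3 numeral_2_eq_2)
next
  case (Suc n)
  show ?case
    by (rule planted_Suc_integrable(1))
      (rule branch_cube(1)[OF planted_measurable AE_planted_nonneg planted_square_integrable Suc.IH])
qed

lemmas cond_integrable = branch_integral(1)[OF planted_integrable]
lemmas cond_square_integrable = branch_square(1)[OF planted_measurable planted_square_integrable]
lemmas cond_cube_integrable =
  branch_cube(1)[OF planted_measurable AE_planted_nonneg planted_square_integrable planted_cube_integrable]

definition x where "x n = (\<integral>y. cond n y \<partial>Q)"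

lemma x_planted: "(\<integral>y. planted m n y \<partial>Q) = x n"
  unfolding x_def by (rule branch_integral(2)[OF planted_integrable, symmetric])

lemma integral_pos_AE:
  assumes "integrable Q f" "AE y in Q. f y > (0::real)"
  shows "(\<integral>y. f y \<partial>Q) > 0"
proof -
  have "(\<integral>y. f y \<partial>Q) \<noteq> 0"
  proof
    assume "(\<integral>y. f y \<partial>Q) = 0"
    then have "AE y in Q. f y = 0"
      using assms by (subst (asm) integral_nonneg_eq_0_iff_AE) (auto elim: eventually_mono)
    with assms(2) have "AE y in Q. False" by eventually_elim simp
    then show False by (simp add: Q.AE_False)
  qed
  moreover have "(\<integral>y. f y \<partial>Q) \<ge> 0"
    using assms(2) by (intro integral_nonneg_AE) (auto elim: eventually_mono)
  ultimately show ?thesis by simp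
qed

lemma x_pos: "x n > 0"
  unfolding x_def by (rule integral_pos_AE[OF cond_integrable])
    (use AE_conductances_pos[of n] in \<open>auto elim: eventually_mono\<close>)

lemma b_pos: "b > 0"
  unfolding resistance_integrals(4)[symmetric] 
  by (rule integral_pos_AE) (use resistance_integrals AE_conductances_pos[of 0] in \<open>auto elim: eventually_mono\<close>)

lemma binv_pos: "binv > 0"
  unfolding resistance_integrals(2)[symmetric] 
  by (rule integral_pos_AE) (use resistance_integrals AE_conductances_pos[of 0] in \<open>auto elim: eventually_mono\<close>)

text \<open>\<open>cond n\<close> lies below the edge above the root and never reads
  \<open>Inr []\<close>, so it is independent of the factor of that edge.\<close>

lemma resistance_times_cond:
  assumes "integrable Q (\<lambda>y. (cond n y) ^ j)"
  shows "integrable Q (\<lambda>y. y (Inr []) * (cond n y) ^ j)"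
    "(\<integral>y. y (Inr []) * (cond n y) ^ j \<partial>Q) = b * (\<integral>y. (cond n y) ^ j \<partial>Q)"
    "integrable Q (\<lambda>y. (y (Inr []))\<^sup>2 * (cond n y) ^ j)"
    "(\<integral>y. (y (Inr []))\<^sup>2 * (cond n y) ^ j \<partial>Q) = b2 * (\<integral>y. (cond n y) ^ j \<partial>Q)"
proof -
  have D: "D (Inr []) = \<xi>" by (simp add: D_def)
  have inv: "(cond n (y(Inr [] := t))) ^ j = (cond n y) ^ j" for y t by simp
  have meas: "(\<lambda>y. (cond n y) ^ j) \<in> borel_measurable Q" by measurable
  note * = indep_coordinate[OF _ meas inv, unfolded D, OF _ _ assms]
  show "integrable Q (\<lambda>y. y (Inr []) * (cond n y) ^ j)"
    by (rule *(1)[OF _ resistance_integrals(5)]) simp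
  show "(\<integral>y. y (Inr []) * (cond n y) ^ j \<partial>Q) = b * (\<integral>y. (cond n y) ^ j \<partial>Q)"
    unfolding b_def by (rule *(2)[OF _ resistance_integrals(5)]) simp
  show "integrable Q (\<lambda>y. (y (Inr []))\<^sup>2 * (cond n y) ^ j)"
    by (rule *(1)[OF _ \<xi>_square]) simp
  show "(\<integral>y. (y (Inr []))\<^sup>2 * (cond n y) ^ j \<partial>Q) = b2 * (\<integral>y. (cond n y) ^ j \<partial>Q)"
    unfolding b2_def by (rule *(2)[OF _ \<xi>_square]) simp
qed

text \<open>These give \<open>x_upper\<close>, \<open>x_lower\<close>, \<open>s_lower\<close> and
  \<open>x_decr\<close> pointwise. The last is a linearised Cauchy-Schwarz: the drop equals C^2 /
  (1/x + C), and C^2 / D >= 2tC - t^2 D for every t. The right side is linear in C and 1/x, so t can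
  be optimised after taking expectations.\<close>

lemma series_drop_bounds:
  fixes x C :: real
  assumes "x > 0" "C > 0"
  shows "C - C / (1 + x * C) \<le> x * C\<^sup>2" "C - C / (1 + x * C) \<ge> x * C\<^sup>2 - x\<^sup>2 * C ^ 3"
    "(C / (1 + x * C))\<^sup>2 \<ge> C\<^sup>2 - 2 * (x * C ^ 3)" "C - C / (1 + x * C) \<ge> 2 * t * C - t\<^sup>2 * (1 / x + C)"
proof -
  define h where "h = 1 / (1 + x * C)"
  have u: "x * C > 0" using assms by simp
  have h: "0 < h" "h \<le> 1" "h * (1 + x * C) = 1" using u by (auto simp: h_def divide_simps)
  have h1: "h = 1 - x * C * h" using h(3) by (simp add: algebra_simps)
  have ge: "h \<ge> 1 - x * C"
    using h1 mult_left_mono[OF h(2), of "x * C"] u by simp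
  have drop: "C - C / (1 + x * C) = x * C\<^sup>2 * h"
    using u by (simp add: h_def divide_simps power2_eq_square) (simp add: algebra_simps)
  show "C - C / (1 + x * C) \<le> x * C\<^sup>2"
    unfolding drop using h assms by (simp add: mult_left_le)
  have "x * C\<^sup>2 * h \<ge> x * C\<^sup>2 * (1 - x * C)"
    using ge assms by (intro mult_left_mono) auto
  then show "C - C / (1 + x * C) \<ge> x * C\<^sup>2 - x\<^sup>2 * C ^ 3"
    unfolding drop by (simp add: power2_eq_square power3_eq_cube algebra_simps)
  have "h\<^sup>2 \<ge> 1 - 2 * (x * C)"
  proof -
    have "h\<^sup>2 \<ge> 2 * h - 1" using zero_le_power2[of "h - 1"] by (simp add: power2_eq_square algebra_simps)
    then show ?thesis using ge by simp
  qed
  then have "C\<^sup>2 * h\<^sup>2 \<ge> C\<^sup>2 * (1 - 2 * (x * C))" by (intro mult_left_mono) auto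
  then show "(C / (1 + x * C))\<^sup>2 \<ge> C\<^sup>2 - 2 * (x * C ^ 3)"
    by (simp add: h_def power_divide power2_eq_square power3_eq_cube algebra_simps)
  have "x * C\<^sup>2 * h - (2 * t * C - t\<^sup>2 * (1 / x + C)) = (x * C - t * (1 + x * C))\<^sup>2 * h / x"
    using u assms add_pos_pos[OF zero_less_one u] by (simp add: h_def divide_simps) (simp add: power2_eq_square algebra_simps)
  also have "\<dots> \<ge> 0" using h assms by simp
  finally show "C - C / (1 + x * C) \<ge> 2 * t * C - t\<^sup>2 * (1 / x + C)" unfolding drop by simp
qed

text \<open>The pointwise form of Chebyshev's association inequality: \<open>h\<close> decreases in
  \<open>C\<close> and takes the value \<open>h'\<close> at \<open>C = q\<close>, so
  \<open>C - q\<close> and \<open>h - h'\<close> have opposite signs. Before this, one factor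
  \<open>h\<close> of the square is bounded by 1.\<close>

lemma planted_Suc_square_le:
  fixes x C q :: real
  assumes "x > 0" "C > 0" "q \<ge> 0"
  shows "(C / (1 + x * C))\<^sup>2 \<le> q * (C / (1 + x * C)) + 1 / (1 + q * x) * (C\<^sup>2 - q * C)"
proof -
  define h where "h = 1 / (1 + x * C)"
  define h' where "h' = 1 / (1 + q * x)"
  have "x * C > 0" using assms by simp
  then have h: "0 < h" "h \<le> 1" by (auto simp: h_def divide_simps)
  have mono: "1 / (1 + u) \<le> 1 / (1 + v)" if "0 \<le> v" "v \<le> u" for u v :: real
    using that by (intro divide_left_mono mult_pos_pos) auto
  have "(C - q) * (h - h') \<le> 0"
  proof (cases "C \<ge> q")
    case True
    then have "h \<le> h'" unfolding h_def h'_def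
      using assms by (intro mono) (auto simp: mult.commute mult_left_mono)
    with True show ?thesis by (simp add: mult_le_0_iff)
  next
    case False
    then have "h' \<le> h" unfolding h_def h'_def
      using assms by (intro mono) (auto simp: mult.commute mult_left_mono)
    with False show ?thesis by (simp add: mult_le_0_iff)
  qed
  then have "C * ((C - q) * (h - h')) \<le> 0" using assms by (simp add: mult_le_0_iff)
  moreover have "C\<^sup>2 * h\<^sup>2 \<le> C\<^sup>2 * h"
    using h by (intro mult_left_mono) (auto simp: power2_eq_square mult_left_le)
  ultimately have "C\<^sup>2 * h\<^sup>2 \<le> q * (C * h) + h' * (C\<^sup>2 - q * C)"
    by (simp add: power2_eq_square algebra_simps)
  then show ?thesis by (simp add: h_def h'_def power_divide)
qed

text \<open>The shift by 2 is where \<open>cond\<close> first has a guaranteed third moment. The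
  bound \<open>\<beta>\<close> of the recursion is E[1/\<xi>], and \<open>3 * a / m\<close> and
  \<open>a3\<close> are the coefficients of the cubic moment formula.\<close>

sublocale mom: moment_recursion "\<lambda>n. x (n + 2)" "\<lambda>n. \<integral>y. (cond (n + 2) y)\<^sup>2 \<partial>Q"
  "\<lambda>n. \<integral>y. (cond (n + 2) y)^3 \<partial>Q" "\<lambda>n. \<integral>y. (planted m (n + 3) y)\<^sup>2 \<partial>Q"
  m a b b2 binv "3 * a / m" a3
proof
  fix n
  have n4: "Suc n + 2 = n + 3" by simp
  have n3: "n + 3 = Suc (n + 2)" "n + 2 = Suc (n + 1)" "n + 2 = Suc (Suc n)" by simp_all
  have C1: "integrable Q (cond (n + 2))" by (rule cond_integrable)
  have C2: "integrable Q (\<lambda>y. (cond (n + 2) y)\<^sup>2)" unfolding n3(2) by (rule cond_square_integrable)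
  have C3: "integrable Q (\<lambda>y. (cond (n + 2) y)^3)" unfolding n3(3) by (rule cond_cube_integrable)
  have P1: "integrable Q (planted m (n + 3))" by (rule planted_integrable)
  have P2: "integrable Q (\<lambda>y. (planted m (n + 3) y)\<^sup>2)" unfolding n3(1) by (rule planted_square_integrable)
  have P3: "integrable Q (\<lambda>y. (planted m (n + 3) y)^3)" unfolding n3(1) n3(2) by (rule planted_cube_integrable)
  note pos = AE_conductances_pos[of "n + 2"]
  have x_diff: "x (n + 2) - x (Suc n + 2) = (\<integral>y. cond (n + 2) y - planted m (n + 3) y \<partial>Q)"
  unfolding n4 Bochner_Integration.integral_diff[OF C1 P1] x_planted x_def[of "n + 2"] ..
  have pl: "planted m (n + 3) y = cond (n + 2) y / (1 + y (Inr []) * cond (n + 2) y)" for y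
    unfolding n3(1) planted.simps by simp
  show "x (n + 2) > 0" by (rule x_pos)
  show "(\<integral>y. (cond (n + 2) y)\<^sup>2 \<partial>Q) \<ge> 0"
    by (auto intro!: integral_nonneg_AE)
  show "(\<integral>y. (cond (n + 2) y)^3 \<partial>Q) \<ge> 0"
    by (rule integral_nonneg_AE) (use pos in \<open>auto elim: eventually_mono\<close>)
  show "x (n + 2) - x (Suc n + 2) \<le> b * (\<integral>y. (cond (n + 2) y)\<^sup>2 \<partial>Q)"
    unfolding x_diff resistance_times_cond(2)[OF C2, symmetric]
  proof (rule integral_mono_AE)
    show "AE y in Q. cond (n + 2) y - planted m (n + 3) y \<le> y (Inr []) * (cond (n + 2) y)\<^sup>2"
      using pos by eventually_elim (auto simp: pl intro!: series_drop_bounds)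
  qed (use C1 P1 resistance_times_cond(1)[OF C2] in auto)
  show "x (n + 2) - x (Suc n + 2) \<ge> b * (\<integral>y. (cond (n + 2) y)\<^sup>2 \<partial>Q) - b2 * (\<integral>y. (cond (n + 2) y)^3 \<partial>Q)"
    unfolding x_diff resistance_times_cond(2)[OF C2, symmetric] resistance_times_cond(4)[OF C3, symmetric]
      Bochner_Integration.integral_diff[OF resistance_times_cond(1)[OF C2] resistance_times_cond(3)[OF C3], symmetric]
  proof (rule integral_mono_AE)
    show "AE y in Q. y (Inr []) * (cond (n + 2) y)\<^sup>2 - (y (Inr []))\<^sup>2 * (cond (n + 2) y)^3
        \<le> cond (n + 2) y - planted m (n + 3) y"
      using pos by eventually_elim (auto simp: pl intro!: series_drop_bounds)
  qed (use C1 P1 resistance_times_cond(1)[OF C2] resistance_times_cond(3)[OF C3] in auto)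
  show "(\<integral>y. (cond (n + 2) y)\<^sup>2 \<partial>Q) - 2 * b * (\<integral>y. (cond (n + 2) y)^3 \<partial>Q) \<le> (\<integral>y. (planted m (n + 3) y)\<^sup>2 \<partial>Q)"
  proof -
    have "(\<integral>y. (cond (n + 2) y)\<^sup>2 - 2 * (y (Inr []) * (cond (n + 2) y)^3) \<partial>Q) \<le> (\<integral>y. (planted m (n + 3) y)\<^sup>2 \<partial>Q)"
    proof (rule integral_mono_AE)
      show "AE y in Q. (cond (n + 2) y)\<^sup>2 - 2 * (y (Inr []) * (cond (n + 2) y)^3) \<le> (planted m (n + 3) y)\<^sup>2"
        using pos by eventually_elim (auto simp only: pl intro!: series_drop_bounds)
    qed (use C2 P2 resistance_times_cond(1)[OF C3] in auto)
    then show ?thesis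
      using C2 resistance_times_cond(1,2)[OF C3] by simp
  qed
  show "(\<integral>y. (planted m (n + 3) y)\<^sup>2 \<partial>Q) \<le> (\<integral>y. (cond (n + 2) y)\<^sup>2 \<partial>Q)"
  proof (rule integral_mono_AE)
    show "AE y in Q. (planted m (n + 3) y)\<^sup>2 \<le> (cond (n + 2) y)\<^sup>2"
      using pos by eventually_elim (auto simp only: pl intro!: power_mono series_le)
  qed (use C2 P2 in auto)
  show "x (n + 2) - x (Suc n + 2) \<ge> (x (n + 2))\<^sup>2 / (binv + x (n + 2))"
  proof -
    \<comment> \<open>The maximiser of
      \<open>2 * t * x (n + 2) - t\<^sup>2 * (binv + x (n + 2))\<close>, the expectation of the
      linearised bound.\<close>
    define t where "t = x (n + 2) / (binv + x (n + 2))"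
    have "(\<integral>y. 2 * t * cond (n + 2) y - t\<^sup>2 * (1 / y (Inr []) + cond (n + 2) y) \<partial>Q)
        \<le> x (n + 2) - x (Suc n + 2)"
      unfolding x_diff
    proof (rule integral_mono_AE)
      show "AE y in Q. 2 * t * cond (n + 2) y - t\<^sup>2 * (1 / y (Inr []) + cond (n + 2) y)
          \<le> cond (n + 2) y - planted m (n + 3) y"
        using pos by eventually_elim (auto simp only: pl intro!: series_drop_bounds)
    qed (use C1 P1 resistance_integrals in auto)
    moreover have "(\<integral>y. 2 * t * cond (n + 2) y - t\<^sup>2 * (1 / y (Inr []) + cond (n + 2) y) \<partial>Q) =
        2 * t * x (n + 2) - t\<^sup>2 * (binv + x (n + 2))"
      using C1 resistance_integrals by (simp add: x_def)
    moreover have "t\<^sup>2 * (binv + x (n + 2)) = t * x (n + 2)"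
      using binv_pos x_pos[of "n + 2"] by (simp add: t_def power2_eq_square)
    moreover have "t * x (n + 2) = (x (n + 2))\<^sup>2 / (binv + x (n + 2))"
      by (simp add: t_def power2_eq_square)
    ultimately show ?thesis by linarith
  qed
  show "(\<integral>y. (cond (Suc n + 2) y)\<^sup>2 \<partial>Q) = (\<integral>y. (planted m (n + 3) y)\<^sup>2 \<partial>Q) / m + a * (x (Suc n + 2))\<^sup>2"
    unfolding n4 branch_square(2)[OF planted_measurable P2] x_planted ..
  show "(\<integral>y. (cond (Suc n + 2) y)^3 \<partial>Q) \<le> (\<integral>y. (cond (n + 2) y)^3 \<partial>Q) / m\<^sup>2 +
      3 * a / m * (\<integral>y. (planted m (n + 3) y)\<^sup>2 \<partial>Q) * x (Suc n + 2) + a3 * (x (Suc n + 2))^3"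
  proof -
    have "(\<integral>y. (planted m (n + 3) y)^3 \<partial>Q) \<le> (\<integral>y. (cond (n + 2) y)^3 \<partial>Q)"
    proof (rule integral_mono_AE)
      show "AE y in Q. (planted m (n + 3) y)^3 \<le> (cond (n + 2) y)^3"
        using pos by eventually_elim (auto simp only: pl intro!: power_mono series_le)
    qed (use C3 P3 in auto)
    then have "(\<integral>y. (planted m (n + 3) y)^3 \<partial>Q) / m\<^sup>2 \<le> (\<integral>y. (cond (n + 2) y)^3 \<partial>Q) / m\<^sup>2"
      by (intro divide_right_mono) auto
    then show ?thesis
      unfolding n4 branch_cube(2)[OF planted_measurable AE_planted_nonneg P2 P3] x_planted by linarith
  qed
  show "(\<integral>y. (planted m (n + 3) y)\<^sup>2 \<partial>Q) * x (n + 2) \<le> x (Suc n + 2) * (\<integral>y. (cond (n + 2) y)\<^sup>2 \<partial>Q)"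
  proof -
    interpret \<xi>: prob_space \<xi> by (rule \<xi>_prob)
    \<comment> \<open>Chosen so that \<open>C\<^sup>2 - q * C\<close> is centred for
      \<open>C = cond (n + 2) y\<close>. The last term of \<open>planted_Suc_square_le\<close> then
      integrates to 0, its other factor depending on the edge above the root alone.\<close>
    define q where "q = (\<integral>y. (cond (n + 2) y)\<^sup>2 \<partial>Q) / x (n + 2)"
    have q: "q \<ge> 0" using x_pos[of "n + 2"] by (auto simp: q_def intro!: divide_nonneg_pos integral_nonneg_AE)
    have "integrable \<xi> (\<lambda>x. 1 / (1 + q * x))"
    proof (rule \<xi>.integrable_const_bound)
      show "AE x in \<xi>. norm (1 / (1 + q * x)) \<le> 1"
        using \<xi>_pos
      proof eventually_elim
        case (elim t)
        then have "q * t \<ge> 0" using q by simp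
        then show ?case by simp
      qed
      show "(\<lambda>x. 1 / (1 + q * x)) \<in> borel_measurable \<xi>"
        unfolding measurable_cong_sets[OF \<xi>_sets refl] by measurable
    qed
    then have int: "integrable Q (\<lambda>y. 1 / (1 + q * y (Inr [])) * ((cond (n + 2) y)\<^sup>2 - q * cond (n + 2) y))"
      "(\<integral>y. 1 / (1 + q * y (Inr [])) * ((cond (n + 2) y)\<^sup>2 - q * cond (n + 2) y) \<partial>Q) = 0"
      using indep_coordinate[of "\<lambda>x. 1 / (1 + q * x)" "\<lambda>y. (cond (n + 2) y)\<^sup>2 - q * cond (n + 2) y" "Inr []"] C1 C2 
        x_pos[of "n + 2"]
      by (simp_all add: D_def q_def flip: x_def)
    have "(\<integral>y. (planted m (n + 3) y)\<^sup>2 \<partial>Q) \<le> (\<integral>y. q * planted m (n + 3) y +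
        1 / (1 + q * y (Inr [])) * ((cond (n + 2) y)\<^sup>2 - q * cond (n + 2) y) \<partial>Q)"
    proof (rule integral_mono_AE)
      show "AE y in Q. (planted m (n + 3) y)\<^sup>2 \<le> q * planted m (n + 3) y +
          1 / (1 + q * y (Inr [])) * ((cond (n + 2) y)\<^sup>2 - q * cond (n + 2) y)"
        using pos by eventually_elim (auto simp only: pl intro!: planted_Suc_square_le q)
    qed (use P1 P2 int in auto)
    also have "\<dots> = q * x (n + 3)"
      using P1 int x_planted[of "n + 3"] by simp
    finally show ?thesis
      using x_pos[of "n + 2"] by (simp add: q_def eval_nat_numeral divide_simps mult.commute)
  qed
next
  show "b2 \<ge> 0" unfolding b2_def by (intro integral_nonneg_AE) auto
qed (use m_gt_1 a_pos b_pos a3_nonneg binv_pos in auto)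

section \<open>The population martingale\<close>

lemma branch_diff: "branch m (\<lambda>y. F y - G y) y = branch m F y - branch m G y"
  by (simp add: branch_def sum_subtractf diff_divide_distrib)

lemma branch_scale: "branch m (\<lambda>y. F y / c) y = branch m F y / c"
  by (simp add: branch_def sum_divide_distrib[symmetric] field_simps)

text \<open>The variance of the absolute value of \<open>F\<close> is nonnegative.\<close>

lemma abs_mean_le_sqrt:
  fixes F :: "_ \<Rightarrow> real"
  assumes [measurable]: "F \<in> borel_measurable Q" and F2: "integrable Q (\<lambda>y. (F y)\<^sup>2)"
  shows "(\<integral>y. \<bar>F y\<bar> \<partial>Q) \<le> sqrt (\<integral>y. (F y)\<^sup>2 \<partial>Q)"
proof -
  have F1: "integrable Q F"
    by (rule Q.square_integrable_imp_integrable) (use F2 in auto)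
  define c where "c = (\<integral>y. \<bar>F y\<bar> \<partial>Q)"
  have "0 \<le> (\<integral>y. (\<bar>F y\<bar> - c)\<^sup>2 \<partial>Q)" by (intro integral_nonneg_AE) auto
  also have "(\<lambda>y. (\<bar>F y\<bar> - c)\<^sup>2) = (\<lambda>y. (F y)\<^sup>2 - 2 * c * \<bar>F y\<bar> + c\<^sup>2)"
    by (simp add: fun_eq_iff power2_diff)
  also have "(\<integral>y. (F y)\<^sup>2 - 2 * c * \<bar>F y\<bar> + c\<^sup>2 \<partial>Q) = (\<integral>y. (F y)\<^sup>2 \<partial>Q) - c\<^sup>2"
    using F1 F2 by (simp add: c_def[symmetric] Q.prob_space power2_eq_square)
  finally show ?thesis
    unfolding c_def[symmetric] by (intro real_le_rsqrt) simp
qed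

abbreviation "W n \<equiv> population m n"

lemma W_square_integrable: "integrable Q (\<lambda>y. (W n y)\<^sup>2)"
proof (induction n)
  case (Suc n)
  then show ?case
    using branch_square(1)[OF population_measurable Suc] by (simp add: population.simps[abs_def])
qed (simp add: population.simps[abs_def])

lemma W_integrable: "integrable Q (W n)"
  by (rule Q.square_integrable_imp_integrable) (use W_square_integrable in auto)

lemma W_mean: "(\<integral>y. W n y \<partial>Q) = 1"
proof (induction n)
  case (Suc n)
  then show ?case
    using branch_integral(2)[OF W_integrable, of n] by (simp add: population.simps[abs_def])
qed (simp add: population.simps[abs_def] Q.prob_space)

lemma W_nonneg: "W n y \<ge> 0"
  by (induction n arbitrary: y) (use m_gt_1 in \<open>auto intro!: branch_nonneg\<close>)

lemma square_diff_integrable: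
  fixes F G :: "_ \<Rightarrow> real"
  assumes [measurable]: "F \<in> borel_measurable Q" "G \<in> borel_measurable Q"
    and "integrable Q (\<lambda>y. (F y)\<^sup>2)" "integrable Q (\<lambda>y. (G y)\<^sup>2)"
  shows "integrable Q (\<lambda>y. (F y - G y)\<^sup>2)"
proof (rule Bochner_Integration.integrable_bound)
  show "integrable Q (\<lambda>y. 2 * ((F y)\<^sup>2 + (G y)\<^sup>2))" using assms by auto
  show "AE y in Q. norm ((F y - G y)\<^sup>2) \<le> norm (2 * ((F y)\<^sup>2 + (G y)\<^sup>2))"
  proof (rule AE_I2)
    fix y
    have "0 \<le> (F y + G y)\<^sup>2" by simp
    then show "norm ((F y - G y)\<^sup>2) \<le> norm (2 * ((F y)\<^sup>2 + (G y)\<^sup>2))"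
      unfolding real_norm_def abs_power2 by (simp add: power2_diff power2_sum)
  qed
qed measurable

text \<open>Each increment is \<open>branch\<close> of the preceding one, which is centred, so its
  second moment shrinks by the factor \<open>1 / m\<close>.\<close>

lemma W_increment_square:
  "(\<integral>y. (W (Suc n) y - W n y)\<^sup>2 \<partial>Q) = (\<integral>y. (W 1 y - 1)\<^sup>2 \<partial>Q) / m ^ n"
proof (induction n)
  case (Suc n)
  have int: "integrable Q (\<lambda>y. (W (Suc n) y - W n y)\<^sup>2)"
    by (rule square_diff_integrable) (auto intro: W_square_integrable simp del: population.simps)
  have mean: "(\<integral>y. W (Suc n) y - W n y \<partial>Q) = 0"
    using W_integrable W_mean by (simp del: population.simps)
  have "(\<integral>y. (W (Suc (Suc n)) y - W (Suc n) y)\<^sup>2 \<partial>Q) = (\<integral>y. (branch m (\<lambda>y. W (Suc n) y - W n y) y)\<^sup>2 \<partial>Q)"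
    unfolding branch_diff population.simps(2)[of m "Suc n"] population.simps(2)[of m n, symmetric] ..
  also have "\<dots> = (\<integral>y. (W (Suc n) y - W n y)\<^sup>2 \<partial>Q) / m"
    by (subst branch_square(2)[OF _ int]) (simp_all add: mean del: population.simps)
  finally show ?case unfolding Suc.IH by simp
qed simp

lemma W_increment_abs:
  "(\<integral>y. \<bar>W (Suc n) y - W n y\<bar> \<partial>Q) \<le> sqrt (\<integral>y. (W 1 y - 1)\<^sup>2 \<partial>Q) * (1 / sqrt m) ^ n"
proof -
  have "(\<integral>y. \<bar>W (Suc n) y - W n y\<bar> \<partial>Q) \<le> sqrt (\<integral>y. (W (Suc n) y - W n y)\<^sup>2 \<partial>Q)"
    by (intro abs_mean_le_sqrt square_diff_integrable borel_measurable_diff population_measurable W_square_integrable)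
  also have "\<dots> = sqrt (\<integral>y. (W 1 y - 1)\<^sup>2 \<partial>Q) * (1 / sqrt m) ^ n"
    unfolding W_increment_square using m_gt_1 by (simp add: real_sqrt_divide real_sqrt_power power_one_over)
  finally show ?thesis .
qed

definition Wlim where "Wlim y = lim (\<lambda>n. W n y)"

lemma Wlim_measurable [measurable]: "Wlim \<in> borel_measurable Q"
  unfolding Wlim_def[abs_def] by measurable

text \<open>The L1 norms of the increments decay geometrically, so the sum of their absolute values
  is integrable. This sum gives almost sure convergence and a dominating function at once.\<close>

lemma W_dominated:
  obtains G where "integrable Q G" "AE y in Q. (\<forall>n. \<bar>W n y\<bar> \<le> G y) \<and> convergent (\<lambda>n. W n y)"
proof -
  define f where "f n y = \<bar>W (Suc n) y - W n y\<bar>" for n y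
  define \<delta> where "\<delta> n = (\<integral>y. f n y \<partial>Q)" for n
  have f_meas [measurable]: "f n \<in> borel_measurable Q" for n unfolding f_def[abs_def] by measurable
  have f_int: "integrable Q (f n)" for n
    unfolding f_def[abs_def] using W_integrable by (intro integrable_abs Bochner_Integration.integrable_diff)
  have f_nonneg: "f n y \<ge> 0" for n y by (simp add: f_def)
  have \<delta>_nonneg: "\<delta> n \<ge> 0" for n unfolding \<delta>_def by (intro integral_nonneg_AE) (simp add: f_nonneg)
  have sum_\<delta>: "summable \<delta>"
  proof (rule summable_comparison_test')
    show "summable (\<lambda>n. sqrt (\<integral>y. (W 1 y - 1)\<^sup>2 \<partial>Q) * (1 / sqrt m) ^ n)"
      using m_gt_1 by (intro summable_mult summable_geometric) simp
    show "norm (\<delta> n) \<le> sqrt (\<integral>y. (W 1 y - 1)\<^sup>2 \<partial>Q) * (1 / sqrt m) ^ n" for n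
      using W_increment_abs[of n] \<delta>_nonneg[of n] by (simp add: \<delta>_def f_def del: population.simps)
  qed
  have "(\<integral>\<^sup>+y. (\<Sum>n. ennreal (f n y)) \<partial>Q) = (\<Sum>n. \<integral>\<^sup>+y. ennreal (f n y) \<partial>Q)"
    by (rule nn_integral_suminf) measurable
  also have "\<dots> = (\<Sum>n. ennreal (\<delta> n))"
    unfolding \<delta>_def using f_int f_nonneg by (intro suminf_cong nn_integral_eq_integral) auto
  also have "\<dots> = ennreal (\<Sum>n. \<delta> n)"
    using sum_\<delta> \<delta>_nonneg by (intro suminf_ennreal2) auto
  finally have fin: "(\<integral>\<^sup>+y. (\<Sum>n. ennreal (f n y)) \<partial>Q) < \<infinity>" by simp
  then have "AE y in Q. (\<Sum>n. ennreal (f n y)) \<noteq> \<infinity>"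
    by (intro nn_integral_PInf_AE) auto
  then have AE_sum: "AE y in Q. summable (\<lambda>n. f n y)"
    by eventually_elim (auto intro!: summable_suminf_not_top f_nonneg simp: infinity_ennreal_def)
  have G_int: "integrable Q (\<lambda>y. \<Sum>n. f n y)"
  proof (rule integrableI_bounded)
    have "(\<integral>\<^sup>+y. norm (\<Sum>n. f n y) \<partial>Q) = (\<integral>\<^sup>+y. (\<Sum>n. ennreal (f n y)) \<partial>Q)"
      using AE_sum by (intro nn_integral_cong_AE, eventually_elim)
        (simp add: suminf_ennreal2 f_nonneg suminf_nonneg)
    then show "(\<integral>\<^sup>+y. norm (\<Sum>n. f n y) \<partial>Q) < \<infinity>" using fin by simp
  qed measurable
  show ?thesis
  proof (rule that)
    show "integrable Q (\<lambda>y. 1 + (\<Sum>n. f n y))" using G_int by simp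
    show "AE y in Q. (\<forall>n. \<bar>W n y\<bar> \<le> 1 + (\<Sum>n. f n y)) \<and> convergent (\<lambda>n. W n y)"
      using AE_sum
    proof eventually_elim
      case (elim y)
      have tele: "W n y = 1 + (\<Sum>k<n. W (Suc k) y - W k y)" for n
        using sum_lessThan_telescope[of "\<lambda>k. W k y" n] by simp
      have "\<bar>W n y\<bar> \<le> 1 + (\<Sum>n. f n y)" for n
      proof -
        have "\<bar>W n y\<bar> \<le> 1 + (\<Sum>k<n. f k y)"
          unfolding tele[of n] f_def
          using abs_triangle_ineq[of 1 "\<Sum>k<n. W (Suc k) y - W k y"]
            sum_abs[of "\<lambda>k. W (Suc k) y - W k y" "{..<n}"] by linarith
        also have "\<dots> \<le> 1 + (\<Sum>n. f n y)"
          using elim f_nonneg by (intro add_left_mono sum_le_suminf) auto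
        finally show ?thesis .
      qed
      moreover have "summable (\<lambda>k. W (Suc k) y - W k y)"
        using elim unfolding f_def by (rule summable_rabs_cancel)
      then have "convergent (\<lambda>n. 1 + (\<Sum>k<n. W (Suc k) y - W k y))"
        by (intro convergent_add convergent_const) (simp add: summable_iff_convergent)
      ultimately show ?case unfolding tele[symmetric] by blast
    qed
  qed
qed

lemma W_tendsto: "AE y in Q. (\<lambda>n. W n y) \<longlonglongrightarrow> Wlim y"
proof -
  obtain G where "AE y in Q. (\<forall>n. \<bar>W n y\<bar> \<le> G y) \<and> convergent (\<lambda>n. W n y)"
    using W_dominated by blast
  then show ?thesis by eventually_elim (simp add: Wlim_def convergent_LIMSEQ_iff)
qed

lemma Wlim_integral: "(\<integral>y. Wlim y \<partial>Q) = 1"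
proof -
  obtain G where G: "integrable Q G" "AE y in Q. (\<forall>n. \<bar>W n y\<bar> \<le> G y) \<and> convergent (\<lambda>n. W n y)"
    using W_dominated by blast
  have "(\<lambda>n. \<integral>y. W n y \<partial>Q) \<longlonglongrightarrow> (\<integral>y. Wlim y \<partial>Q)"
  proof (rule integral_dominated_convergence[OF _ _ G(1) W_tendsto])
    show "AE y in Q. norm (W n y) \<le> G y" for n using G(2) by eventually_elim simp
  qed measurable
  then show ?thesis unfolding W_mean by (simp add: LIMSEQ_const_iff)
qed

lemma Wlim_nonneg: "AE y in Q. Wlim y \<ge> 0"
  using W_tendsto by eventually_elim (auto intro: LIMSEQ_le_const W_nonneg)

lemma Wlim_branch: "AE y in Q. Wlim y = branch m Wlim y"
proof -
  have "AE y in Q. \<forall>i. (\<lambda>n. W n (subtree i y)) \<longlonglongrightarrow> Wlim (subtree i y)"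
    using AE_subtree[OF W_tendsto] by (simp add: AE_all_countable)
  with W_tendsto show ?thesis
  proof eventually_elim
    case (elim y)
    have "(\<lambda>n. W (Suc n) y) \<longlonglongrightarrow> branch m Wlim y"
      unfolding population.simps branch_def using elim m_gt_1 by (intro tendsto_intros) auto
    then show ?case using elim LIMSEQ_unique LIMSEQ_Suc by blast
  qed
qed

text \<open>An event that forces something on every child can be tested on the first two at most,
  and distinct children are independent. With \<open>f = g\<close> this bounds the probability that
  W vanishes; with an excess \<open>f\<close> and a tail indicator \<open>g\<close> it bounds the
  resistance.\<close>

lemma integral_one_or_two_children:
  fixes f g :: "_ \<Rightarrow> real"
  assumes f: "integrable Q f" and g: "integrable Q g"
  defines "H k y \<equiv> if k = (1::nat) then f (subtree 0 y) else f (subtree 0 y) * g (subtree 1 y)"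
  shows "integrable Q (\<lambda>y. H (children y) y)"
    "(\<integral>y. H (children y) y \<partial>Q) =
      pmf p 1 * (\<integral>y. f y \<partial>Q) + (1 - pmf p 1) * ((\<integral>y. f y \<partial>Q) * (\<integral>y. g y \<partial>Q))"
proof -
  have [measurable]: "f \<in> borel_measurable Q" "g \<in> borel_measurable Q" using f g by auto
  have prod: "integrable Q (\<lambda>y. f (subtree 0 y) * g (subtree 1 y))"
    "(\<integral>y. f (subtree 0 y) * g (subtree 1 y) \<partial>Q) = (\<integral>y. f y \<partial>Q) * (\<integral>y. g y \<partial>Q)"
    if "integrable Q f" "integrable Q g" for f g :: "_ \<Rightarrow> real"
  proof -
    have [measurable]: "f \<in> borel_measurable Q" "g \<in> borel_measurable Q" using that by auto
    define F where "F i = (if i = 0 then f else g)" for i :: nat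
    have "F i \<in> borel_measurable Q" for i by (simp add: F_def)
    then have "Q.indep_vars (\<lambda>_. borel) (\<lambda>i y. F i (subtree i y)) (insert 0 {1})"
      by (rule Q.indep_vars_subset[OF indep_subtrees]) simp
    from Q.indep_vars_sum[OF _ _ this]
    have ind: "Q.indep_var borel (\<lambda>y. f (subtree 0 y)) borel (\<lambda>y. g (subtree 1 y))"
      by (simp add: F_def)
    show "integrable Q (\<lambda>y. f (subtree 0 y) * g (subtree 1 y))"
      by (rule Q.indep_var_integrable[OF ind]) (simp_all add: subtree_integrable_iff that)
    show "(\<integral>y. f (subtree 0 y) * g (subtree 1 y) \<partial>Q) = (\<integral>y. f y \<partial>Q) * (\<integral>y. g y \<partial>Q)"
      by (subst Q.indep_var_lebesgue_integral[OF ind]) (simp_all add: subtree_integrable_iff subtree_integral that)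
  qed
  have mix: "integrable p (\<lambda>k. if k = 1 then u else v)"
      "(\<integral>k. (if k = 1 then u else v) \<partial>p) = pmf p 1 * u + (1 - pmf p 1) * v" for u v :: real
  proof -
    have eq: "(\<lambda>k. if k = 1 then u else v) = (\<lambda>k. (u - v) * indicator {1} k + v)"
      by (auto simp: fun_eq_iff)
    show "integrable p (\<lambda>k. if k = 1 then u else v)"
      by (rule measure_pmf.integrable_const_bound[where B = "max \<bar>u\<bar> \<bar>v\<bar>"]) auto
    have "integrable p (indicator {1} :: nat \<Rightarrow> real)"
      by (rule measure_pmf.integrable_const_bound[where B = 1]) auto
    then have "(\<integral>k. (u - v) * indicator {1} k + v \<partial>p) = (u - v) * pmf p 1 + v"
      by (subst Bochner_Integration.integral_add) (auto simp: measure_pmf_single)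
    then show "(\<integral>k. (if k = 1 then u else v) \<partial>p) = pmf p 1 * u + (1 - pmf p 1) * v"
      unfolding eq by (simp add: algebra_simps)
  qed
  have int: "integrable Q (H k)" for k
    unfolding H_def using prod(1)[OF f g] f by (cases "k = 1") (simp_all add: subtree_integrable_iff)
  have abs: "(\<integral>y. \<bar>H k y\<bar> \<partial>Q) = (if k = 1 then \<integral>y. \<bar>f y\<bar> \<partial>Q else (\<integral>y. \<bar>f y\<bar> \<partial>Q) * (\<integral>y. \<bar>g y\<bar> \<partial>Q))" for k
    using prod(2)[of "\<lambda>y. \<bar>f y\<bar>" "\<lambda>y. \<bar>g y\<bar>"] f g subtree_integral[of "\<lambda>y. \<bar>f y\<bar>" 0]
    by (simp add: H_def abs_mult)
  have int2: "integrable p (\<lambda>k. \<integral>y. \<bar>H k y\<bar> \<partial>Q)"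
    unfolding abs by (rule mix(1))
  have inv: "H k (y(Inl [] := t)) = H k y" for k y t by (simp add: H_def)
  show "integrable Q (\<lambda>y. H (children y) y)"
    by (rule integral_children(1)[OF int int2 inv])
  have "(\<integral>y. H (children y) y \<partial>Q) = (\<integral>k. (\<integral>y. H k y \<partial>Q) \<partial>p)"
    by (rule integral_children(2)[OF int int2 inv])
  also have "(\<lambda>k. \<integral>y. H k y \<partial>Q) = (\<lambda>k. if k = 1 then \<integral>y. f y \<partial>Q else (\<integral>y. f y \<partial>Q) * (\<integral>y. g y \<partial>Q))"
    using prod(2)[OF f g] subtree_integral[of f 0] by (simp add: H_def fun_eq_iff)
  finally show "(\<integral>y. H (children y) y \<partial>Q) =
      pmf p 1 * (\<integral>y. f y \<partial>Q) + (1 - pmf p 1) * ((\<integral>y. f y \<partial>Q) * (\<integral>y. g y \<partial>Q))"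
    unfolding mix(2) .
qed

lemma AE_children_ge_1: "AE y in Q. children y \<ge> 1"
  using AE_positive_env by eventually_elim (rule positive_env_children)

text \<open>If W = 0 then W vanishes in every subtree of a child, so its probability satisfies q <=
  p_1 q + (1 - p_1) q^2. For p_1 < 1 this leaves q = 0 or q = 1, and E[W] = 1 excludes the
  latter.\<close>

lemma Wlim_pos:
  assumes p1: "pmf p 1 < 1"
  shows "AE y in Q. Wlim y > 0"
proof -
  define I where "I y = (indicator {y. Wlim y = 0} y :: real)" for y
  have [measurable]: "I \<in> borel_measurable Q" unfolding I_def[abs_def] by measurable
  have I: "0 \<le> I y" "I y \<le> 1" for y by (auto simp: I_def split: split_indicator)
  have int: "integrable Q I"
    by (rule Q.integrable_const_bound[where B = 1]) (use I in auto)
  define q where "q = (\<integral>y. I y \<partial>Q)"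
  have q: "0 \<le> q" "q \<le> 1"
    unfolding q_def using I integral_mono[OF int, of "\<lambda>_. 1"] by (auto intro!: integral_nonneg_AE)
  note two = integral_one_or_two_children[OF int int]
  have "q \<le> pmf p 1 * q + (1 - pmf p 1) * (q * q)"
    unfolding q_def two(2)[symmetric]
  proof (rule integral_mono_AE[OF int two(1)])
    have "AE y in Q. \<forall>i. Wlim (subtree i y) \<ge> 0"
      using AE_subtree[OF Wlim_nonneg] by (simp add: AE_all_countable)
    with Wlim_branch AE_children_ge_1
    show "AE y in Q. I y \<le> (if children y = 1 then I (subtree 0 y) else I (subtree 0 y) * I (subtree 1 y))"
    proof eventually_elim
      case (elim y)
      show ?case
      proof (cases "Wlim y = 0")
        case True
        then have "(\<Sum>i<children y. Wlim (subtree i y)) = 0"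
          using elim m_gt_1 by (simp add: branch_def)
        then have "\<forall>i<children y. Wlim (subtree i y) = 0"
          using elim by (subst (asm) sum_nonneg_eq_0_iff) auto
        then show ?thesis using elim by (auto simp: I_def indicator_def)
      qed (use I in \<open>simp add: I_def\<close>)
    qed
  qed
  then have "(1 - pmf p 1) * (q * (1 - q)) \<le> 0" by (simp add: algebra_simps)
  then have "q * (1 - q) \<le> 0" using p1 by (simp add: mult_le_0_iff)
  then have "q = 0 \<or> q = 1" using q by (auto simp: mult_le_0_iff)
  moreover have "q \<noteq> 1"
  proof
    assume "q = 1"
    then have "(\<integral>y. 1 - I y \<partial>Q) = 0" using int by (simp add: q_def)
    then have "AE y in Q. 1 - I y = 0"
      using int I by (subst (asm) integral_nonneg_eq_0_iff_AE) auto
    then have "AE y in Q. Wlim y = 0"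
      by eventually_elim (auto simp: I_def split: split_indicator_asm)
    then have "(\<integral>y. Wlim y \<partial>Q) = 0" by (subst integral_cong_AE[of _ _ "\<lambda>_. 0"]) auto
    then show False by (simp add: Wlim_integral)
  qed
  ultimately have "AE y in Q. I y = 0"
    using int I integral_nonneg_eq_0_iff_AE[of Q I] by (auto simp: q_def)
  with Wlim_nonneg show ?thesis
    by eventually_elim (auto simp: I_def split: split_indicator_asm)
qed

section \<open>Mean-square comparison of the normalised conductance with the population\<close>

definition V where "V n y = cond n y / x n"

text \<open>The new difference is \<open>branch\<close> of the centred difference between the
  normalised planted conductance \<open>G\<close> and \<open>W\<close>, which contracts by
  \<open>1 / m\<close>. Passing from \<open>G\<close> to \<open>V\<close> costs only the error
  \<open>e n\<close>. The indices differ by one because \<open>cond n\<close> reaches level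
  \<open>n + 1\<close>.\<close>

lemma V_W_distance: "(\<lambda>n. \<integral>y. (V (n + 2) y - W (n + 3) y)\<^sup>2 \<partial>Q) \<longlonglongrightarrow> 0"
proof -
  \<comment> \<open>The weight in Young's inequality; this choice leaves the factor
    \<open>(1 + \<eta>) / m = (m + 1) / (2 * m) < 1\<close>.\<close>
  define \<eta> where "\<eta> = (m - 1) / 2"
  define G where "G n y = planted m (n + 3) y / x (n + 3)" for n y
  define e where "e n = (\<integral>y. (G n y - V (n + 2) y)\<^sup>2 \<partial>Q)" for n
  have \<eta>: "\<eta> > 0" "(1 + \<eta>) / m < 1" using m_gt_1 by (auto simp: \<eta>_def divide_simps)
  have idx: "n + 3 = Suc (n + 2)" "n + 2 = Suc (n + 1)" "n + 2 = Suc (Suc n)" "Suc n + 2 = n + 3" "Suc n + 3 = Suc (n + 3)" for n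
    by simp_all
  have [measurable]: "V n \<in> borel_measurable Q" for n unfolding V_def[abs_def] by measurable
  have [measurable]: "G n \<in> borel_measurable Q" for n unfolding G_def[abs_def] by measurable
  have C2: "integrable Q (\<lambda>y. (cond (n + 2) y)\<^sup>2)" for n unfolding idx(2) by (rule cond_square_integrable)
  have C3: "integrable Q (\<lambda>y. (cond (n + 2) y)^3)" for n unfolding idx(3) by (rule cond_cube_integrable)
  have P2: "integrable Q (\<lambda>y. (planted m (n + 3) y)\<^sup>2)" for n unfolding idx(1) by (rule planted_square_integrable)
  have V2: "integrable Q (\<lambda>y. (V (n + 2) y)\<^sup>2)" for n
    unfolding V_def power_divide by (intro integrable_divide_zero C2)
  have G2: "integrable Q (\<lambda>y. (G n y)\<^sup>2)" for n
    unfolding G_def power_divide by (intro integrable_divide_zero P2)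
  have G1: "integrable Q (G n)" "(\<integral>y. G n y \<partial>Q) = 1" for n
    using planted_integrable[of "n + 3"] x_planted[of "n + 3"] x_pos[of "n + 3"] by (simp_all add: G_def[abs_def])
  have step: "(\<integral>y. (V (Suc n + 2) y - W (Suc n + 3) y)\<^sup>2 \<partial>Q) \<le>
      (1 + \<eta>) / m * (\<integral>y. (V (n + 2) y - W (n + 3) y)\<^sup>2 \<partial>Q) + (1 + 1 / \<eta>) / m * e n" for n
  proof -
    have GW: "integrable Q (\<lambda>y. (G n y - W (n + 3) y)\<^sup>2)"
      by (rule square_diff_integrable[OF _ _ G2 W_square_integrable]) measurable
    have VW: "integrable Q (\<lambda>y. (V (n + 2) y - W (n + 3) y)\<^sup>2)"
      by (rule square_diff_integrable[OF _ _ V2 W_square_integrable]) measurable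
    have GV: "integrable Q (\<lambda>y. (G n y - V (n + 2) y)\<^sup>2)"
      by (rule square_diff_integrable[OF _ _ G2 V2]) measurable
    have mean: "(\<integral>y. G n y - W (n + 3) y \<partial>Q) = 0"
      using G1 W_integrable W_mean by simp
    have "V (Suc n + 2) y - W (Suc n + 3) y = branch m (\<lambda>y. G n y - W (n + 3) y) y" for y
      unfolding branch_diff V_def G_def branch_scale idx(4,5) population.simps ..
    then have "(\<integral>y. (V (Suc n + 2) y - W (Suc n + 3) y)\<^sup>2 \<partial>Q) = (\<integral>y. (branch m (\<lambda>y. G n y - W (n + 3) y) y)\<^sup>2 \<partial>Q)"
      by (simp only:)
    also have "\<dots> = (\<integral>y. (G n y - W (n + 3) y)\<^sup>2 \<partial>Q) / m"
    proof -
      have "(\<lambda>y. G n y - W (n + 3) y) \<in> borel_measurable Q" by measurable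
      from branch_square(2)[OF this GW] show ?thesis unfolding mean by simp
    qed
    also have "\<dots> \<le> ((1 + \<eta>) * (\<integral>y. (V (n + 2) y - W (n + 3) y)\<^sup>2 \<partial>Q) + (1 + 1 / \<eta>) * e n) / m"
    proof (rule divide_right_mono)
      have young: "(u + v)\<^sup>2 \<le> (1 + \<eta>) * v\<^sup>2 + (1 + 1 / \<eta>) * u\<^sup>2" for u v :: real
      proof -
        have "(1 + \<eta>) * v\<^sup>2 + (1 + 1 / \<eta>) * u\<^sup>2 - (u + v)\<^sup>2 = (\<eta> * v - u)\<^sup>2 / \<eta>"
          using \<eta>(1) by (simp add: field_simps power2_eq_square)
        also have "\<dots> \<ge> 0" using \<eta>(1) by simp
        finally show ?thesis by simp
      qed
      have "(\<integral>y. (G n y - W (n + 3) y)\<^sup>2 \<partial>Q) \<le>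
          (\<integral>y. (1 + \<eta>) * (V (n + 2) y - W (n + 3) y)\<^sup>2 + (1 + 1 / \<eta>) * (G n y - V (n + 2) y)\<^sup>2 \<partial>Q)"
      proof (rule integral_mono)
        show "(G n y - W (n + 3) y)\<^sup>2 \<le> (1 + \<eta>) * (V (n + 2) y - W (n + 3) y)\<^sup>2 + (1 + 1 / \<eta>) * (G n y - V (n + 2) y)\<^sup>2" for y
          using young[of "G n y - V (n + 2) y" "V (n + 2) y - W (n + 3) y"] by (simp del: population.simps)
      qed (use GW VW GV in auto)
      also have "\<dots> = (1 + \<eta>) * (\<integral>y. (V (n + 2) y - W (n + 3) y)\<^sup>2 \<partial>Q) + (1 + 1 / \<eta>) * e n"
        unfolding e_def using VW GV by simp
      finally show "(\<integral>y. (G n y - W (n + 3) y)\<^sup>2 \<partial>Q) \<le> \<dots>" .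
    qed (use m_gt_1 in simp)
    also have "\<dots> = (1 + \<eta>) / m * (\<integral>y. (V (n + 2) y - W (n + 3) y)\<^sup>2 \<partial>Q) + (1 + 1 / \<eta>) / m * e n"
      by (rule trans[OF add_divide_distrib]) (simp only: times_divide_eq_left)
    finally show ?thesis .
  qed
  \<comment> \<open>The error has two sources, the series edge and the change of normalisation from
    \<open>x (n + 2)\<close> to \<open>x (n + 3)\<close>; they produce the \<open>Z\<close> term and
    the \<open>Y\<close> term.\<close>
  have e_bound: "e n \<le> 4 * b * (mom.Z n * x (n + 2)) * (mom.\<rho> n)\<^sup>2 + 2 * mom.Y n * (mom.\<rho> n - 1)\<^sup>2" for n
  proof -
    have xp: "x (n + 2) > 0" "x (n + 3) > 0" by (rule x_pos)+
    have \<rho>: "mom.\<rho> n = x (n + 2) / x (n + 3)" unfolding mom.\<rho>_def idx(4) ..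
    have Z: "mom.Z n = (\<integral>y. (cond (n + 2) y)^3 \<partial>Q) / x (n + 2) ^ 3" unfolding mom.Z_def ..
    have Y: "mom.Y n = (\<integral>y. (cond (n + 2) y)\<^sup>2 \<partial>Q) / (x (n + 2))\<^sup>2" unfolding mom.Y_def ..
    define c where "c = 1 / x (n + 3) - 1 / x (n + 2)"
    have "e n \<le> (\<integral>y. 4 / (x (n + 3))\<^sup>2 * (y (Inr []) * (cond (n + 2) y)^3) + 2 * c\<^sup>2 * (cond (n + 2) y)\<^sup>2 \<partial>Q)"
      unfolding e_def
    proof (rule integral_mono_AE)
      show "integrable Q (\<lambda>y. (G n y - V (n + 2) y)\<^sup>2)"
        by (rule square_diff_integrable[OF _ _ G2 V2]) measurable
      show "integrable Q (\<lambda>y. 4 / (x (n + 3))\<^sup>2 * (y (Inr []) * (cond (n + 2) y)^3) + 2 * c\<^sup>2 * (cond (n + 2) y)\<^sup>2)"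
        using resistance_times_cond(1)[OF C3] C2 by simp
      show "AE y in Q. (G n y - V (n + 2) y)\<^sup>2 \<le>
          4 / (x (n + 3))\<^sup>2 * (y (Inr []) * (cond (n + 2) y)^3) + 2 * c\<^sup>2 * (cond (n + 2) y)\<^sup>2"
        using AE_conductances_pos[of "n + 2"]
      proof eventually_elim
        case (elim y)
        define C where "C = cond (n + 2) y"
        define P where "P = planted m (n + 3) y"
        have P: "P = C / (1 + y (Inr []) * C)" unfolding P_def C_def idx(1) planted.simps by simp
        have C: "C > 0" "y (Inr []) > 0" using elim by (auto simp: C_def)
        have "0 \<le> C - P" "C - P \<le> C" "C - P \<le> y (Inr []) * C\<^sup>2"
          using series_le[OF C(2,1)] series_drop_bounds(1)[OF C(2,1)] by (simp_all add: P)
        \<comment> \<open>Two different bounds on \<open>C - P\<close> are multiplied; squaring the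
          sharper one would call for a fourth moment of \<open>C\<close>.\<close>
        then have "(C - P) * (C - P) \<le> (y (Inr []) * C\<^sup>2) * C"
          using C by (intro mult_mono) auto
        then have sq: "(P - C)\<^sup>2 \<le> y (Inr []) * C^3"
          by (simp add: power2_eq_square power3_eq_cube algebra_simps)
        have sq2: "(u + v)\<^sup>2 \<le> 2 * u\<^sup>2 + 2 * v\<^sup>2" for u v :: real
          using zero_le_power2[of "u - v"] by (simp add: power2_eq_square algebra_simps)
        have "G n y - V (n + 2) y = (P - C) / x (n + 3) + c * C"
          by (simp add: G_def V_def P_def C_def c_def algebra_simps diff_divide_distrib)
        then have "(G n y - V (n + 2) y)\<^sup>2 \<le> 2 * ((P - C) / x (n + 3))\<^sup>2 + 2 * (c * C)\<^sup>2"
          using sq2 by simp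
        also have "2 * ((P - C) / x (n + 3))\<^sup>2 = 2 / (x (n + 3))\<^sup>2 * (P - C)\<^sup>2" by (simp add: power_divide)
        also have "\<dots> \<le> 4 / (x (n + 3))\<^sup>2 * (y (Inr []) * C^3)"
          using sq by (intro mult_mono divide_right_mono) auto
        finally show ?case by (simp add: C_def power_mult_distrib mult.assoc)
      qed
    qed
    also have "\<dots> = 4 / (x (n + 3))\<^sup>2 * (b * (\<integral>y. (cond (n + 2) y)^3 \<partial>Q)) + 2 * c\<^sup>2 * (\<integral>y. (cond (n + 2) y)\<^sup>2 \<partial>Q)"
      using resistance_times_cond(1,2)[OF C3] C2 by simp
    also have "4 / (x (n + 3))\<^sup>2 * (b * (\<integral>y. (cond (n + 2) y)^3 \<partial>Q)) = 4 * b * (mom.Z n * x (n + 2)) * (mom.\<rho> n)\<^sup>2"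
      unfolding \<rho> Z using xp by (simp add: power2_eq_square power3_eq_cube)
    also have "2 * c\<^sup>2 * (\<integral>y. (cond (n + 2) y)\<^sup>2 \<partial>Q) = 2 * mom.Y n * (mom.\<rho> n - 1)\<^sup>2"
    proof -
      have "c = (mom.\<rho> n - 1) / x (n + 2)" unfolding c_def \<rho> using xp by (simp add: diff_divide_distrib)
      then show ?thesis unfolding Y by (simp add: power_divide)
    qed
    finally show ?thesis .
  qed
  have e_lim: "e \<longlonglongrightarrow> 0"
  proof (rule tendsto_sandwich[OF _ _ tendsto_const])
    have "(\<lambda>n. 4 * b * (mom.Z n * x (n + 2)) * (mom.\<rho> n)\<^sup>2 + 2 * mom.Y n * (mom.\<rho> n - 1)\<^sup>2)
        \<longlonglongrightarrow> 4 * b * 0 * 1\<^sup>2 + 2 * (a / (1 - 1 / m)) * (1 - 1)\<^sup>2"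
      by (intro tendsto_intros mom.Zx_tendsto_0 mom.\<rho>_tendsto mom.Y_tendsto)
    then show "(\<lambda>n. 4 * b * (mom.Z n * x (n + 2)) * (mom.\<rho> n)\<^sup>2 + 2 * mom.Y n * (mom.\<rho> n - 1)\<^sup>2) \<longlonglongrightarrow> 0"
      by simp
    show "eventually (\<lambda>n. 0 \<le> e n) sequentially"
      unfolding e_def by (intro always_eventually allI integral_nonneg_AE) auto
  qed (use e_bound in \<open>auto intro: always_eventually\<close>)
  show ?thesis
  proof (rule perturbed_contraction_null[where a = "\<lambda>_. (1 + \<eta>) / m"], rule step)
    show "(\<lambda>n. (1 + 1 / \<eta>) / m * e n) \<longlonglongrightarrow> 0"
      using tendsto_mult[OF tendsto_const[of "(1 + 1 / \<eta>) / m"] e_lim] by simp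
    show "0 \<le> (\<integral>y. (V (n + 2) y - W (n + 3) y)\<^sup>2 \<partial>Q)" for n
      by (intro integral_nonneg_AE) auto
  qed (use \<eta> in auto)
qed

section \<open>Uniform integrability of the resistance\<close>

lemma V_measurable [measurable]: "V n \<in> borel_measurable Q"
  unfolding V_def[abs_def] by measurable

text \<open>For \<open>V n y > 0\<close> and \<open>c > 0\<close> the integrand is the minimum of
  the normalised resistance \<open>1 / V n y\<close> and \<open>1 / c\<close>, written so that it is
  bounded and Lipschitz in \<open>V\<close>.\<close>

definition T where "T n c = (\<integral>y. 1 / max (V n y) c \<partial>Q)"
definition Tlim where "Tlim c = (\<integral>y. 1 / max (Wlim y) c \<partial>Q)"

lemma truncated_integrable:
  fixes c :: real
  assumes "c > 0" and [measurable]: "F \<in> borel_measurable Q"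
  shows "integrable Q (\<lambda>y. 1 / max (F y) c)"
proof (rule Q.integrable_const_bound[where B = "1 / c"])
  show "AE y in Q. norm (1 / max (F y) c) \<le> 1 / c"
    using \<open>c > 0\<close> by (intro AE_I2) (auto simp: abs_of_pos less_max_iff_disj intro!: divide_left_mono mult_pos_pos)
qed measurable

lemma truncated_lipschitz:
  fixes u v c :: real
  assumes "c > 0"
  shows "\<bar>1 / max u c - 1 / max v c\<bar> \<le> \<bar>u - v\<bar> / c\<^sup>2"
proof -
  have pos: "max u c > 0" "max v c > 0" using assms by auto
  have "\<bar>1 / max u c - 1 / max v c\<bar> = \<bar>max v c - max u c\<bar> / (max u c * max v c)"
    using pos by (simp add: diff_frac_eq abs_mult)
  also have "\<dots> \<le> \<bar>u - v\<bar> / (c * c)"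
    using assms pos by (intro frac_le mult_mono mult_pos_pos) auto
  finally show ?thesis by (simp add: power2_eq_square)
qed

text \<open>Truncation at \<open>c\<close> makes the reciprocal Lipschitz with constant
  \<open>1 / c\<^sup>2\<close>, so mean-square closeness of \<open>V\<close> and \<open>W\<close>
  suffices; for \<open>W\<close> itself dominated convergence applies.\<close>

lemma T_tendsto:
  assumes c: "c > 0"
  shows "(\<lambda>n. T (n + 2) c) \<longlonglongrightarrow> Tlim c"
proof -
  define S where "S n = (\<integral>y. 1 / max (W (n + 3) y) c \<partial>Q)" for n
  define d where "d n = (\<integral>y. (V (n + 2) y - W (n + 3) y)\<^sup>2 \<partial>Q)" for n
  have int: "integrable Q (\<lambda>y. (V (n + 2) y - W (n + 3) y)\<^sup>2)" for n
  proof (rule square_diff_integrable[OF _ _ _ W_square_integrable])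
    show "integrable Q (\<lambda>y. (V (n + 2) y)\<^sup>2)"
      unfolding V_def power_divide using cond_square_integrable[of "n + 1"]
      by (intro integrable_divide_zero) (simp del: planted.simps)
  qed measurable
  have S: "S \<longlonglongrightarrow> Tlim c"
    unfolding S_def Tlim_def
  proof (rule integral_dominated_convergence[where w = "\<lambda>_. 1 / c"])
    show "AE y in Q. (\<lambda>n. 1 / max (W (n + 3) y) c) \<longlonglongrightarrow> 1 / max (Wlim y) c"
      using W_tendsto
    proof eventually_elim
      case (elim y)
      then have "(\<lambda>n. W (n + 3) y) \<longlonglongrightarrow> Wlim y" by (rule LIMSEQ_ignore_initial_segment)
      then show ?case using c by (intro tendsto_intros) auto
    qed
    show "AE y in Q. norm (1 / max (W (n + 3) y) c) \<le> 1 / c" for n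
      using c by (intro AE_I2) (auto simp: abs_of_pos less_max_iff_disj intro!: divide_left_mono mult_pos_pos)
    show "(\<lambda>y. 1 / max (W (n + 3) y) c) \<in> borel_measurable Q" for n by measurable
    show "(\<lambda>y. 1 / max (Wlim y) c) \<in> borel_measurable Q" by measurable
    show "integrable Q (\<lambda>y. 1 / c)" by (rule Q.integrable_const)
  qed
  have bound: "\<bar>T (n + 2) c - S n\<bar> \<le> sqrt (d n) / c\<^sup>2" for n
  proof -
    have ints: "integrable Q (\<lambda>y. 1 / max (V (n + 2) y) c)" "integrable Q (\<lambda>y. 1 / max (W (n + 3) y) c)"
      by (rule truncated_integrable[OF c], measurable)+
    have "\<bar>T (n + 2) c - S n\<bar> = \<bar>\<integral>y. 1 / max (V (n + 2) y) c - 1 / max (W (n + 3) y) c \<partial>Q\<bar>"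
      unfolding T_def S_def by (subst Bochner_Integration.integral_diff[OF ints]) simp
    also have "\<dots> \<le> (\<integral>y. \<bar>1 / max (V (n + 2) y) c - 1 / max (W (n + 3) y) c\<bar> \<partial>Q)"
      by (rule integral_abs_bound)
    also have "\<dots> \<le> (\<integral>y. \<bar>V (n + 2) y - W (n + 3) y\<bar> / c\<^sup>2 \<partial>Q)"
    proof (rule integral_mono)
      show "integrable Q (\<lambda>y. \<bar>1 / max (V (n + 2) y) c - 1 / max (W (n + 3) y) c\<bar>)"
        using ints by (intro integrable_abs Bochner_Integration.integrable_diff)
      have "integrable Q (\<lambda>y. V (n + 2) y - W (n + 3) y)"
        by (rule Q.square_integrable_imp_integrable[OF _ int]) measurable
      then show "integrable Q (\<lambda>y. \<bar>V (n + 2) y - W (n + 3) y\<bar> / c\<^sup>2)"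
        by (intro integrable_divide_zero integrable_abs)
    qed (rule truncated_lipschitz[OF c])
    also have "\<dots> = (\<integral>y. \<bar>V (n + 2) y - W (n + 3) y\<bar> \<partial>Q) / c\<^sup>2" by (rule integral_divide_zero)
    also have "\<dots> \<le> sqrt (d n) / c\<^sup>2"
    proof (rule divide_right_mono)
      have "(\<lambda>y. V (n + 2) y - W (n + 3) y) \<in> borel_measurable Q"
        by (intro borel_measurable_diff V_measurable population_measurable)
      from abs_mean_le_sqrt[OF this int]
      show "(\<integral>y. \<bar>V (n + 2) y - W (n + 3) y\<bar> \<partial>Q) \<le> sqrt (d n)"
        unfolding d_def .
    qed simp
    finally show ?thesis .
  qed
  have "(\<lambda>n. sqrt (d n) / c\<^sup>2) \<longlonglongrightarrow> sqrt 0 / c\<^sup>2"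
    unfolding d_def by (intro tendsto_divide tendsto_real_sqrt V_W_distance tendsto_const) (use c in simp)
  then have "(\<lambda>n. sqrt (d n) / c\<^sup>2) \<longlonglongrightarrow> 0" by simp
  then have "(\<lambda>n. T (n + 2) c - S n) \<longlonglongrightarrow> 0"
    by (rule Lim_null_comparison[rotated]) (use bound in simp)
  from tendsto_add[OF this S] show ?thesis by simp
qed

text \<open>\<open>c * Tlim c\<close> is the mean of the smaller of c/W and 1, which tends to 0 with
  \<open>c\<close> because W > 0 almost surely. Through \<open>tail_A\<close> it bounds the
  probability of a large resistance in the limit.\<close>

lemma small_values_unlikely:
  assumes "pmf p 1 < 1" "\<epsilon> > 0"
  obtains c where "c > 0" "c * Tlim c < \<epsilon>"
proof -
  have "(\<lambda>k. \<integral>y. (1 / real (Suc k)) * (1 / max (Wlim y) (1 / real (Suc k))) \<partial>Q) \<longlonglongrightarrow> (\<integral>y. 0 \<partial>Q)"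
  proof (rule integral_dominated_convergence[where w = "\<lambda>_. 1"])
    show "AE y in Q. (\<lambda>k. (1 / real (Suc k)) * (1 / max (Wlim y) (1 / real (Suc k)))) \<longlonglongrightarrow> 0"
      using Wlim_pos[OF assms(1)]
    proof eventually_elim
      case (elim y)
      have lim: "(\<lambda>k. 1 / real (Suc k)) \<longlonglongrightarrow> 0" using LIMSEQ_Suc[OF lim_1_over_n] by simp
      then have "(\<lambda>k. (1 / real (Suc k)) * (1 / max (Wlim y) (1 / real (Suc k)))) \<longlonglongrightarrow> 0 * (1 / max (Wlim y) 0)"
        using elim by (intro tendsto_intros) auto
      then show ?case by simp
    qed
    show "AE y in Q. norm ((1 / real (Suc k)) * (1 / max (Wlim y) (1 / real (Suc k)))) \<le> 1" for k
    proof (rule AE_I2)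
      fix y
      have *: "norm (1 / k' * (1 / w)) \<le> 1" if "k' > 0" "w \<ge> 1 / k'" for k' w :: real
      proof -
        have "w * k' \<ge> 1" using that by (simp add: pos_divide_le_eq)
        then have "1 / (w * k') \<le> 1" "0 \<le> 1 / (w * k')" by auto
        then show ?thesis by (simp only: real_norm_def times_divide_times_eq mult_1 mult.commute[of k'] abs_of_nonneg)
      qed
      show "norm ((1 / real (Suc k)) * (1 / max (Wlim y) (1 / real (Suc k)))) \<le> 1"
        by (rule *) simp_all
    qed
  qed auto
  then have "(\<lambda>k. 1 / real (Suc k) * Tlim (1 / real (Suc k))) \<longlonglongrightarrow> 0"
    by (simp only: Tlim_def integral_mult_right_zero Bochner_Integration.integral_zero)
  from order_tendstoD(2)[OF this assms(2)] obtain k where "1 / real (Suc k) * Tlim (1 / real (Suc k)) < \<epsilon>"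
    by (auto simp: eventually_sequentially)
  then show ?thesis by (intro that[of "1 / real (Suc k)"]) auto
qed

section \<open>Recursive bounds on the resistance\<close>

lemma AE_subtrees_pos:
  "AE y in Q. children y \<ge> 1 \<and> (\<forall>i. planted m n (subtree i y) > 0)"
  using AE_positive_env
proof eventually_elim
  case (elim y)
  then show ?case
    using m_gt_1 positive_env_children[OF elim] by (simp add: planted_pos positive_env_subtree)
qed

lemma cond_ge_child:
  assumes "\<And>i. planted m n (subtree i y) > 0" "i < children y"
  shows "planted m n (subtree i y) \<le> m * cond n y"
proof -
  have "planted m n (subtree i y) \<le> (\<Sum>i<children y. planted m n (subtree i y))"
    using assms by (intro member_le_sum) (auto intro: less_imp_le)
  then show ?thesis using m_gt_1 by (simp add: branch_def)
qed

lemma planted_Suc_inverse: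
  assumes "y (Inr []) > 0" "cond n y > 0"
  shows "1 / planted m (Suc n) y = y (Inr []) + 1 / cond n y"
  using assms by (simp add: add_divide_distrib)

text \<open>Keeping only the child 0 can only increase the resistance, so it is at most
  \<open>m\<close> times that of one planted branch, and each generation adds an integrable edge
  factor.\<close>

lemma inverse_integrable:
  "integrable Q (\<lambda>y. 1 / planted m n y)" "integrable Q (\<lambda>y. 1 / cond n y)"
proof -
  have step: "integrable Q (\<lambda>y. 1 / cond n y)" if int: "integrable Q (\<lambda>y. 1 / planted m n y)" for n
  proof (rule Bochner_Integration.integrable_bound)
    have "integrable Q (\<lambda>y. 1 / planted m n (subtree 0 y))"
      using subtree_integrable_iff[of "\<lambda>y. 1 / planted m n y" 0] int by simp
    then show "integrable Q (\<lambda>y. m * (1 / planted m n (subtree 0 y)))" by (rule integrable_mult_right)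
    show "AE y in Q. norm (1 / cond n y) \<le> norm (m * (1 / planted m n (subtree 0 y)))"
      using AE_subtrees_pos[of n] AE_conductances_pos[of n]
    proof eventually_elim
      case (elim y)
      then have "planted m n (subtree 0 y) \<le> m * cond n y" "planted m n (subtree 0 y) > 0" "cond n y > 0"
        by (auto intro!: cond_ge_child)
      then show ?case using m_gt_1 by (simp add: divide_simps mult.commute)
    qed
  qed measurable
  show *: "integrable Q (\<lambda>y. 1 / planted m n y)" for n
  proof (induction n)
    case (Suc n)
    have "integrable Q (\<lambda>y. y (Inr []) + 1 / cond n y)"
      using resistance_integrals(3) step[OF Suc] by (rule Bochner_Integration.integrable_add)
    moreover have "AE y in Q. y (Inr []) + 1 / cond n y = 1 / planted m (Suc n) y"
      using AE_conductances_pos[of n] by eventually_elim (rule planted_Suc_inverse[symmetric]; simp)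
    ultimately show ?case
      using integrable_cong_AE_imp[of Q "\<lambda>y. y (Inr []) + 1 / cond n y" "\<lambda>y. 1 / planted m (Suc n) y"]
      by (simp del: planted.simps)
  qed (simp add: resistance_integrals(3))
  show "integrable Q (\<lambda>y. 1 / cond n y)" by (rule step[OF *])
qed

text \<open>\<open>U n\<close> is the normalised resistance of the tree, \<open>A n\<close> that of the tree with an edge attached
above its root.\<close>

definition U where "U n y = x n / cond n y"
definition A where "A n y = x n / planted m (Suc n) y"

lemma U_measurable [measurable]: "U n \<in> borel_measurable Q"
  unfolding U_def[abs_def] by measurable

lemma A_measurable [measurable]: "A n \<in> borel_measurable Q"
  unfolding A_def[abs_def] by measurable

lemma U_integrable: "integrable Q (U n)"
  unfolding U_def[abs_def] using integrable_mult_right[OF inverse_integrable(2), of "x n"] by simp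

lemma A_integrable: "integrable Q (A n)"
  unfolding A_def[abs_def] using integrable_mult_right[OF inverse_integrable(1), of "x n" "Suc n"]
  by (simp del: planted.simps)

lemma A_eq: "AE y in Q. A n y = x n * y (Inr []) + U n y \<and> y (Inr []) > 0 \<and> U n y > 0 \<and> V n y = 1 / U n y"
  using AE_conductances_pos[of n]
proof eventually_elim
  case (elim y)
  have "A n y = x n * (1 / planted m (Suc n) y)" by (simp add: A_def del: planted.simps)
  also have "\<dots> = x n * (y (Inr []) + 1 / cond n y)"
    using elim by (subst planted_Suc_inverse) simp_all
  finally show ?case using elim x_pos[of n] by (simp add: U_def V_def distrib_left)
qed

lemma x_Suc_le: "x (Suc n) \<le> x n"
  unfolding x_planted[symmetric, of "Suc n"] unfolding x_def
proof (rule integral_mono_AE[OF planted_integrable cond_integrable])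
  show "AE y in Q. planted m (Suc n) y \<le> cond n y"
    using AE_conductances_pos[of n] by eventually_elim (auto intro!: series_le)
qed

text \<open>All children but \<open>i\<close> are discarded. The change of normalisation from
  \<open>x n\<close> to \<open>x (Suc n)\<close> only helps, since \<open>x\<close>
  decreases.\<close>

lemma U_Suc_le: "AE y in Q. children y \<ge> 1 \<and> (\<forall>i<children y. U (Suc n) y \<le> m * A n (subtree i y))"
  using AE_subtrees_pos[of "Suc n"] AE_conductances_pos[of "Suc n"]
proof eventually_elim
  case (elim y)
  have "U (Suc n) y \<le> m * A n (subtree i y)" if i: "i < children y" for i
  proof -
    have "planted m (Suc n) (subtree i y) \<le> m * cond (Suc n) y"
      by (rule cond_ge_child) (use elim i in \<open>auto simp del: planted.simps\<close>)
    then have "x (Suc n) / (m * cond (Suc n) y) \<le> x n / planted m (Suc n) (subtree i y)"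
      using elim x_Suc_le[of n] x_pos less_imp_le by (intro frac_le) auto
    then show ?thesis
      using m_gt_1 elim by (simp add: U_def A_def pos_divide_le_eq mult.commute mult.left_commute del: planted.simps)
  qed
  then show ?case using elim by simp
qed

definition h where "h n K = (\<integral>y. max 0 (U n y - K) \<partial>Q)"

lemma h_integrable: "integrable Q (\<lambda>y. max 0 (U n y - K))"
  using U_integrable by auto

lemma h_nonneg: "h n K \<ge> 0"
  unfolding h_def by (intro integral_nonneg_AE) simp

lemma excess_A: "(\<integral>y. max 0 (A n y - K) \<partial>Q) \<le> b * x n + h n K"
proof -
  have "(\<integral>y. max 0 (A n y - K) \<partial>Q) \<le> (\<integral>y. x n * y (Inr []) + max 0 (U n y - K) \<partial>Q)"
  proof (rule integral_mono_AE)
    show "AE y in Q. max 0 (A n y - K) \<le> x n * y (Inr []) + max 0 (U n y - K)"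
      using A_eq[of n]
    proof eventually_elim
      case (elim y)
      have "x n * y (Inr []) \<ge> 0" using elim x_pos[of n] by simp
      then show ?case using elim by auto
    qed
  qed (use A_integrable h_integrable resistance_integrals(3) in auto)
  also have "\<dots> = x n * b + h n K"
    using h_integrable resistance_integrals by (simp add: h_def)
  finally show ?thesis by (simp add: mult.commute)
qed

text \<open>If \<open>A n\<close> exceeds \<open>K\<close>, the edge part or \<open>U n\<close>
  exceeds \<open>K / 2\<close>. The first case is Markov's inequality; in the second
  \<open>V n < 2 / K\<close>, where the truncated reciprocal times \<open>2 / K\<close> equals
  1.\<close>

lemma tail_A:
  assumes "K > 0"
  shows "(\<integral>y. indicator {y. A n y > K} y \<partial>Q) \<le> 2 / K * (b * x n) + 2 / K * T n (2 / K)"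
proof -
  have int: "integrable Q (\<lambda>y. 1 / max (V n y) (2 / K))"
    by (rule truncated_integrable) (use assms in auto)
  have "(\<integral>y. indicator {y. A n y > K} y \<partial>Q) \<le>
      (\<integral>y. 2 / K * (x n * y (Inr [])) + 2 / K * (1 / max (V n y) (2 / K)) \<partial>Q)"
  proof (rule integral_mono_AE)
    show "integrable Q (\<lambda>y. indicator {y. A n y > K} y :: real)"
      by (rule Q.integrable_const_bound[where B = 1]) auto
    show "integrable Q (\<lambda>y. 2 / K * (x n * y (Inr [])) + 2 / K * (1 / max (V n y) (2 / K)))"
      using int resistance_integrals(3) by (intro Bochner_Integration.integrable_add integrable_mult_right)
    show "AE y in Q. indicator {y. A n y > K} y \<le> 2 / K * (x n * y (Inr [])) + 2 / K * (1 / max (V n y) (2 / K))"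
      using A_eq[of n]
    proof eventually_elim
      case (elim y)
      have nn: "2 / K * (x n * y (Inr [])) \<ge> 0" "2 / K * (1 / max (V n y) (2 / K)) \<ge> 0"
        using elim x_pos[of n] assms by (auto simp: less_max_iff_disj max_def)
      have ind: "indicator {y. A n y > K} y \<le> (1 :: real)" by (simp add: indicator_def)
      show ?case
      proof (cases "A n y > K")
        case True
        then consider "x n * y (Inr []) > K / 2" | "U n y > K / 2" using elim by fastforce
        then show ?thesis
        proof cases
          case 1
          then have "2 / K * (x n * y (Inr [])) \<ge> 1" using assms by (simp add: divide_simps)
          then show ?thesis using nn ind by linarith
        next
          case 2
          then have "1 / U n y \<le> 1 / (K / 2)" using assms by (intro divide_left_mono mult_pos_pos) auto
          then have "V n y \<le> 2 / K" using elim by simp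
          then have "2 / K * (1 / max (V n y) (2 / K)) = 1" using assms by (simp add: max_def)
          then show ?thesis using nn ind by linarith
        qed
      qed (use nn in simp)
    qed
  qed
  also have "\<dots> = 2 / K * (x n * (\<integral>y. y (Inr []) \<partial>Q)) + 2 / K * T n (2 / K)"
    unfolding T_def integral_mult_right_zero[symmetric]
    using int resistance_integrals(3) by (intro Bochner_Integration.integral_add integrable_mult_right)
  also have "\<dots> = 2 / K * (b * x n) + 2 / K * T n (2 / K)"
    unfolding resistance_integrals(4) by (simp only: mult.commute)
  finally show ?thesis .
qed

text \<open>With at least two children the excess is charged to the first branch (\<open>f\<close>),
  while the second contributes only the indicator \<open>g\<close> that it too exceeds
  \<open>K\<close>. Independence turns this into the factor \<open>P\<close>.\<close>

lemma h_Suc: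
  assumes K: "K \<ge> 0" and P: "(\<integral>y. indicator {y. A n y > K} y \<partial>Q) \<le> P"
  shows "h (Suc n) (m * K) \<le> m * (pmf p 1 + P) * (b * x n + h n K)"
proof -
  define f where "f y = max 0 (A n y - K)" for y
  define g where "g y = (indicator {y. A n y > K} y :: real)" for y
  have f: "integrable Q f" "\<And>y. f y \<ge> 0"
    unfolding f_def[abs_def] using A_integrable by auto
  have g: "integrable Q g" "\<And>y. g y \<ge> 0"
    unfolding g_def[abs_def] by (auto intro!: Q.integrable_const_bound[where B = 1])
  note two = integral_one_or_two_children[OF f(1) g(1)]
  define H where "H y = (if children y = 1 then f (subtree 0 y) else f (subtree 0 y) * g (subtree 1 y))" for y
  have "h (Suc n) (m * K) \<le> (\<integral>y. m * H y \<partial>Q)"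
    unfolding h_def
  proof (rule integral_mono_AE[OF h_integrable])
    show "integrable Q (\<lambda>y. m * H y)"
      unfolding H_def by (intro integrable_mult_right two(1))
    show "AE y in Q. max 0 (U (Suc n) y - m * K) \<le> m * H y"
      using U_Suc_le[of n]
    proof eventually_elim
      case (elim y)
      have U0: "U (Suc n) y - m * K \<le> m * (A n (subtree 0 y) - K)"
        using elim by (auto simp: right_diff_distrib)
      have mf: "m * (A n (subtree 0 y) - K) \<le> m * f (subtree 0 y)"
        using m_gt_1 by (intro mult_left_mono) (auto simp: f_def)
      have f0: "m * f (subtree 0 y) \<ge> 0" using m_gt_1 f(2) by simp
      show ?case
      proof (cases "children y = 1")
        case True
        then show ?thesis using U0 mf f0 by (simp add: H_def)
      next
        case False
        then have U1: "U (Suc n) y \<le> m * A n (subtree 1 y)" using elim by auto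
        show ?thesis
        proof (cases "A n (subtree 1 y) > K")
          case True
          then show ?thesis using False U0 mf f0 by (simp add: H_def g_def)
        next
          case le: False
          then have "m * A n (subtree 1 y) \<le> m * K" using m_gt_1 by simp
          then show ?thesis using False U1 le by (simp add: H_def g_def)
        qed
      qed
    qed
  qed
  also have "\<dots> = m * (pmf p 1 * (\<integral>y. f y \<partial>Q) + (1 - pmf p 1) * ((\<integral>y. f y \<partial>Q) * (\<integral>y. g y \<partial>Q)))"
    unfolding H_def by (simp only: integral_mult_right_zero two(2))
  also have "\<dots> \<le> m * ((pmf p 1 + P) * (\<integral>y. f y \<partial>Q))"
  proof (rule mult_left_mono)
    have fg: "(\<integral>y. f y \<partial>Q) \<ge> 0" "(\<integral>y. g y \<partial>Q) \<ge> 0" "(\<integral>y. g y \<partial>Q) \<le> P"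
      using P f g by (auto intro!: integral_nonneg_AE simp: g_def)
    have "(1 - pmf p 1) * ((\<integral>y. f y \<partial>Q) * (\<integral>y. g y \<partial>Q)) \<le> 1 * ((\<integral>y. f y \<partial>Q) * P)"
      using fg by (intro mult_mono) (auto simp: pmf_le_1)
    then show "pmf p 1 * (\<integral>y. f y \<partial>Q) + (1 - pmf p 1) * ((\<integral>y. f y \<partial>Q) * (\<integral>y. g y \<partial>Q))
        \<le> (pmf p 1 + P) * (\<integral>y. f y \<partial>Q)"
      by (simp add: algebra_simps)
  qed (use m_gt_1 in simp)
  also have "\<dots> = m * (pmf p 1 + P) * (\<integral>y. f y \<partial>Q)" by simp
  also have "\<dots> \<le> m * (pmf p 1 + P) * (b * x n + h n K)"
  proof (rule mult_left_mono)
    show "(\<integral>y. f y \<partial>Q) \<le> b * x n + h n K" unfolding f_def by (rule excess_A)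
    have "0 \<le> (\<integral>y. indicator {y. A n y > K} y \<partial>Q :: real)" by (intro integral_nonneg_AE) simp
    then have "P \<ge> 0" using P by linarith
    then show "0 \<le> m * (pmf p 1 + P)" using m_gt_1 by simp
  qed
  finally show ?thesis .
qed

text \<open>\<open>U n\<close> is the sum of its minimum with \<open>K\<close>, which is the
  truncated reciprocal of \<open>V n\<close> at \<open>1 / K\<close>, and its excess over
  \<open>K\<close>.\<close>

lemma U_split: 
  assumes "K > 0"
  shows "(\<integral>y. U n y \<partial>Q) = T n (1 / K) + h n K"
proof -
  have "(\<integral>y. U n y \<partial>Q) = (\<integral>y. 1 / max (V n y) (1 / K) + max 0 (U n y - K) \<partial>Q)"
  proof (rule integral_cong_AE)
    show "AE y in Q. U n y = 1 / max (V n y) (1 / K) + max 0 (U n y - K)"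
      using A_eq[of n]
    proof eventually_elim
      case (elim y)
      then have V: "V n y = 1 / U n y" and U: "U n y > 0" by auto
      show ?case
      proof (cases "U n y \<le> K")
        case True
        then have "V n y \<ge> 1 / K" unfolding V using U assms by (intro divide_left_mono) auto
        then show ?thesis using True U by (simp add: max_absorb1 V)
      next
        case False
        then have "V n y \<le> 1 / K" unfolding V using U assms by (intro divide_left_mono) auto
        then show ?thesis using False assms by (simp add: max_absorb2)
      qed
    qed
  qed measurable
  then show ?thesis
    using truncated_integrable[of "1 / K" "V n"] h_integrable assms by (simp add: T_def h_def)
qed

text \<open>The part of \<open>U\<close> below a threshold converges by \<open>T_tendsto\<close>,
  and the part above is eventually small uniformly in the level. Integrability of 1/W comes from
  monotone convergence of its truncations.\<close>

lemma U_mean_tendsto: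
  assumes p1m: "pmf p 1 * m < 1"
  shows "integrable Q (\<lambda>y. 1 / Wlim y)" "(\<lambda>n. \<integral>y. U (n + 2) y \<partial>Q) \<longlonglongrightarrow> (\<integral>y. 1 / Wlim y \<partial>Q)"
proof -
  have p1: "pmf p 1 < 1"
  proof (rule ccontr)
    assume "\<not> pmf p 1 < 1"
    then have "1 * m \<le> pmf p 1 * m" using m_gt_1 by (intro mult_right_mono) auto
    then show False using p1m m_gt_1 by linarith
  qed
  \<comment> \<open>Half the gap between \<open>1 / m\<close> and \<open>pmf p 1\<close>, so that
    \<open>\<theta>\<close> is halfway between \<open>pmf p 1 * m\<close> and 1.\<close>
  define \<eta> where "\<eta> = (1 / m - pmf p 1) / 2"
  define \<theta> where "\<theta> = m * (pmf p 1 + \<eta>)"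
  have \<eta>: "\<eta> > 0" using p1m m_gt_1 by (simp add: \<eta>_def field_simps)
  have \<theta>_eq: "\<theta> = (1 + pmf p 1 * m) / 2" using m_gt_1 by (simp add: \<theta>_def \<eta>_def field_simps)
  have \<theta>: "0 \<le> \<theta>" "\<theta> < 1" unfolding \<theta>_eq using p1m m_gt_1 by auto
  obtain c where c: "c > 0" "c * Tlim c < \<eta>"
    using small_values_unlikely[OF p1 \<eta>] by blast
  \<comment> \<open>Thresholds grow by \<open>m\<close> per generation, as \<open>h_Suc\<close>
    demands; the initial value makes the truncation level \<open>2 / K 0\<close> in
    \<open>tail_A\<close> equal to \<open>c\<close>.\<close>
  define K where "K j = m ^ j * (2 / c)" for j
  have K_pos: "K j > 0" for j using c m_gt_1 by (simp add: K_def)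
  have K_Suc: "K (Suc j) = m * K j" for j by (simp add: K_def)
  have K_mono: "K i \<le> K j" if "i \<le> j" for i j
    unfolding K_def using that c m_gt_1 by (intro mult_right_mono power_increasing) auto
  have x_lim: "(\<lambda>n. x (n + 2)) \<longlonglongrightarrow> 0" by (rule mom.x_tendsto_0)
  have "(\<lambda>n. c * (b * x (n + 2)) + c * T (n + 2) c) \<longlonglongrightarrow> c * (b * 0) + c * Tlim c"
    by (intro tendsto_intros x_lim T_tendsto c)
  from order_tendstoD(2)[OF this, of \<eta>] c(2)
  obtain n0 where n0: "\<And>n. n \<ge> n0 \<Longrightarrow> c * (b * x (n + 2)) + c * T (n + 2) c < \<eta>"
    by (auto simp: eventually_sequentially)
  have tail: "(\<integral>y. indicator {y. A (n + 2) y > K j} y \<partial>Q) \<le> \<eta>" if "n \<ge> n0" for n j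
  proof -
    have "(\<integral>y. indicator {y. A (n + 2) y > K j} y \<partial>Q) \<le> (\<integral>y. indicator {y. A (n + 2) y > K 0} y \<partial>Q :: real)"
      using K_mono[of 0 j]
      by (intro integral_mono Q.integrable_const_bound[where B = 1]) (auto simp: indicator_def)
    also have "\<dots> \<le> 2 / K 0 * (b * x (n + 2)) + 2 / K 0 * T (n + 2) (2 / K 0)"
      by (rule tail_A[OF K_pos])
    also have "2 / K 0 = c" using c by (simp add: K_def)
    finally show ?thesis using n0[OF that] by simp
  qed
  have h_step: "h (Suc n + 2) (K (Suc j)) \<le> \<theta> * (b * x (n + 2) + h (n + 2) (K j))" if "n \<ge> n0" for n j
    unfolding K_Suc \<theta>_def using h_Suc[OF _ tail[OF that], of j] K_pos[of j] by simp
  have x_le: "x n \<le> x 0" for n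
    using decseq_SucI[of x] x_Suc_le by (auto simp: decseq_def)
  \<comment> \<open>\<open>h_Suc\<close> only reaches the larger threshold \<open>K 1\<close>.
    Returning to \<open>K 0\<close> costs the constant \<open>K 1 - K 0 = (m - 1) * K 0\<close>,
    harmless in a contraction by \<open>\<theta>\<close>.\<close>
  have "\<exists>B. \<forall>n. h (n + n0 + 2) (K 0) \<le> B"
  proof (rule perturbed_contraction_bounded[where a = "\<lambda>_. \<theta>" and b = "\<lambda>n. \<theta> * (b * x (n + n0 + 2)) + (m - 1) * K 0"])
    fix n
    have "h (Suc (n + n0) + 2) (K 0) \<le> (\<integral>y. max 0 (U (Suc (n + n0) + 2) y - K 1) + (m - 1) * K 0 \<partial>Q)"
      unfolding h_def
    proof (rule integral_mono[OF h_integrable])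
      show "integrable Q (\<lambda>y. max 0 (U (Suc (n + n0) + 2) y - K 1) + (m - 1) * K 0)"
        using h_integrable by auto
      have "(m - 1) * K 0 \<ge> 0" "K 1 = K 0 + (m - 1) * K 0"
        using K_pos[of 0] m_gt_1 K_Suc[of 0] by (auto simp: algebra_simps)
      then show "max 0 (U (Suc (n + n0) + 2) y - K 0) \<le> max 0 (U (Suc (n + n0) + 2) y - K 1) + (m - 1) * K 0" for y
        by (auto simp: max_def)
    qed
    also have "\<dots> = h (Suc (n + n0) + 2) (K 1) + (m - 1) * K 0"
      using h_integrable by (simp add: h_def)
    finally show "h (Suc n + n0 + 2) (K 0) \<le> \<theta> * h (n + n0 + 2) (K 0) + (\<theta> * (b * x (n + n0 + 2)) + (m - 1) * K 0)"
      using h_step[of "n + n0" 0] by (simp add: distrib_left)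
    show "\<theta> * (b * x (n + n0 + 2)) + (m - 1) * K 0 \<le> \<theta> * (b * x 0) + (m - 1) * K 0"
      using \<theta> b_pos x_le by (intro add_right_mono mult_left_mono) auto
  qed (use \<theta> in \<open>auto simp: h_nonneg\<close>)
  then obtain B where B: "\<And>n. h (n + n0 + 2) (K 0) \<le> B" by blast
  have B_nonneg: "B \<ge> 0" using B[of 0] h_nonneg order_trans by blast
  \<comment> \<open>Raising the threshold \<open>j\<close> times gains \<open>\<theta> ^ j\<close>
    on the uniform bound \<open>B\<close>; the edge terms vanish with \<open>x\<close>.\<close>
  have excess: "eventually (\<lambda>n. h (n + 2) (K j) \<le> \<theta> ^ j * B + \<epsilon>) sequentially" if "\<epsilon> > 0" for j \<epsilon>
    using that
  proof (induction j arbitrary: \<epsilon>)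
    case 0
    show ?case unfolding eventually_sequentially
    proof (intro exI[of _ n0] allI impI)
      fix n assume "n \<ge> n0"
      then have "n - n0 + n0 + 2 = n + 2" by simp
      then show "h (n + 2) (K 0) \<le> \<theta> ^ 0 * B + \<epsilon>" using B[of "n - n0"] 0 by simp
    qed
  next
    case (Suc j)
    have "eventually (\<lambda>n. b * x (n + 2) < \<epsilon> / 2) sequentially"
      using order_tendstoD(2)[OF tendsto_mult[OF tendsto_const[of b] x_lim], of "\<epsilon> / 2"] Suc.prems by simp
    moreover have "eventually (\<lambda>n. h (n + 2) (K j) \<le> \<theta> ^ j * B + \<epsilon> / 2) sequentially"
      by (rule Suc.IH) (use Suc.prems in simp)
    ultimately have "eventually (\<lambda>n. h (Suc n + 2) (K (Suc j)) \<le> \<theta> ^ Suc j * B + \<epsilon>) sequentially"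
      using eventually_ge_at_top[of n0]
    proof eventually_elim
      case (elim n)
      have "h (Suc n + 2) (K (Suc j)) \<le> \<theta> * (b * x (n + 2) + h (n + 2) (K j))"
        by (rule h_step) (rule elim)
      also have "\<dots> \<le> \<theta> * (\<theta> ^ j * B + \<epsilon>)"
        using elim \<theta> by (intro mult_left_mono) auto
      also have "\<dots> \<le> \<theta> ^ Suc j * B + \<epsilon>"
        using \<theta> Suc.prems mult_right_mono[of \<theta> 1 \<epsilon>] by (simp add: distrib_left)
      finally show ?case .
    qed
    then show ?case by (rule eventually_sequentially_Suc[THEN iffD1])
  qed
  have split: "(\<integral>y. U n y \<partial>Q) = T n (1 / K j) + h n (K j)" for n j by (rule U_split[OF K_pos])
  have T_lim: "(\<lambda>n. T (n + 2) (1 / K j)) \<longlonglongrightarrow> Tlim (1 / K j)" for j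
    by (rule T_tendsto) (use K_pos in simp)
  have T_le: "T n (1 / K j) \<le> K j" for n j
  proof -
    have "T n (1 / K j) \<le> (\<integral>y. K j \<partial>Q)" unfolding T_def
    proof (rule integral_mono)
      fix y
      have "1 / max (V n y) (1 / K j) \<le> 1 / (1 / K j)"
        using K_pos[of j] by (intro divide_left_mono mult_pos_pos) (auto simp: less_max_iff_disj)
      then show "1 / max (V n y) (1 / K j) \<le> K j" by simp
    qed (use K_pos in \<open>auto intro!: truncated_integrable\<close>)
    then show ?thesis by simp
  qed
  \<comment> \<open>Every truncated mean is at most the mean of \<open>U\<close>, which the
    splitting at the single threshold \<open>K 0\<close> bounds uniformly. This is the bound that
    monotone convergence needs.\<close>
  have Tlim_le: "Tlim (1 / K j) \<le> K 0 + (B + 1)" for j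
  proof (rule tendsto_upperbound[OF T_lim])
    show "eventually (\<lambda>n. T (n + 2) (1 / K j) \<le> K 0 + (B + 1)) sequentially"
      using excess[OF zero_less_one, of 0]
    proof eventually_elim
      case (elim n)
      have "T (n + 2) (1 / K j) \<le> T (n + 2) (1 / K 0) + h (n + 2) (K 0)"
        using split[of "n + 2" j] split[of "n + 2" 0] h_nonneg[of "n + 2" "K j"] by linarith
      also have "\<dots> \<le> K 0 + (B + 1)" using elim T_le[of "n + 2" 0] by simp
      finally show ?case .
    qed
  qed simp
  have trunc_mono: "1 / max w (1 / K i) \<le> 1 / max w (1 / K j)" if "i \<le> j" for w i j
  proof -
    have "1 / K j \<le> 1 / K i" using K_mono[OF that] K_pos[of i] K_pos[of j] by (intro divide_left_mono mult_pos_pos) auto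
    then show ?thesis using K_pos[of i] K_pos[of j]
      by (intro divide_left_mono mult_pos_pos) (auto simp: less_max_iff_disj le_max_iff_disj)
  qed
  have int: "integrable Q (\<lambda>y. 1 / max (Wlim y) (1 / K j))" for j
    by (rule truncated_integrable) (use K_pos in auto)
  have "incseq (\<lambda>j. Tlim (1 / K j))"
    unfolding Tlim_def by (intro incseq_SucI integral_mono int trunc_mono) simp
  then obtain \<tau> where \<tau>: "(\<lambda>j. Tlim (1 / K j)) \<longlonglongrightarrow> \<tau>"
    using incseq_convergent[of "\<lambda>j. Tlim (1 / K j)" "K 0 + (B + 1)"] Tlim_le by blast
  have K_lim: "(\<lambda>j. 1 / K j) \<longlonglongrightarrow> 0"
  proof -
    have "(\<lambda>j. (1 / m) ^ j * (c / 2)) \<longlonglongrightarrow> 0 * (c / 2)"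
      using m_gt_1 by (intro tendsto_intros LIMSEQ_realpow_zero) auto
    then show ?thesis by (simp add: K_def power_one_over)
  qed
  have mono_conv: "AE y in Q. mono (\<lambda>j. 1 / max (Wlim y) (1 / K j))"
    by (intro AE_I2 monoI trunc_mono)
  have lim_conv: "AE y in Q. (\<lambda>j. 1 / max (Wlim y) (1 / K j)) \<longlonglongrightarrow> 1 / Wlim y"
    using Wlim_pos[OF p1]
  proof eventually_elim
    case (elim y)
    then have "(\<lambda>j. 1 / max (Wlim y) (1 / K j)) \<longlonglongrightarrow> 1 / max (Wlim y) 0"
      by (intro tendsto_intros K_lim) auto
    then show ?case using elim by (simp add: max_absorb1)
  qed
  have meas: "(\<lambda>y. 1 / Wlim y) \<in> borel_measurable Q" by measurable
  note * = int mono_conv lim_conv \<tau>[unfolded Tlim_def] meas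
  show "integrable Q (\<lambda>y. 1 / Wlim y)" by (rule integrable_monotone_convergence[OF *])
  have \<tau>_eq: "(\<integral>y. 1 / Wlim y \<partial>Q) = \<tau>" by (rule integral_monotone_convergence[OF *])
  have \<theta>_lim: "(\<lambda>j. \<theta> ^ j * B) \<longlonglongrightarrow> 0"
    using tendsto_mult[OF LIMSEQ_realpow_zero[OF \<theta>] tendsto_const[of B]] by simp
  show "(\<lambda>n. \<integral>y. U (n + 2) y \<partial>Q) \<longlonglongrightarrow> (\<integral>y. 1 / Wlim y \<partial>Q)"
    unfolding \<tau>_eq
  proof (rule tendstoI)
    fix \<epsilon> :: real assume \<epsilon>: "\<epsilon> > 0"
    \<comment> \<open>The index \<open>j\<close> is fixed before the level grows: truncating the
      limit and the convergence of \<open>T\<close> cost a quarter each, the excess at most two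
      quarters.\<close>
    have "eventually (\<lambda>j. dist (Tlim (1 / K j)) \<tau> < \<epsilon> / 4 \<and> \<theta> ^ j * B < \<epsilon> / 4) sequentially"
      using \<epsilon> by (intro eventually_conj tendstoD[OF \<tau>] order_tendstoD(2)[OF \<theta>_lim]) auto
    then obtain j where j: "\<bar>Tlim (1 / K j) - \<tau>\<bar> < \<epsilon> / 4" "\<theta> ^ j * B < \<epsilon> / 4"
      by (auto simp: eventually_sequentially dist_real_def)
    have "eventually (\<lambda>n. dist (T (n + 2) (1 / K j)) (Tlim (1 / K j)) < \<epsilon> / 4) sequentially"
      by (rule tendstoD[OF T_lim]) (use \<epsilon> in simp)
    moreover have "eventually (\<lambda>n. h (n + 2) (K j) \<le> \<theta> ^ j * B + \<epsilon> / 4) sequentially"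
      by (rule excess) (use \<epsilon> in simp)
    ultimately show "eventually (\<lambda>n. dist (\<integral>y. U (n + 2) y \<partial>Q) \<tau> < \<epsilon>) sequentially"
    proof eventually_elim
      case (elim n)
      then show ?case
        using j split[of "n + 2" j] h_nonneg[of "n + 2" "K j"] unfolding dist_real_def by linarith
    qed
  qed
qed

section \<open>The two limits under the law \<open>Q\<close>\<close>

lemma shifted_ratio: "(\<lambda>n. real n / real (n + 3)) \<longlonglongrightarrow> 1"
proof -
  have "(\<lambda>n. 1 - 3 / real (n + 3)) \<longlonglongrightarrow> 1 - 0"
    by (intro tendsto_diff tendsto_const LIMSEQ_ignore_initial_segment[of "\<lambda>n. 3 / real n"] lim_const_over_n)
  moreover have "1 - 3 / real (n + 3) = real n / real (n + 3)" for n by (simp add: field_simps)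
  ultimately show ?thesis by (simp only: diff_zero)
qed

text \<open>\<open>x (n + 2)\<close> belongs to level \<open>n + 3\<close>, whereas the slope of its
  reciprocal is measured against \<open>n\<close>; the factor tending to 1 repairs the
  mismatch.\<close>

theorem mean_conductance: "(\<lambda>n. real n * (\<integral>y. cond (n - 1) y \<partial>Q)) \<longlonglongrightarrow> 1 / (a * b / (1 - 1 / m))"
proof (rule LIMSEQ_offset[where k = 3])
  have "(\<lambda>n. 1 / (1 / x (n + 2) / real n * (real n / real (n + 3)))) \<longlonglongrightarrow> 1 / (a * b / (1 - 1 / m) * 1)"
    using a_pos b_pos m_gt_1
    by (intro tendsto_divide tendsto_mult tendsto_const mom.inverse_x_slope shifted_ratio) auto
  then have "(\<lambda>n. 1 / (1 / x (n + 2) / real n * (real n / real (n + 3)))) \<longlonglongrightarrow> 1 / (a * b / (1 - 1 / m))"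
    by simp
  then show "(\<lambda>n. real (n + 3) * (\<integral>y. cond (n + 3 - 1) y \<partial>Q)) \<longlonglongrightarrow> 1 / (a * b / (1 - 1 / m))"
  proof (rule Lim_transform_eventually)
    show "eventually (\<lambda>n. 1 / (1 / x (n + 2) / real n * (real n / real (n + 3))) =
        real (n + 3) * (\<integral>y. cond (n + 3 - 1) y \<partial>Q)) sequentially"
      using eventually_gt_at_top[of 0]
    proof eventually_elim
      case (elim n)
      have "n + 3 - 1 = n + 2" by simp
      then show ?case using elim x_pos[of "n + 2"] by (simp only: x_def[symmetric]) simp
    qed
  qed
qed

text \<open>The mean resistance is the reciprocal of the mean conductance times the mean of
  \<open>U\<close>; the first grows linearly and the second converges to E[1/W].\<close>

theorem mean_resistance:
  assumes "pmf p 1 * m < 1"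
  shows "(\<lambda>n. (\<integral>y. 1 / cond (n - 1) y \<partial>Q) / real n) \<longlonglongrightarrow> a * b / (1 - 1 / m) * (\<integral>y. 1 / Wlim y \<partial>Q)"
proof (rule LIMSEQ_offset[where k = 3])
  have "(\<lambda>n. 1 / x (n + 2) / real n * (real n / real (n + 3)) * (\<integral>y. U (n + 2) y \<partial>Q))
      \<longlonglongrightarrow> a * b / (1 - 1 / m) * 1 * (\<integral>y. 1 / Wlim y \<partial>Q)"
    by (intro tendsto_mult mom.inverse_x_slope shifted_ratio U_mean_tendsto assms)
  then have "(\<lambda>n. 1 / x (n + 2) / real n * (real n / real (n + 3)) * (\<integral>y. U (n + 2) y \<partial>Q))
      \<longlonglongrightarrow> a * b / (1 - 1 / m) * (\<integral>y. 1 / Wlim y \<partial>Q)" by simp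
  then show "(\<lambda>n. (\<integral>y. 1 / cond (n + 3 - 1) y \<partial>Q) / real (n + 3))
      \<longlonglongrightarrow> a * b / (1 - 1 / m) * (\<integral>y. 1 / Wlim y \<partial>Q)"
  proof (rule Lim_transform_eventually)
    show "eventually (\<lambda>n. 1 / x (n + 2) / real n * (real n / real (n + 3)) * (\<integral>y. U (n + 2) y \<partial>Q) =
        (\<integral>y. 1 / cond (n + 3 - 1) y \<partial>Q) / real (n + 3)) sequentially"
      using eventually_gt_at_top[of 0]
    proof eventually_elim
      case (elim n)
      have "n + 3 - 1 = n + 2" by simp
      moreover have "(\<integral>y. U (n + 2) y \<partial>Q) = x (n + 2) * (\<integral>y. 1 / cond (n + 2) y \<partial>Q)"
        unfolding U_def by (subst integral_mult_right_zero[symmetric]) simp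
      ultimately show ?case using elim x_pos[of "n + 2"] by simp
    qed
  qed
qed

end

section \<open>Transfer to the given probability space\<close>

text \<open>The edge set is random, so measurability is proved along the recursion over the children
  of the root, whose number takes countably many values.\<close>

lemma energy_measurable:
  assumes "\<And>u. N u \<in> M \<rightarrow>\<^sub>M count_space UNIV" "\<And>u. X u \<in> borel_measurable M"
  shows "(\<lambda>\<omega>. energy m N X n \<omega> f) \<in> borel_measurable M"
  using assms
proof (induction n arbitrary: N X f)
  case (Suc n)
  have [measurable]: "X u \<in> borel_measurable M" for u by (rule Suc.prems)
  have [measurable]: "(\<lambda>\<omega>. energy m (\<lambda>v. N (v @ [i])) (\<lambda>v. X (v @ [i])) n \<omega> (\<lambda>v. f (v @ [i]))) \<in> borel_measurable M" for i
    by (rule Suc.IH) (rule Suc.prems)+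
  show ?case
    unfolding energy_Suc
    by (rule measurable_compose_countable[where f = "\<lambda>k \<omega>. (\<Sum>i<k. (f [] - f [i])\<^sup>2 / X [i] \<omega> +
       energy m (\<lambda>v. N (v @ [i])) (\<lambda>v. X (v @ [i])) n \<omega> (\<lambda>v. f (v @ [i]))) / m", OF _ Suc.prems(1)]) measurable
qed simp

text \<open>A countable family of potentials that suffices in Dirichlet's principle.\<close>

definition rational_potential :: "nat \<Rightarrow> (nat list \<times> rat) list \<Rightarrow> nat list \<Rightarrow> real" where
  "rational_potential n l x = (if x = [] then 1 else if length x < n then
     (case map_of l x of None \<Rightarrow> 0 | Some q \<Rightarrow> of_rat q) else 0)"

text \<open>On a finite edge set the energy is continuous in finitely many potential values. The
  rational potentials vanish at every label of length \<open>n\<close>, in the tree or not, so one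
  family is admissible for all \<open>\<omega>\<close>.\<close>

lemma energy_rational_approximation:
  assumes f: "f [] = 1" "\<And>x. x \<in> gw_level N n \<omega> \<Longrightarrow> f x = 0"
  shows "\<exists>l. (\<lambda>k. energy m N X n \<omega> (rational_potential n (l k))) \<longlonglongrightarrow> energy m N X n \<omega> f"
proof -
  define E where "E = edges N n \<omega>"
  obtain xs where xs: "set xs = E \<union> tl ` E"
    using finite_list[of "E \<union> tl ` E"] by (auto simp: E_def finite_edges)
  have ex: "\<exists>q. \<bar>of_rat q - f x\<bar> < 1 / real (Suc k)" for k x
  proof -
    obtain q where "f x - 1 / real (Suc k) < of_rat q" "of_rat q < f x + 1 / real (Suc k)"
      using of_rat_dense[of "f x - 1 / real (Suc k)" "f x + 1 / real (Suc k)"] by auto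
    then show ?thesis by (intro exI[of _ q]) (simp only: abs_less_iff, linarith)
  qed
  define q where "q k x = (SOME q. \<bar>of_rat q - f x\<bar> < 1 / real (Suc k))" for k x
  have q: "\<bar>of_rat (q k x) - f x\<bar> < 1 / real (Suc k)" for k x
    unfolding q_def by (rule someI_ex[OF ex])
  have q_lim: "(\<lambda>k. of_rat (q k x) :: real) \<longlonglongrightarrow> f x" for x
  proof -
    have "(\<lambda>k. of_rat (q k x) - f x) \<longlonglongrightarrow> 0"
    proof (rule Lim_null_comparison)
      show "(\<lambda>k. 1 / real (Suc k)) \<longlonglongrightarrow> 0" by (rule LIMSEQ_Suc[OF lim_1_over_n])
      show "eventually (\<lambda>k. norm (of_rat (q k x) - f x) \<le> 1 / real (Suc k)) sequentially"
        using q by (intro always_eventually) (auto intro: less_imp_le)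
    qed
    then show ?thesis by (simp add: LIM_zero_iff)
  qed
  define l where "l k = map (\<lambda>x. (x, q k x)) xs" for k
  have pot: "rational_potential n (l k) x = (if x = [] then 1 else if length x < n then of_rat (q k x) else 0)"
    if "x \<in> set xs" for k x
    using that by (simp add: rational_potential_def l_def map_of_map_restrict)
  have lim: "(\<lambda>k. rational_potential n (l k) x) \<longlonglongrightarrow> f x"
    if x: "x \<in> set xs" "length x \<ge> n \<Longrightarrow> x \<in> gw_level N n \<omega>" for x
    using q_lim[of x] f x(2) unfolding pot[OF x(1)] by (cases "x = []"; cases "length x < n") auto
  have "(\<lambda>k. energy m N X n \<omega> (rational_potential n (l k))) \<longlonglongrightarrow> energy m N X n \<omega> f"
    unfolding energy_def divide_inverse
  proof (intro tendsto_sum tendsto_mult tendsto_power tendsto_diff tendsto_const)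
    fix x assume x: "x \<in> edges N n \<omega>"
    show "(\<lambda>k. rational_potential n (l k) (tl x)) \<longlonglongrightarrow> f (tl x)"
      by (rule lim) (use x in \<open>auto simp: xs E_def edges_def\<close>)
    show "(\<lambda>k. rational_potential n (l k) x) \<longlonglongrightarrow> f x"
      by (rule lim) (use x in \<open>auto simp: xs E_def edges_def gw_level_def\<close>)
  qed
  then show ?thesis by blast
qed

text \<open>\<open>Inf\<close> on the reals unfolds to a least upper bound of the negated set.
  Without any upper bound the defining predicate is constantly false, whichever set it came
  from.\<close>

lemma Inf_not_bdd_below:
  fixes S :: "real set"
  assumes "\<not> bdd_below S"
  shows "Inf S = Inf UNIV"
proof -
  have "\<not> (\<forall>x\<in>uminus ` S. x \<le> z)" for z
  proof
    assume "\<forall>x\<in>uminus ` S. x \<le> z"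
    then have "bdd_below S" by (intro bdd_belowI[of _ "- z"]) (auto simp: minus_le_iff)
    with assms show False by simp
  qed
  then have 1: "(\<forall>x\<in>uminus ` S. x \<le> z) \<longleftrightarrow> False" for z by blast
  have "\<not> (\<forall>x\<in>uminus ` (UNIV :: real set). x \<le> z)" for z
    by (metis UNIV_I image_eqI minus_minus not_le gt_ex)
  then have 2: "(\<forall>x\<in>uminus ` (UNIV :: real set). x \<le> z) \<longleftrightarrow> False" for z by blast
  show ?thesis
    unfolding Inf_real_def Sup_real_def 1 2 ..
qed

text \<open>On the null set where some \<open>X u\<close> is negative, \<open>eff_conductance_eq_branch\<close> fails and the infimum
may even range over a set that is unbounded below, where \<open>Inf\<close> has a fixed junk value. The Bochner
integral nevertheless requires measurability everywhere.\<close>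

lemma eff_conductance_measurable:
  fixes N :: "nat list \<Rightarrow> 'a \<Rightarrow> nat" and X :: "nat list \<Rightarrow> 'a \<Rightarrow> real"
  assumes meas: "\<And>u. N u \<in> M \<rightarrow>\<^sub>M count_space UNIV" "\<And>u. X u \<in> borel_measurable M"
  shows "eff_conductance N (\<lambda>x \<omega>. m ^ length x * X x \<omega>) (Suc n) \<in> borel_measurable M"
proof -
  define S where "S \<omega> = {energy m N X (Suc n) \<omega> f | f. f [] = 1 \<and> (\<forall>x\<in>gw_level N (Suc n) \<omega>. f x = 0)}" for \<omega>
  \<comment> \<open>Taken in the extended reals, a countable infimum is measurable in every case,
    and the value minus infinity records exactly that \<open>S \<omega>\<close> is unbounded
    below.\<close>
  define J where "J \<omega> = (INF l. ereal (energy m N X (Suc n) \<omega> (rational_potential (Suc n) l)))" for \<omega>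
  have [measurable]: "J \<in> borel_measurable M"
    unfolding J_def[abs_def]
    by (intro borel_measurable_INF borel_measurable_ereal energy_measurable meas) auto
  have rat_in_S: "energy m N X (Suc n) \<omega> (rational_potential (Suc n) l) \<in> S \<omega>" for \<omega> l
    unfolding S_def by (rule CollectI, rule exI[of _ "rational_potential (Suc n) l"])
      (auto simp: rational_potential_def gw_level_def)
  have J_le: "J \<omega> \<le> ereal s" if s: "s \<in> S \<omega>" for \<omega> s
  proof -
    obtain f where f: "s = energy m N X (Suc n) \<omega> f" "f [] = 1" "\<And>x. x \<in> gw_level N (Suc n) \<omega> \<Longrightarrow> f x = 0"
      using s by (auto simp: S_def)
    obtain l where l: "(\<lambda>k. energy m N X (Suc n) \<omega> (rational_potential (Suc n) (l k))) \<longlonglongrightarrow> s"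
      using energy_rational_approximation[of f N "Suc n" \<omega> m X] f by blast
    then have "(\<lambda>k. ereal (energy m N X (Suc n) \<omega> (rational_potential (Suc n) (l k)))) \<longlonglongrightarrow> ereal s"
      by simp
    then show ?thesis
      by (rule LIMSEQ_le_const) (auto simp: J_def intro: INF_lower)
  qed
  have eq: "eff_conductance N (\<lambda>x \<omega>. m ^ length x * X x \<omega>) (Suc n) \<omega> =
      (if J \<omega> = -\<infinity> then Inf UNIV else real_of_ereal (J \<omega>))" for \<omega>
  proof -
    have eff: "eff_conductance N (\<lambda>x \<omega>. m ^ length x * X x \<omega>) (Suc n) \<omega> = Inf (S \<omega>)"
      unfolding eff_conductance_def edges_def[symmetric] energy_def[symmetric] S_def ..
    show ?thesis
    proof (cases "bdd_below (S \<omega>)")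
      case True
      have "ereal (Inf (S \<omega>)) = (INF s\<in>S \<omega>. ereal s)"
        by (rule ereal_Inf'[OF True]) (use rat_in_S in blast)
      also have "\<dots> = J \<omega>"
      proof (rule antisym)
        show "(INF s\<in>S \<omega>. ereal s) \<le> J \<omega>"
          unfolding J_def by (intro INF_mono) (use rat_in_S in blast)
        show "J \<omega> \<le> (INF s\<in>S \<omega>. ereal s)"
          by (intro INF_greatest J_le)
      qed
      finally show ?thesis unfolding eff by (metis MInfty_neq_ereal(1) real_of_ereal.simps(1))
    next
      case False
      have "J \<omega> = -\<infinity>"
      proof (rule ccontr)
        assume ninf: "J \<omega> \<noteq> -\<infinity>"
        obtain s where "s \<in> S \<omega>" using rat_in_S by blast
        then have "J \<omega> \<noteq> \<infinity>" using J_le[of s \<omega>] by auto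
        with ninf obtain r where "J \<omega> = ereal r" by (cases "J \<omega>") auto
        then have "bdd_below (S \<omega>)" using J_le by (intro bdd_belowI[of _ r]) force
        with False show False by simp
      qed
      then show ?thesis unfolding eff using Inf_not_bdd_below[OF False] by simp
    qed
  qed
  show ?thesis unfolding eq[abs_def] by measurable
qed

theorem theorem1p2:
  fixes M :: "'a measure" and p :: "nat pmf"
    and N :: "nat list \<Rightarrow> 'a \<Rightarrow> nat" and X :: "nat list \<Rightarrow> 'a \<Rightarrow> real"
  defines "m \<equiv> measure_pmf.expectation p real"
  defines "a1 \<equiv> measure_pmf.expectation p (\<lambda>k. real k * (real k - 1)) / m ^ 2"
  defines "b1 \<equiv> prob_space.expectation M (X [])"
  defines "c1 \<equiv> a1 * b1 / (1 - 1 / m)"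
  defines "r \<equiv> (\<lambda>x \<omega>. m ^ length x * X x \<omega>)"
  assumes M: "prob_space M"
    and p0: "pmf p 0 = 0"
    and mean_fin: "integrable (measure_pmf p) real"
    and m_gt1: "m > 1"
    and N_meas: "\<And>u. N u \<in> M \<rightarrow>\<^sub>M count_space UNIV"
    and X_meas: "\<And>u. X u \<in> borel_measurable M"
    and N_distr: "\<And>u. distr M (count_space UNIV) (N u) = measure_pmf p"
    and X_distr: "\<And>u. distr M borel (X u) = distr M borel (X [])"
    and X_pos: "AE \<omega> in M. X [] \<omega> > 0"
    and indep: "prob_space.indep_vars M (\<lambda>_. borel)
                  (\<lambda>i \<omega>. case i of Inl u \<Rightarrow> real (N u \<omega>) | Inr u \<Rightarrow> X u \<omega>) UNIV"
    and moments: "integrable M (\<lambda>\<omega>. (X [] \<omega>)^2 + 1 / X [] \<omega> + real (N [] \<omega>) ^ 3)"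
  shows "((\<lambda>n. real n * prob_space.expectation M (eff_conductance N r n))
            \<longlonglongrightarrow> 1 / c1) \<and>
         (pmf p 1 * m < 1 \<longrightarrow>
           integrable M (\<lambda>\<omega>. 1 / gw_W N m \<omega>) \<and>
           (\<lambda>n. prob_space.expectation M (eff_resistance N r n) / real n)
             \<longlonglongrightarrow> c1 * prob_space.expectation M (\<lambda>\<omega>. 1 / gw_W N m \<omega>))"
proof -
  interpret M: prob_space M by (rule M)
  note [measurable] = X_meas N_meas
  have N_real [measurable]: "(\<lambda>\<omega>. real (N u \<omega>)) \<in> borel_measurable M" for u
    by measurable
  \<comment> \<open>Where \<open>X [] > 0\<close>, the three terms of the joint moment hypothesis
    are nonnegative, so each is dominated by their sum and integrable on its own.\<close>
  have bound: "integrable M g"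
    if [measurable]: "g \<in> borel_measurable M"
      and "AE \<omega> in M. X [] \<omega> > 0 \<longrightarrow> 0 \<le> g \<omega> \<and> g \<omega> \<le> (X [] \<omega>)^2 + 1 / X [] \<omega> + real (N [] \<omega>) ^ 3"
    for g :: "'a \<Rightarrow> real"
  proof (rule Bochner_Integration.integrable_bound[OF moments])
    show "AE \<omega> in M. norm (g \<omega>) \<le> norm ((X [] \<omega>)^2 + 1 / X [] \<omega> + real (N [] \<omega>) ^ 3)"
      using X_pos that(2) by eventually_elim auto
  qed measurable
  have X_sq: "integrable M (\<lambda>\<omega>. (X [] \<omega>)\<^sup>2)" and X_inv: "integrable M (\<lambda>\<omega>. 1 / X [] \<omega>)"
    and N_cube: "integrable M (\<lambda>\<omega>. real (N [] \<omega>) ^ 3)"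
    by (rule bound; auto)+
  interpret branching_environment p "distr M borel (X [])" m
  proof (rule branching_environment.intro)
    show "prob_space (distr M borel (X []))" by (rule M.prob_space_distr) simp
    show "AE x in distr M borel (X []). x > 0" using X_pos by (simp add: AE_distr_iff)
    show "integrable (distr M borel (X [])) (\<lambda>x. x\<^sup>2)" using X_sq by (simp add: integrable_distr_eq)
    show "integrable (distr M borel (X [])) (\<lambda>x. 1 / x)" using X_inv by (simp add: integrable_distr_eq)
    show "integrable p (\<lambda>k. real k ^ 3)"
      unfolding N_distr[of "[]", symmetric] using N_cube by (subst integrable_distr_eq) auto
    show "m = measure_pmf.expectation p real" by (simp add: m_def)
  qed (simp_all add: p0 m_gt1)
  have env_sum: "(\<lambda>\<omega> s. case s of Inl u \<Rightarrow> real (N u \<omega>) | Inr u \<Rightarrow> X u \<omega>) = environment N X"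
    by (simp add: environment_def fun_eq_iff)
  have rv: "(\<lambda>\<omega>. case s of Inl u \<Rightarrow> real (N u \<omega>) | Inr u \<Rightarrow> X u \<omega>) \<in> borel_measurable M" for s
    by (cases s) auto
  have law: "distr M borel (\<lambda>\<omega>. case s of Inl u \<Rightarrow> real (N u \<omega>) | Inr u \<Rightarrow> X u \<omega>) = D s" for s
  proof (cases s)
    case (Inl u)
    have "distr M borel (\<lambda>\<omega>. real (N u \<omega>)) = distr (distr M (count_space UNIV) (N u)) borel real"
      by (subst distr_distr) (auto simp: comp_def)
    then show ?thesis by (simp add: Inl D_def N_distr)
  next
    case (Inr u)
    show ?thesis unfolding Inr D_def sum.case by (rule X_distr)
  qed
  \<comment> \<open>Independence together with the marginal laws identifies the law of the
    environment as \<open>Q\<close>, so expectations of functions of the environment can be computed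
    there.\<close>
  have "distr M (PiM UNIV (\<lambda>_. borel)) (\<lambda>\<omega>. \<lambda>s\<in>UNIV. case s of Inl u \<Rightarrow> real (N u \<omega>) | Inr u \<Rightarrow> X u \<omega>) = Q"
    using M.indep_vars_iff_distr_eq_PiM[where I = UNIV and M' = "\<lambda>_. borel", THEN iffD1, OF UNIV_not_empty rv indep]
    unfolding law Q_def .
  then have "distr M (PiM UNIV (\<lambda>_. borel)) (environment N X) = Q"
    by (simp add: restrict_UNIV env_sum)
  moreover have "distr M (PiM UNIV (\<lambda>_. borel)) (environment N X) = distr M Q (environment N X)"
    by (rule distr_cong) (auto simp: sets_Q)
  ultimately have env_law: "distr M Q (environment N X) = Q" by simp
  have "(\<lambda>\<omega>. \<lambda>s\<in>UNIV. case s of Inl u \<Rightarrow> real (N u \<omega>) | Inr u \<Rightarrow> X u \<omega>) \<in> measurable M (PiM UNIV (\<lambda>_. borel))"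
    by (rule measurable_restrict) (rule rv)
  then have env_meas [measurable]: "environment N X \<in> measurable M Q"
    unfolding measurable_cong_sets[OF refl sets_Q] by (simp only: restrict_UNIV env_sum)
  have transfer: "(\<integral>\<omega>. F (environment N X \<omega>) \<partial>M) = (\<integral>y. F y \<partial>Q)"
    "integrable M (\<lambda>\<omega>. F (environment N X \<omega>)) \<longleftrightarrow> integrable Q F"
    if [measurable]: "F \<in> borel_measurable Q" for F :: "_ \<Rightarrow> real"
    using integral_distr[OF env_meas that] integrable_distr_eq[OF env_meas that] by (simp_all add: env_law)
  have pos: "AE \<omega> in M. \<forall>u. X u \<omega> > 0"
  proof -
    have "AE y in distr M Q (environment N X). positive_env y"
      unfolding env_law by (rule AE_positive_env)
    then have "AE \<omega> in M. positive_env (environment N X \<omega>)"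
      by (rule AE_distrD[OF env_meas])
    then show ?thesis by eventually_elim (auto dest: positive_env_resistance)
  qed
  have C_meas: "eff_conductance N r (Suc n) \<in> borel_measurable M" for n
    unfolding r_def by (rule eff_conductance_measurable) (rule N_meas X_meas)+
  have cond_meas [measurable]: "(\<lambda>\<omega>. cond n (environment N X \<omega>)) \<in> borel_measurable M" for n
    by (rule measurable_compose[OF env_meas branch_measurable[OF planted_measurable]])
  have C_AE: "AE \<omega> in M. eff_conductance N r (Suc n) \<omega> = cond n (environment N X \<omega>)" for n
    using pos by eventually_elim (use m_gt1 in \<open>auto simp: r_def intro!: eff_conductance_eq_branch\<close>)
  have C_mean: "(\<integral>\<omega>. eff_conductance N r (Suc n) \<omega> \<partial>M) = (\<integral>y. cond n y \<partial>Q)" for n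
  proof -
    have "(\<integral>\<omega>. eff_conductance N r (Suc n) \<omega> \<partial>M) = (\<integral>\<omega>. cond n (environment N X \<omega>) \<partial>M)"
      by (rule integral_cong_AE[OF C_meas cond_meas C_AE])
    then show ?thesis by (simp add: transfer(1))
  qed
  have R_mean: "(\<integral>\<omega>. eff_resistance N r (Suc n) \<omega> \<partial>M) = (\<integral>y. 1 / cond n y \<partial>Q)" for n
  proof -
    have "(\<integral>\<omega>. eff_resistance N r (Suc n) \<omega> \<partial>M) = (\<integral>\<omega>. 1 / cond n (environment N X \<omega>) \<partial>M)"
      unfolding eff_resistance_def
    proof (rule integral_cong_AE)
      show "AE \<omega> in M. 1 / eff_conductance N r (Suc n) \<omega> = 1 / cond n (environment N X \<omega>)"
        using C_AE[of n] by eventually_elim simp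
      show "(\<lambda>\<omega>. 1 / eff_conductance N r (Suc n) \<omega>) \<in> borel_measurable M"
        using C_meas[of n] by measurable
    qed measurable
    then show ?thesis by (simp add: transfer(1)[of "\<lambda>y. 1 / cond n y"])
  qed
  \<comment> \<open>Both sides are \<open>lim\<close> of the same sequence, so they agree at every
    \<open>\<omega>\<close>, convergent or not.\<close>
  have W: "gw_W N m \<omega> = Wlim (environment N X \<omega>)" for \<omega>
    unfolding gw_W_def Wlim_def card_gw_level[of N _ \<omega> m X] ..
  have b: "b = b1"
    unfolding b_def b1_def by (subst integral_distr) simp_all
  have c1: "a * b / (1 - 1 / m) = c1"
    by (simp add: b c1_def a1_def a_def)
  \<comment> \<open>The identification with \<open>cond (n - 1)\<close> holds for positive
    \<open>n\<close>; at level 0 the effective conductance is a default value.\<close>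
  have "(\<lambda>n. real n * M.expectation (eff_conductance N r n)) \<longlonglongrightarrow> 1 / c1"
  proof (rule Lim_transform_eventually)
    show "(\<lambda>n. real n * (\<integral>y. cond (n - 1) y \<partial>Q)) \<longlonglongrightarrow> 1 / c1"
      using mean_conductance by (simp only: c1)
    show "eventually (\<lambda>n. real n * (\<integral>y. cond (n - 1) y \<partial>Q) = real n * M.expectation (eff_conductance N r n)) sequentially"
      using eventually_gt_at_top[of 0] by eventually_elim (metis C_mean Suc_diff_1)
  qed
  moreover have "integrable M (\<lambda>\<omega>. 1 / gw_W N m \<omega>) \<and>
      (\<lambda>n. M.expectation (eff_resistance N r n) / real n) \<longlonglongrightarrow> c1 * M.expectation (\<lambda>\<omega>. 1 / gw_W N m \<omega>)"
    if p1m: "pmf p 1 * m < 1"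
  proof
    show "integrable M (\<lambda>\<omega>. 1 / gw_W N m \<omega>)"
      unfolding W using transfer(2)[of "\<lambda>y. 1 / Wlim y"] U_mean_tendsto(1)[OF p1m] by simp
    have "M.expectation (\<lambda>\<omega>. 1 / gw_W N m \<omega>) = (\<integral>y. 1 / Wlim y \<partial>Q)"
      unfolding W by (rule transfer(1)) measurable
    moreover have "(\<lambda>n. M.expectation (eff_resistance N r n) / real n) \<longlonglongrightarrow> c1 * (\<integral>y. 1 / Wlim y \<partial>Q)"
    proof (rule Lim_transform_eventually)
      show "(\<lambda>n. (\<integral>y. 1 / cond (n - 1) y \<partial>Q) / real n) \<longlonglongrightarrow> c1 * (\<integral>y. 1 / Wlim y \<partial>Q)"
        using mean_resistance[OF p1m] by (simp only: c1)
      show "eventually (\<lambda>n. (\<integral>y. 1 / cond (n - 1) y \<partial>Q) / real n = M.expectation (eff_resistance N r n) / real n) sequentially"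
        using eventually_gt_at_top[of 0] by eventually_elim (metis R_mean Suc_diff_1)
    qed
    ultimately show "(\<lambda>n. M.expectation (eff_resistance N r n) / real n)
        \<longlonglongrightarrow> c1 * M.expectation (\<lambda>\<omega>. 1 / gw_W N m \<omega>)" by simp
  qed
  ultimately show ?thesis by blast
qed

end
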